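(* Let $C_1>0$ and $C_4,C_{\mathcal R}\ge 1$ be constants with the following two properties (such constants exist). (A1) For all $\mathcal{T}\in\mathbb{T}(\mathcal{T}_0)$, all $\hat{\mathcal{T}}\in\mathbb{T}(\mathcal{T})$, all $\mathcal{S}\subseteq\mathcal{T}\cap\hat{\mathcal{T}}$, all $z\in X(\mathcal{T})$ and all $\hat z\in X(\hat{\mathcal{T}})$, $$\Big|\Big(\sum_{T\in\mathcal{S}}\eta_T(\hat{\mathcal{T}};\hat z)^2\Big)^{1/2}-\Big(\sum_{T\in\mathcal{S}}\eta_T(\mathcal{T};z)^2\Big)^{1/2}\Big|\le C_1\,\mathrm{d}[\hat z,z].$$ (A4) For all $\mathcal{T}\in\mathbb{T}(\mathcal{T}_0)$ and all $\hat{\mathcal{T}}\in\mathbb{T}(\mathcal{T})$ there is a set $\mathcal{R}(\mathcal{T},\hat{\mathcal{T}})$ with $\mathcal{T}\setminus\hat{\mathcal{T}}\subseteq\mathcal{R}(\mathcal{T},\hat{\mathcal{T}})\subseteq\mathcal{T}$, $|\mathcal{R}(\mathcal{T},\hat{\mathcal{T}})|\le C_{\mathcal R}|\mathcal{T}\setminus\hat{\mathcal{T}}|$ and $$\mathrm{d}[U(\hat{\mathcal{T}}),U(\mathcal{T})]^2\le C_4^2\sum_{T\in\mathcal{R}(\mathcal{T},\hat{\mathcal{T}})}\eta_T(\mathcal{T};U(\mathcal{T}))^2.$$ Let $0<\theta<(1+C_1^2C_4^2)^{-1}$ and let $(\mathcal{T}_\ell)_{\ell\in\mathbb{N}_0}$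 be the sequence of meshes generated by the adaptive algorithm with bulk parameter $\theta$. Then for all $s>0$, $$\|(u,U(\cdot))\|_{\mathbb{B}_s}\lesssim\sup_{\ell\in\mathbb{N}_0}\eta(\mathcal{T}_\ell;U(\mathcal{T}_\ell))\,\big(|\mathcal{T}_\ell|-|\mathcal{T}_0|+1\big)^s\lesssim\|(u,U(\cdot))\|_{\mathbb{B}_s},$$ where $$\|(u,U(\cdot))\|_{\mathbb{B}_s}:=\sup_{N\in\mathbb{N}_0}\ \min_{\mathcal{T}\in\mathbb{T}(N)}(N+1)^s\,\eta(\mathcal{T};U(\mathcal{T})),\qquad \mathbb{T}(N):=\{\mathcal{T}\in\mathbb{T}(\mathcal{T}_0)\mid |\mathcal{T}|-|\mathcal{T}_0|\le N\}.$$
   Context: **Convention.** $X\lesssim Y$ means $X\le C\,Y$ for some constant $C>0$ which is independent of $Y$. For a finite set $\mathcal{M}$ of elements, $|\mathcal{M}|$ is its cardinality; for an element $T$, $|T|$ is its measure; for a matrix $q$, $|q|$ is the Frobenius norm, and $\tau:\mu$ is the Frobenius inner product. **Continuous problem.** Let $d\in\{2,3\}$ and let $\Omega\subset\mathbb{R}^d$ be a domain with Lipschitz boundary $\partial\Omega$, which is split into a closed non-empty part $\Gamma_D\subset\partial\Omega$ of positive surface measure and an open part $\Gamma_N:=\partial\Omega\setminus\Gamma_D$ (possibly empty). Let $f\in L^2(\Omega;\mathbb{R}^d)$, $g\in L^2(\Gamma_N;\mathbb{R}^d)$. Put $\mathbb{S}_d:=\{q\in\mathbb{R}^{d\times d}\mid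 q_{ji}=q_{ij}\}$, $\mathbb{S}_{d,0}:=\{q\in\mathbb{S}_d\mid \sum_{j=1}^d q_{jj}=0\}$, $V:=\{v\in H^1(\Omega;\mathbb{R}^d)\mid v=0\text{ on }\Gamma_D\}$, $Q:=L^2(\Omega;\mathbb{S}_{d,0})$, $M:=L^2(\Omega)$, $X:=V\times Q\times M$. For $w\in V$, $\varepsilon(w):=\frac12(\nabla w+(\nabla w)^T)$. Let $\mathbb{C}$ be the isotropic elasticity tensor, symmetric and constant, with $\kappa_{\mathbb{C}}|\tau|^2\le\mathbb{C}\tau:\tau$ for all $\tau\in L^2(\Omega;\mathbb{S}_d)$, and $\mathbb{H}$ the hardening tensor, symmetric with $\kappa_{\mathbb{H}}|\tau|^2\le\mathbb{H}\tau:\tau$ for all $\tau\in L^2(\Omega;\mathbb{S}_d)$, where $\kappa_{\mathbb{C}},\kappa_{\mathbb{H}}>0$ are constants. Let $H>0$ be the isotropic hardening modulus and $\sigma_y>0$ the constant yield stress. The stress is $\sigma(w,p):=\mathbb{C}(\varepsilon(w)-p)$. Let $j(q,\beta):=\sigma_y|q|$ if $|q|\le\beta$ and $j(q,\beta):=\infty$ otherwise. For $u=(w,p,\alpha)$, $z=(v,q,\beta)\in X$ let $$a(u,z):=(\sigma(w,p),\varepsilon(v)-q)_{L^2(\Omega)}+(\mathbb{H}p,q)_{L^2(\Omega)}+(H\alpha,\beta)_{L^2(\Omega)},$$ $$\psi(z):=\int_\Omega j(q,\beta)\,dx,\qquad b(z):=(f,v)_{L^2(\Omega)}+(g,v)_{L^2(\Gamma_N)}.$$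 $u\in X$ denotes the unique solution of $b(z-u)\le a(u,z-u)+\psi(z)-\psi(u)$ for all $z\in X$. **Meshes and refinement.** A mesh $\mathcal{T}$ is a finite decomposition of $\Omega$, $\overline\Omega=\bigcup_{T\in\mathcal{T}}T$, into closed triangles ($d=2$) or tetrahedra ($d=3$), which is conforming, i.e. the intersection of two elements is either empty or a common face, edge or vertex. Each $T\in\mathcal{T}$ has a fixed edge $E_T$ (the reference edge). For a set $\mathcal{M}\subset\mathcal{T}$ of elements to be refined, newest vertex bisection (for dimension $d\ge2$ in the generalization of Maubach, Traxler and Stevenson) generates the new mesh $\operatorname{NVB}(\mathcal{T},\mathcal{M})$ as follows. First, each $T\in\mathcal{M}$ is bisected into two triangles or tetrahedra, where the midpoint of $E_T$ (the newest vertex) is connected to the vertex opposite to $E_T$; the edges opposite to the newest vertex are the reference edges of the new triangles or tetrahedra. Second, in the same way all elements of the resulting mesh which have a hanging node (a vertex of the mesh in the interior of an edge of the element) are bisected, until there are no hanging nodes. $\mathbb{T}(\mathcal{T})$ is the set of all meshes created from $\mathcal{T}$ by finitely many successive applications of newest vertex bisection. Properties of this refinement: $|\mathcal{T}\setminus\hat{\mathcal{T}}|\le|\hat{\mathcal{T}}|-|\mathcal{T}|$ for $\hat{\mathcal{T}}\in\mathbb{T}(\mathcal{T})$; the meshes in $\mathbb{T}(\mathcal{T})$ are uniformly shape regular (there is $c>0$ with $h_T\le c\,\rho_T$ for all elements $T$ of all these meshes, $h_T$ being the diameter and $\rho_T$ the inradius of $T$); $|\operatorname{NVB}(\mathcal{T},\mathcal{M})|-|\mathcal{T}|\le(C_{\rm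 son}-1)|\mathcal{T}|$ with a constant $C_{\rm son}>0$; any $\mathcal{T}',\mathcal{T}''\in\mathbb{T}(\mathcal{T})$ have a coarsest common refinement $\mathcal{T}'\oplus\mathcal{T}''$ with $|\mathcal{T}'\oplus\mathcal{T}''|\le|\mathcal{T}'|+|\mathcal{T}''|-|\mathcal{T}|$; and for the adaptive meshes below $|\mathcal{T}_\ell|-|\mathcal{T}_0|\le C_{\rm mesh}\sum_{k=0}^{\ell-1}|\mathcal{M}_k|$ for all $\ell\in\mathbb{N}$, with a constant $C_{\rm mesh}>0$ depending on $\mathbb{T}(\mathcal{T}_0)$. $\mathcal{T}_0$ is the initial mesh. **Discrete problem.** $X(\mathcal{T}):=V(\mathcal{T})\times Q(\mathcal{T})\times M(\mathcal{T})$, where $V(\mathcal{T})$ consists of the functions in $V$ that are affine on every element, and $Q(\mathcal{T})$, $M(\mathcal{T})$ consist of the functions with values in $\mathbb{S}_{d,0}$, resp. $\mathbb{R}$, that are constant on every element. $U(\mathcal{T})\in X(\mathcal{T})$ is the unique solution of $b(z-U(\mathcal{T}))\le a(U(\mathcal{T}),z-U(\mathcal{T}))+\psi(z)-\psi(U(\mathcal{T}))$ for all $z\in X(\mathcal{T})$. **Error measure and estimator.** For $z=(v,q,\beta)$, $\hat z=(\hat v,\hat q,\hat\beta)\in X$: $\mathrm{d}[z,\hat z]:=\|\sigma(v,q)-\sigma(\hat v,\hat q)\|_{L^2(\Omega;\mathbb{R}^{d\times d})}$. For $T\in\mathcal{T}$ and $z=(v,q,\beta)\in X(\mathcal{T})$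 (for both $d=2$ and $d=3$), $$\eta_T(\mathcal{T};z)^2:=|T|\,\|f\|_{L^2(T;\mathbb{R}^d)}^2+|T|^{1/2}\sum_{E\in\mathcal{E}(T)}R_E(z)^2,\qquad \eta(\mathcal{T};z)^2:=\sum_{T\in\mathcal{T}}\eta_T(\mathcal{T};z)^2,$$ where $\mathcal{E}(T)$ is the set of edges ($d=2$) or faces ($d=3$) of $T$, and, with $\nu_E$ the fixed unit normal corresponding to $E$, $R_E(z):=\|[\sigma(v,q)]\nu_E\|_{L^2(E;\mathbb{R}^d)}$ for interior $E$ ($[\cdot]$ the jump along $E$), $R_E(z):=\|g-\sigma(v,q)\nu_E\|_{L^2(E;\mathbb{R}^d)}$ for $E$ on $\Gamma_N$, $R_E(z):=0$ for $E$ on $\Gamma_D$. **Adaptive algorithm.** Given $0<\theta\le1$ and $\mathcal{T}_0$, for $\ell\in\mathbb{N}_0$ let $\mathcal{M}_\ell\subset\mathcal{T}_\ell$ be a set of minimal cardinality with $\theta\,\eta(\mathcal{T}_\ell;U(\mathcal{T}_\ell))^2\le\sum_{T\in\mathcal{M}_\ell}\eta_T(\mathcal{T}_\ell;U(\mathcal{T}_\ell))^2$, and $\mathcal{T}_{\ell+1}:=\operatorname{NVB}(\mathcal{T}_\ell,\mathcal{M}_\ell)$. *)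

theory Defs
  imports "HOL-Analysis.Analysis" "HOL-Library.While_Combinator"
begin

section \<open>Surface measure, Lipschitz domains, Sobolev functions\<close>

text \<open>The \<open>m\<close>-dimensional Hausdorff outer measure, normalised so that it is the
  \<open>m\<close>-dimensional area on \<open>m\<close>-dimensional flat pieces.\<close>

definition hausdorff_pre :: "nat \<Rightarrow> real \<Rightarrow> 'a::metric_space set \<Rightarrow> ennreal" where
  "hausdorff_pre m \<delta> A =
     (INF C \<in> {C :: nat \<Rightarrow> 'a set. A \<subseteq> (\<Union>i. C i) \<and> (\<forall>i. bounded (C i) \<and> diameter (C i) \<le> \<delta>)}.
        \<Sum>i. ennreal (unit_ball_vol (real m) * (diameter (C i) / 2) ^ m))"

definition hausdorff_outer :: "nat \<Rightarrow> 'a::metric_space set \<Rightarrow> ennreal" where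
  "hausdorff_outer m A = (SUP \<delta>\<in>{0<..}. hausdorff_pre m \<delta> A)"

text \<open>The outer measure is a metric outer measure, hence countably additive on Borel sets, so
  \<^const>\<open>measure_of\<close> yields the surface measure and not the default null measure.\<close>

definition surface_measure :: "(real^'n) measure" where
  "surface_measure = measure_of UNIV (sets borel) (hausdorff_outer (CARD('n) - 1))"

text \<open>Near every boundary point the domain is the strict epigraph, in some direction \<open>e\<close>, of a
  Lipschitz function \<open>h\<close> of the component orthogonal to \<open>e\<close>.\<close>

definition lipschitz_domain :: "(real^'n) set \<Rightarrow> bool" where
  "lipschitz_domain \<Omega> \<longleftrightarrow> open \<Omega> \<and> connected \<Omega> \<and> \<Omega> \<noteq> {} \<and> bounded \<Omega> \<and>
     (\<forall>x\<in>frontier \<Omega>. \<exists>r>0. \<exists>e h L. norm e = 1 \<and> L-lipschitz_on UNIV h \<and>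
        \<Omega> \<inter> ball x r = {y \<in> ball x r. h (y - (y \<bullet> e) *\<^sub>R e) < y \<bullet> e})"

definition L2 :: "'a measure \<Rightarrow> ('a \<Rightarrow> 'b::euclidean_space) \<Rightarrow> bool" where
  "L2 M F \<longleftrightarrow> F \<in> borel_measurable M \<and> integrable M (\<lambda>x. (norm (F x))\<^sup>2)"

definition L2_inner :: "'a measure \<Rightarrow> ('a \<Rightarrow> 'b::euclidean_space) \<Rightarrow> ('a \<Rightarrow> 'b) \<Rightarrow> real" where
  "L2_inner M F G = (LINT x|M. F x \<bullet> G x)"

definition L2_nrm :: "'a measure \<Rightarrow> ('a \<Rightarrow> 'b::euclidean_space) \<Rightarrow> real" where
  "L2_nrm M F = sqrt (LINT x|M. (norm (F x))\<^sup>2)"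

text \<open>Test functions are continuously differentiable with compact support in \<open>\<Omega>\<close>; by
  mollification they define the same weak derivatives as the infinitely differentiable ones.
  The function \<open>d\<phi>\<close> is the gradient of \<open>\<phi>\<close>.\<close>

definition test_function :: "(real^'n) set \<Rightarrow> (real^'n \<Rightarrow> real) \<Rightarrow> (real^'n \<Rightarrow> real^'n) \<Rightarrow> bool" where
  "test_function \<Omega> \<phi> d\<phi> \<longleftrightarrow>
     (\<forall>x. (\<phi> has_derivative (\<lambda>h. d\<phi> x \<bullet> h)) (at x)) \<and> continuous_on UNIV d\<phi> \<and>
     (\<exists>K. compact K \<and> K \<subseteq> \<Omega> \<and> (\<forall>x. x \<notin> K \<longrightarrow> \<phi> x = 0))"

definition weak_gradient ::
    "(real^'n) set \<Rightarrow> (real^'n \<Rightarrow> real^'n) \<Rightarrow> (real^'n \<Rightarrow> real^'n^'n) \<Rightarrow> bool" where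
  "weak_gradient \<Omega> v G \<longleftrightarrow> L2 (lebesgue_on \<Omega>) G \<and>
     (\<forall>\<phi> d\<phi>. test_function \<Omega> \<phi> d\<phi> \<longrightarrow>
        (\<forall>i j. (LINT x|lebesgue_on \<Omega>. v x $ i * d\<phi> x $ j) =
               - (LINT x|lebesgue_on \<Omega>. G x $ i $ j * \<phi> x)))"

definition H1 :: "(real^'n) set \<Rightarrow> (real^'n \<Rightarrow> real^'n) \<Rightarrow> bool" where
  "H1 \<Omega> v \<longleftrightarrow> L2 (lebesgue_on \<Omega>) v \<and> (\<exists>G. weak_gradient \<Omega> v G)"

definition grad :: "(real^'n) set \<Rightarrow> (real^'n \<Rightarrow> real^'n) \<Rightarrow> real^'n \<Rightarrow> real^'n^'n" where
  "grad \<Omega> v = (SOME G. weak_gradient \<Omega> v G)"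

definition sym_grad :: "(real^'n) set \<Rightarrow> (real^'n \<Rightarrow> real^'n) \<Rightarrow> real^'n \<Rightarrow> real^'n^'n" where
  "sym_grad \<Omega> v x = (1/2) *\<^sub>R (grad \<Omega> v x + transpose (grad \<Omega> v x))"

text \<open>The trace of a Sobolev function on the boundary of a Lipschitz domain, by its pointwise
  description as the limit of means over the part of small balls inside the domain.  The limit
  exists at surface-almost every boundary point (Evans and Gariepy, Section 5.3), and at every
  boundary point if \<open>v\<close> is continuous on the closure.\<close>

definition ball_mean :: "(real^'n) set \<Rightarrow> (real^'n \<Rightarrow> real^'n) \<Rightarrow> real^'n \<Rightarrow> real \<Rightarrow> real^'n" where
  "ball_mean \<Omega> v x r =
     (1 / measure lebesgue (ball x r \<inter> \<Omega>)) *\<^sub>R (LINT y|lebesgue_on (ball x r \<inter> \<Omega>). v y)"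

definition has_bd_trace :: "(real^'n) set \<Rightarrow> (real^'n \<Rightarrow> real^'n) \<Rightarrow> real^'n \<Rightarrow> real^'n \<Rightarrow> bool" where
  "has_bd_trace \<Omega> v x y \<longleftrightarrow> (ball_mean \<Omega> v x \<longlongrightarrow> y) (at_right 0)"

definition bd_trace :: "(real^'n) set \<Rightarrow> (real^'n \<Rightarrow> real^'n) \<Rightarrow> real^'n \<Rightarrow> real^'n" where
  "bd_trace \<Omega> v x = (THE y. has_bd_trace \<Omega> v x y)"


section \<open>The elastoplastic problem\<close>

text \<open>The inner product and the norm of the type \<^typ>\<open>real^'n^'n\<close> are the Frobenius ones.\<close>

definition sym_mats :: "(real^'n^'n) set" where
  "sym_mats = {q. transpose q = q}"

definition dev_mats :: "(real^'n^'n) set" where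
  "dev_mats = {q. transpose q = q \<and> trace q = 0}"

text \<open>Everything but the loads.  The isotropic elasticity tensor is given by its Lame
  coefficients.\<close>

record ('n::finite) plasticity =
  Dom :: "(real^'n) set"
  GamD :: "(real^'n) set"
  lame_lambda :: real
  lame_mu :: real
  hard_tensor :: "real^'n \<Rightarrow> real^'n^'n \<Rightarrow> real^'n^'n"
  hard_modulus :: real
  yield_stress :: real

definition GamN :: "('n::finite) plasticity \<Rightarrow> (real^'n) set" where
  "GamN P = frontier (Dom P) - GamD P"

definition elast :: "('n::finite) plasticity \<Rightarrow> real^'n^'n \<Rightarrow> real^'n^'n" where
  "elast P \<tau> = (lame_lambda P * trace \<tau>) *\<^sub>R mat 1 + (2 * lame_mu P) *\<^sub>R \<tau>"

definition coercive_tensor ::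
    "(real^'n) set \<Rightarrow> (real^'n \<Rightarrow> real^'n^'n \<Rightarrow> real^'n^'n) \<Rightarrow> real \<Rightarrow> bool" where
  "coercive_tensor \<Omega> B \<kappa> \<longleftrightarrow>
     (\<forall>\<tau>. L2 (lebesgue_on \<Omega>) \<tau> \<and> (AE x in lebesgue_on \<Omega>. \<tau> x \<in> sym_mats) \<longrightarrow>
        (AE x in lebesgue_on \<Omega>. \<kappa> * (norm (\<tau> x))\<^sup>2 \<le> B x (\<tau> x) \<bullet> \<tau> x))"

definition plasticity_setting :: "('n::finite) plasticity \<Rightarrow> bool" where
  "plasticity_setting P \<longleftrightarrow>
     lipschitz_domain (Dom P) \<and>
     closed (GamD P) \<and> GamD P \<noteq> {} \<and> GamD P \<subseteq> frontier (Dom P) \<and>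
     emeasure surface_measure (GamD P) > 0 \<and>
     (\<exists>\<kappa>>0. coercive_tensor (Dom P) (\<lambda>x. elast P) \<kappa>) \<and>
     (AE x in lebesgue_on (Dom P). linear (hard_tensor P x) \<and>
        (\<forall>\<tau>\<in>sym_mats. \<forall>\<mu>\<in>sym_mats. hard_tensor P x \<tau> \<bullet> \<mu> = \<tau> \<bullet> hard_tensor P x \<mu>)) \<and>
     (\<exists>\<kappa>>0. coercive_tensor (Dom P) (hard_tensor P) \<kappa>) \<and>
     hard_modulus P > 0 \<and> yield_stress P > 0"

type_synonym 'n state =
  "(real^'n \<Rightarrow> real^'n) \<times> (real^'n \<Rightarrow> real^'n^'n) \<times> (real^'n \<Rightarrow> real)"

definition V_space :: "('n::finite) plasticity \<Rightarrow> (real^'n \<Rightarrow> real^'n) set" where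
  "V_space P = {v. H1 (Dom P) v \<and>
     (AE x in restrict_space surface_measure (GamD P). has_bd_trace (Dom P) v x 0)}"

definition Q_space :: "('n::finite) plasticity \<Rightarrow> (real^'n \<Rightarrow> real^'n^'n) set" where
  "Q_space P = {q. L2 (lebesgue_on (Dom P)) q \<and> (AE x in lebesgue_on (Dom P). q x \<in> dev_mats)}"

definition M_space :: "('n::finite) plasticity \<Rightarrow> (real^'n \<Rightarrow> real) set" where
  "M_space P = {\<beta>. L2 (lebesgue_on (Dom P)) \<beta>}"

definition X_space :: "('n::finite) plasticity \<Rightarrow> 'n state set" where
  "X_space P = V_space P \<times> Q_space P \<times> M_space P"

definition stress :: "('n::finite) plasticity \<Rightarrow> 'n state \<Rightarrow> real^'n \<Rightarrow> real^'n^'n" where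
  "stress P z x = (case z of (w, p, \<alpha>) \<Rightarrow> elast P (sym_grad (Dom P) w x - p x))"

definition a_form :: "('n::finite) plasticity \<Rightarrow> 'n state \<Rightarrow> 'n state \<Rightarrow> real" where
  "a_form P u z = (case u of (w, p, \<alpha>) \<Rightarrow> case z of (v, q, \<beta>) \<Rightarrow>
     L2_inner (lebesgue_on (Dom P)) (stress P u) (\<lambda>x. sym_grad (Dom P) v x - q x) +
     L2_inner (lebesgue_on (Dom P)) (\<lambda>x. hard_tensor P x (p x)) q +
     L2_inner (lebesgue_on (Dom P)) (\<lambda>x. hard_modulus P * \<alpha> x) \<beta>)"

definition dissipation :: "('n::finite) plasticity \<Rightarrow> real^'n^'n \<Rightarrow> real \<Rightarrow> ennreal" where
  "dissipation P q \<beta> = (if norm q \<le> \<beta> then ennreal (yield_stress P * norm q) else \<infinity>)"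

definition psi :: "('n::finite) plasticity \<Rightarrow> 'n state \<Rightarrow> ennreal" where
  "psi P z = (case z of (v, q, \<beta>) \<Rightarrow> \<integral>\<^sup>+x. dissipation P (q x) (\<beta> x) \<partial>lebesgue_on (Dom P))"

definition loads ::
    "('n::finite) plasticity \<Rightarrow> (real^'n \<Rightarrow> real^'n) \<Rightarrow> (real^'n \<Rightarrow> real^'n) \<Rightarrow> bool" where
  "loads P f g \<longleftrightarrow> L2 (lebesgue_on (Dom P)) f \<and> L2 (restrict_space surface_measure (GamN P)) g"

definition b_form ::
    "('n::finite) plasticity \<Rightarrow> (real^'n \<Rightarrow> real^'n) \<Rightarrow> (real^'n \<Rightarrow> real^'n) \<Rightarrow> 'n state \<Rightarrow> real" where
  "b_form P f g z = (case z of (v, q, \<beta>) \<Rightarrow>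
     L2_inner (lebesgue_on (Dom P)) f v +
     L2_inner (restrict_space surface_measure (GamN P)) g (bd_trace (Dom P) v))"

text \<open>Finiteness of \<open>\<psi>(u)\<close> is part of the variational inequality: it follows from comparison with
  \<open>z = 0\<close>, but \<open>\<infinity> - \<infinity> = \<infinity>\<close> in the extended reals, so it is stated separately.\<close>

definition vi_solution ::
    "('n::finite) plasticity \<Rightarrow> (real^'n \<Rightarrow> real^'n) \<Rightarrow> (real^'n \<Rightarrow> real^'n) \<Rightarrow>
     'n state set \<Rightarrow> 'n state \<Rightarrow> bool" where
  "vi_solution P f g Z u \<longleftrightarrow> u \<in> Z \<and> psi P u < \<infinity> \<and>
     (\<forall>z\<in>Z. ereal (b_form P f g (z - u)) \<le>
        ereal (a_form P u (z - u)) + enn2ereal (psi P z) - enn2ereal (psi P u))"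

definition stress_dist :: "('n::finite) plasticity \<Rightarrow> 'n state \<Rightarrow> 'n state \<Rightarrow> real" where
  "stress_dist P z z' = L2_nrm (lebesgue_on (Dom P)) (\<lambda>x. stress P z x - stress P z' x)"


section \<open>Meshes and newest vertex bisection\<close>

text \<open>Maubach--Traxler--Stevenson bisection acts on tagged simplices: a list \<open>[x\<^sub>0, \<dots>, x\<^sub>d]\<close> of
  vertices, whose reference edge is that between \<open>x\<^sub>0\<close> and \<open>x\<^sub>d\<close>, with a type \<open>\<gamma> < d\<close>.  For
  \<open>d = 2\<close> the type is irrelevant and this is newest vertex bisection with the reference edges of
  the children opposite to the new vertex.\<close>

type_synonym 'n tagged = "(real^'n) list \<times> nat"

type_synonym 'n mesh = "'n tagged set"

definition elem :: "('n::finite) tagged \<Rightarrow> (real^'n) set" where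
  "elem K = convex hull (set (fst K))"

definition vol :: "('n::finite) tagged \<Rightarrow> real" where
  "vol K = measure lebesgue (elem K)"

definition is_mesh :: "(real^'n::finite) set \<Rightarrow> 'n mesh \<Rightarrow> bool" where
  "is_mesh \<Omega> \<T> \<longleftrightarrow> finite \<T> \<and> (\<Union>K\<in>\<T>. elem K) = closure \<Omega> \<and>
     (\<forall>K\<in>\<T>. length (fst K) = CARD('n) + 1 \<and> distinct (fst K) \<and>
        \<not> affine_dependent (set (fst K)) \<and> snd K < CARD('n)) \<and>
     inj_on elem \<T> \<and> triangulation (elem ` \<T>)"

definition children :: "('n::finite) tagged \<Rightarrow> 'n mesh" where
  "children K = (let xs = fst K; \<gamma> = snd K; x0 = hd xs; xd = last xs; ys = butlast (tl xs);
       m = midpoint x0 xd; \<gamma>' = (\<gamma> + 1) mod (length xs - 1)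
     in {(x0 # m # ys, \<gamma>'), (xd # m # take \<gamma> ys @ rev (drop \<gamma> ys), \<gamma>')})"

definition bisect :: "('n::finite) mesh \<Rightarrow> 'n mesh \<Rightarrow> 'n mesh" where
  "bisect \<T> \<M> = (\<T> - \<M>) \<union> (\<Union>K\<in>\<M>. children K)"

definition hanging :: "('n::finite) mesh \<Rightarrow> 'n mesh" where
  "hanging \<T> = {K\<in>\<T>. \<exists>K'\<in>\<T>. \<exists>x\<in>set (fst K'). \<exists>y\<in>set (fst K). \<exists>y'\<in>set (fst K).
     x \<in> open_segment y y'}"

text \<open>The result is \<^const>\<open>None\<close> iff the completion loop does not terminate.\<close>

definition NVB :: "('n::finite) mesh \<Rightarrow> 'n mesh \<Rightarrow> 'n mesh option" where
  "NVB \<T> \<M> = while_option (\<lambda>\<S>. hanging \<S> \<noteq> {}) (\<lambda>\<S>. bisect \<S> (hanging \<S>)) (bisect \<T> \<M>)"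

inductive_set refinements :: "('n::finite) mesh \<Rightarrow> 'n mesh set" for \<T> :: "('n::finite) mesh" where
  base: "\<T> \<in> refinements \<T>"
| step: "\<S> \<in> refinements \<T> \<Longrightarrow> \<M> \<subseteq> \<S> \<Longrightarrow> NVB \<S> \<M> = Some \<S>' \<Longrightarrow> \<S>' \<in> refinements \<T>"

definition refinements_upto :: "('n::finite) mesh \<Rightarrow> nat \<Rightarrow> 'n mesh set" where
  "refinements_upto \<T>0 N = {\<T> \<in> refinements \<T>0. card \<T> \<le> card \<T>0 + N}"

definition inradius :: "('n::finite) tagged \<Rightarrow> real" where
  "inradius K = Sup {r. 0 \<le> r \<and> (\<exists>x. cball x r \<subseteq> elem K)}"

definition coarsest_common_refinement :: "('n::finite) mesh \<Rightarrow> 'n mesh \<Rightarrow> 'n mesh \<Rightarrow> bool" where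
  "coarsest_common_refinement \<T>1 \<T>2 \<S> \<longleftrightarrow> \<S> \<in> refinements \<T>1 \<inter> refinements \<T>2 \<and>
     (\<forall>\<S>'\<in>refinements \<T>1 \<inter> refinements \<T>2. \<S>' \<in> refinements \<S>)"

text \<open>The standing properties of the refinement strategy.  They hold for suitably tagged initial
  meshes.  The closure estimate is not included, as it concerns sequences of meshes.\<close>

definition nvb_properties :: "(real^'n::finite) set \<Rightarrow> 'n mesh \<Rightarrow> real \<Rightarrow> bool" where
  "nvb_properties \<Omega> \<T>0 Cson \<longleftrightarrow>
     (\<forall>\<T>\<in>refinements \<T>0. is_mesh \<Omega> \<T> \<and> (\<forall>\<M>\<subseteq>\<T>. NVB \<T> \<M> \<noteq> None)) \<and>
     (\<forall>\<T>\<in>refinements \<T>0. \<forall>\<T>'\<in>refinements \<T>. card \<T> + card (\<T> - \<T>') \<le> card \<T>') \<and>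
     (\<exists>c>0. \<forall>\<T>\<in>refinements \<T>0. \<forall>K\<in>\<T>. diameter (elem K) \<le> c * inradius K) \<and>
     (\<forall>\<T>\<in>refinements \<T>0. \<forall>\<M>\<subseteq>\<T>. \<forall>\<T>'. NVB \<T> \<M> = Some \<T>' \<longrightarrow>
        real (card \<T>') - real (card \<T>) \<le> (Cson - 1) * real (card \<T>)) \<and>
     (\<forall>\<T>\<in>refinements \<T>0. \<forall>\<T>1\<in>refinements \<T>. \<forall>\<T>2\<in>refinements \<T>.
        \<exists>\<S>. coarsest_common_refinement \<T>1 \<T>2 \<S> \<and> card \<S> + card \<T> \<le> card \<T>1 + card \<T>2)"

text \<open>The set of edges (\<open>d = 2\<close>) or faces (\<open>d = 3\<close>) of an element.\<close>

definition facets :: "('n::finite) tagged \<Rightarrow> (real^'n) set set" where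
  "facets K = (\<lambda>x. convex hull (set (fst K) - {x})) ` set (fst K)"

text \<open>Every boundary facet belongs to one of the two boundary parts.  A closed facet on the
  Neumann boundary may touch \<open>\<Gamma>\<^sub>D\<close> with its relative boundary.\<close>

definition resolves_boundary :: "('n::finite) plasticity \<Rightarrow> 'n mesh \<Rightarrow> bool" where
  "resolves_boundary P \<T> \<longleftrightarrow> (\<forall>K\<in>\<T>. \<forall>E\<in>facets K. E \<subseteq> frontier (Dom P) \<longrightarrow>
     E \<subseteq> GamD P \<or> rel_interior E \<subseteq> GamN P)"

definition elementwise_const :: "('n::finite) mesh \<Rightarrow> (real^'n \<Rightarrow> 'b) \<Rightarrow> bool" where
  "elementwise_const \<T> F \<longleftrightarrow> (\<forall>K\<in>\<T>. \<exists>c. AE x in lebesgue_on (elem K). F x = c)"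


section \<open>Discrete spaces and error estimator\<close>

text \<open>Discrete displacements are affine on the closed elements, i.e. the continuous
  representatives are used.\<close>

definition X_disc :: "('n::finite) plasticity \<Rightarrow> 'n mesh \<Rightarrow> 'n state set" where
  "X_disc P \<T> = {(v, q, \<beta>) \<in> X_space P.
     (\<forall>K\<in>\<T>. \<exists>A c. \<forall>x\<in>elem K. v x = A *v x + c) \<and>
     elementwise_const \<T> q \<and> elementwise_const \<T> \<beta>}"

definition elem_value :: "('n::finite) tagged \<Rightarrow> (real^'n \<Rightarrow> 'b) \<Rightarrow> 'b" where
  "elem_value K F = (THE c. AE x in lebesgue_on (elem K). F x = c)"

text \<open>The orientation is immaterial for the norm of a jump; on the boundary of the domain this is
  the exterior normal.\<close>

definition facet_normal :: "('n::finite) tagged \<Rightarrow> (real^'n) set \<Rightarrow> real^'n" where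
  "facet_normal K E = (THE \<nu>. norm \<nu> = 1 \<and> (\<forall>x\<in>E. \<forall>y\<in>E. \<nu> \<bullet> (y - x) = 0) \<and>
     (\<forall>x\<in>E. \<forall>y\<in>elem K. \<nu> \<bullet> (y - x) \<le> 0))"

definition facet_nbs :: "('n::finite) mesh \<Rightarrow> 'n tagged \<Rightarrow> (real^'n) set \<Rightarrow> 'n mesh" where
  "facet_nbs \<T> K E = {K'\<in>\<T>. K' \<noteq> K \<and> E \<in> facets K'}"

text \<open>A facet is interior iff it has a neighbour, which is then unique.  For a facet on the Neumann
  boundary, \<open>E\<close> and \<open>E \<inter> \<Gamma>\<^sub>N\<close> differ by a set of surface measure zero, on which \<open>g\<close> is not
  given.\<close>

definition facet_residual ::
    "('n::finite) plasticity \<Rightarrow> (real^'n \<Rightarrow> real^'n) \<Rightarrow> 'n mesh \<Rightarrow> 'n state \<Rightarrow> 'n tagged \<Rightarrow>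
     (real^'n) set \<Rightarrow> real" where
  "facet_residual P g \<T> z K E =
     (if facet_nbs \<T> K E \<noteq> {} then
        L2_nrm (restrict_space surface_measure E) (\<lambda>x.
          (elem_value K (stress P z) - elem_value (THE K'. K' \<in> facet_nbs \<T> K E) (stress P z))
            *v facet_normal K E)
      else if E \<subseteq> GamD P then 0
      else L2_nrm (restrict_space surface_measure (E \<inter> GamN P)) (\<lambda>x.
          g x - elem_value K (stress P z) *v facet_normal K E))"

definition eta_sq ::
    "('n::finite) plasticity \<Rightarrow> (real^'n \<Rightarrow> real^'n) \<Rightarrow> (real^'n \<Rightarrow> real^'n) \<Rightarrow> 'n mesh \<Rightarrow>
     'n state \<Rightarrow> 'n tagged \<Rightarrow> real" where
  "eta_sq P f g \<T> z K =
     vol K * (L2_nrm (lebesgue_on (elem K)) f)\<^sup>2 +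
     sqrt (vol K) * (\<Sum>E\<in>facets K. (facet_residual P g \<T> z K E)\<^sup>2)"

definition eta_on ::
    "('n::finite) plasticity \<Rightarrow> (real^'n \<Rightarrow> real^'n) \<Rightarrow> (real^'n \<Rightarrow> real^'n) \<Rightarrow> 'n mesh \<Rightarrow>
     'n state \<Rightarrow> 'n mesh \<Rightarrow> real" where
  "eta_on P f g \<T> z \<S> = sqrt (\<Sum>K\<in>\<S>. eta_sq P f g \<T> z K)"

definition eta ::
    "('n::finite) plasticity \<Rightarrow> (real^'n \<Rightarrow> real^'n) \<Rightarrow> (real^'n \<Rightarrow> real^'n) \<Rightarrow> 'n mesh \<Rightarrow>
     'n state \<Rightarrow> real" where
  "eta P f g \<T> z = eta_on P f g \<T> z \<T>"


section \<open>Adaptive algorithm and approximation class\<close>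

definition bulk ::
    "('n::finite) plasticity \<Rightarrow> (real^'n \<Rightarrow> real^'n) \<Rightarrow> (real^'n \<Rightarrow> real^'n) \<Rightarrow> real \<Rightarrow> 'n mesh \<Rightarrow>
     'n state \<Rightarrow> 'n mesh \<Rightarrow> bool" where
  "bulk P f g \<theta> \<T> z \<M> \<longleftrightarrow> \<M> \<subseteq> \<T> \<and> \<theta> * (eta P f g \<T> z)\<^sup>2 \<le> (\<Sum>K\<in>\<M>. eta_sq P f g \<T> z K)"

definition adaptive_sequence ::
    "('n::finite) plasticity \<Rightarrow> (real^'n \<Rightarrow> real^'n) \<Rightarrow> (real^'n \<Rightarrow> real^'n) \<Rightarrow> real \<Rightarrow> 'n mesh \<Rightarrow>
     ('n mesh \<Rightarrow> 'n state) \<Rightarrow> (nat \<Rightarrow> 'n mesh) \<Rightarrow> (nat \<Rightarrow> 'n mesh) \<Rightarrow> bool" where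
  "adaptive_sequence P f g \<theta> \<T>0 U \<T> \<M> \<longleftrightarrow> \<T> 0 = \<T>0 \<and>
     (\<forall>l. bulk P f g \<theta> (\<T> l) (U (\<T> l)) (\<M> l) \<and>
        (\<forall>\<M>'. bulk P f g \<theta> (\<T> l) (U (\<T> l)) \<M>' \<longrightarrow> card (\<M> l) \<le> card \<M>') \<and>
        NVB (\<T> l) (\<M> l) = Some (\<T> (Suc l)))"

text \<open>The set of refinements in the minimum is finite and nonempty, so the infimum is attained.
  The supremum may be infinite.\<close>

definition approx_norm ::
    "('n::finite) plasticity \<Rightarrow> (real^'n \<Rightarrow> real^'n) \<Rightarrow> (real^'n \<Rightarrow> real^'n) \<Rightarrow> 'n mesh \<Rightarrow>
     ('n mesh \<Rightarrow> 'n state) \<Rightarrow> real \<Rightarrow> ennreal" where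
  "approx_norm P f g \<T>0 U s =
     (SUP N. INF \<T>\<in>refinements_upto \<T>0 N. ennreal ((real N + 1) powr s * eta P f g \<T> (U \<T>)))"

end

theory Submission
  imports Defs
begin

text \<open>The proof follows the axioms of adaptivity of Carstensen, Feischl, Page and Praetorius.  Two of
  the four axioms, stability on common elements and discrete reliability, are hypotheses.  The other
  two are estimator reduction on refined elements and quasi-orthogonality of the increments
  \<open>\<sigma>(U(\<T>\<^sub>k\<^sub>+\<^sub>1)) - \<sigma>(U(\<T>\<^sub>k))\<close>; they are derived here.

  \<^emph>\<open>Quasi-orthogonality.\<close>  The energy \<open>J(z) = a(z,z)/2 + \<psi>(z) - b(z)\<close> decreases under refinement, and
  for a refinement \<open>\<S>\<close> of \<open>\<T>\<close> the gap \<open>J(U(\<T>)) - J(U(\<S>))\<close> is comparable with the square of the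
  stress distance of \<open>U(\<T>)\<close> and \<open>U(\<S>)\<close> (lemma \<open>energy_gap\<close>).  Indeed the dissipation does not
  depend on the displacement, so testing with displacements turns the variational inequality into an
  equation (\<open>displacement_equation\<close>), and plastic strain and hardening are independent constants on
  the elements, so the inequality for these two holds on every single element (\<open>flow_rule\<close>).  The
  gap becomes a sum over the elements of the finer mesh.  By monotonicity of the flow rule and by
  hardening, the difference of the plastic strains is controlled by that of the stresses, which
  bounds each summand from both sides (\<open>energy_gap_density\<close>).  Summing the lower bounds telescopes;
  the upper bound and discrete reliability then give
  \<open>\<Sum>\<^sub>k\<^sub>\<ge>\<^sub>l d[U(\<T>\<^sub>k\<^sub>+\<^sub>1), U(\<T>\<^sub>k)]\<^sup>2 \<lesssim> \<eta>(\<T>\<^sub>l; U(\<T>\<^sub>l))\<^sup>2\<close>.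

  \<^emph>\<open>Estimator reduction.\<close>  On a refined element the weights \<open>|T|\<close> and \<open>|T|\<^sup>1\<^sup>/\<^sup>2\<close> shrink by a fixed
  factor, since both halves of a bisected simplex contain a copy of it of half the size.  For a
  function that is discrete on the old mesh, new interior facets carry no jump, and old facets are
  covered by new ones that overlap in surface null sets (\<open>residual_localizes\<close>,
  \<open>estimator_refined_sum\<close>).  On the common elements, and for comparing two functions on one mesh,
  the stability hypothesis is used.

  \<^emph>\<open>Conclusion.\<close>  Both facts yield R-linear convergence of the estimators (\<open>linear_convergence\<close>).
  If the estimator drops by a sufficient factor on a refinement, then a set of elements whose number
  is comparable with that of the refined ones satisfies the bulk criterion (\<open>bulk_optimal\<close>); applied to the overlay with a quasi-optimal mesh this bounds
  the number of marked elements (\<open>marked_card\<close>), and linear convergence sums these bounds to the upper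
  estimate (\<open>alg_le_apx\<close>).  The lower estimate compares with the last adaptive mesh that
  has at most \<open>N\<close> additional elements (\<open>apx_le_alg\<close>).

  The discrete objects are defined through Sobolev functions and Hausdorff measure, and part of the
  text makes these concrete: weak gradients of elementwise affine functions are elementwise constant
  (\<open>weak_gradient_affine\<close>), traces of continuous functions are their values
  (\<open>bd_trace_continuous\<close>), facets have finite surface measure and their proper faces are null
  sets (\<open>hausdorff_outer_convex_hull\<close>).\<close>

section \<open>Bisection and the descent of elements\<close>

text \<open>The homothety with ratio one half and centre at an end point of the bisected edge maps the simplex
  into one of its halves.  This half is therefore nondegenerate and has at least the fraction
  \<open>(1/2) ^ DIM('a)\<close> of the volume, which leaves at most the remaining fraction to the other half.\<close>

lemma bisected_simplex:
  fixes x y :: "'a::euclidean_space"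
  assumes fin: "finite Y" and card: "card Y < DIM('a)"
    and int: "interior (convex hull (insert x (insert y Y))) \<noteq> {}"
  defines "m \<equiv> midpoint x y"
  shows "convex hull (insert x (insert m Y)) \<subseteq> convex hull (insert x (insert y Y))"
    and "interior (convex hull (insert x (insert m Y))) \<noteq> {}"
    and "measure lebesgue (convex hull (insert x (insert m Y)))
           \<le> (1 - (1/2) ^ DIM('a)) * measure lebesgue (convex hull (insert x (insert y Y)))"
proof -
  define A where "A = convex hull (insert x (insert y Y))"
  define A1 where "A1 = convex hull (insert x (insert m Y))"
  define A2 where "A2 = convex hull (insert y (insert m Y))"
  have cA: "compact A" "compact A1" "compact A2" "convex A"
    using fin by (auto simp: A_def A1_def A2_def intro!: finite_imp_compact_convex_hull)
  have mA: "m \<in> A"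
  proof -
    have "m \<in> closed_segment x y" by (simp add: m_def)
    also have "\<dots> \<subseteq> A" unfolding segment_convex_hull A_def by (rule hull_mono) auto
    finally show ?thesis .
  qed
  have sub: "A1 \<subseteq> A" "A2 \<subseteq> A"
  proof -
    have "insert x (insert y Y) \<subseteq> A" unfolding A_def by (rule hull_subset)
    with mA have "insert x (insert m Y) \<subseteq> A" "insert y (insert m Y) \<subseteq> A" by auto
    then show "A1 \<subseteq> A" "A2 \<subseteq> A" unfolding A1_def A2_def
      using \<open>convex A\<close> by (simp_all add: hull_minimal)
  qed
  \<comment> \<open>The homothety with centre \<open>c\<close> and ratio one half.\<close>
  define f where "f = (\<lambda>c z::'a. (1/2) *\<^sub>R z + (1/2) *\<^sub>R c)"
  have half: "f c ` A \<subseteq> convex hull (insert c (insert m Y))" if "c \<in> {x,y}" for c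
  proof -
    let ?B = "convex hull (insert c (insert m Y))"
    have inB: "c \<in> ?B" "m \<in> ?B" "\<And>z. z \<in> Y \<Longrightarrow> z \<in> ?B" by (auto intro: hull_inc)
    have "f c z \<in> ?B" if z: "z \<in> insert x (insert y Y)" for z
    proof (cases "z \<in> {x,y} \<and> z \<noteq> c")
      case True
      then have "f c z = m" using \<open>c \<in> {x,y}\<close> by (auto simp: f_def m_def midpoint_def algebra_simps)
      then show ?thesis using inB by simp
    next
      case False
      then have "z \<in> ?B" using z inB by auto
      moreover have "f c z = midpoint z c" by (simp add: f_def midpoint_def algebra_simps)
      ultimately show ?thesis using inB(1)
        by (metis convex_contains_segment convex_convex_hull midpoint_in_closed_segment subsetD)
    qed
    then have "f c ` insert x (insert y Y) \<subseteq> ?B" by blast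
    then have "convex hull (f c ` insert x (insert y Y)) \<subseteq> ?B" by (simp add: hull_minimal)
    moreover have "f c ` A = convex hull (f c ` insert x (insert y Y))"
    proof -
      have "f c = (\<lambda>z. (1/2) *\<^sub>R c + (1/2) *\<^sub>R z)" by (auto simp: f_def)
      then show ?thesis unfolding A_def by (simp only: convex_hull_affinity)
    qed
    ultimately show ?thesis by simp
  qed
  have vA: "measure lebesgue A > 0"
    using cA int A_def negligible_convex_interior[of A] 
    by (metis lmeasurable_compact negligible_iff_measure zero_less_measure_iff)
  have vhalf: "measure lebesgue (f c ` A) = (1/2) ^ DIM('a) * measure lebesgue A" for c
    using measure_lebesgue_affine[of "1/2" "(1/2) *\<^sub>R c" A] by (simp add: f_def)
  have ms: "A1 \<in> lmeasurable" "A2 \<in> lmeasurable" "A \<in> lmeasurable" "f c ` A \<in> lmeasurable" for c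
    using cA by (auto intro!: lmeasurable_compact compact_continuous_image continuous_intros simp: f_def)
  have lo: "(1/2) ^ DIM('a) * measure lebesgue A \<le> measure lebesgue A1"
    "(1/2) ^ DIM('a) * measure lebesgue A \<le> measure lebesgue A2"
    using measure_mono_fmeasurable[of "f x ` A" A1 lebesgue] half[of x]
      measure_mono_fmeasurable[of "f y ` A" A2 lebesgue] half[of y] ms vhalf[of x] vhalf[of y]
    by (auto simp: A1_def A2_def fmeasurableD)
  \<comment> \<open>The midpoint and the other vertices lie in a hyperplane, which separates the two halves.\<close>
  have neg: "negligible (A1 \<inter> A2)"
  proof -
    have "aff_dim (insert m Y) \<le> int (card (insert m Y)) - 1"
      using fin by (intro aff_dim_le_card) auto
    also have "card (insert m Y) \<le> Suc (card Y)" using fin by (simp add: card_insert_le_m1 card_insert_if)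
    then have "int (card (insert m Y)) - 1 < int DIM('a)" using card by linarith
    finally obtain \<nu> b where \<nu>: "\<nu> \<noteq> 0" "insert m Y \<subseteq> {z. \<nu> \<bullet> z = b}"
      using aff_lowdim_subset_hyperplane by blast
    have mid: "\<nu> \<bullet> x + \<nu> \<bullet> y = 2 * b"
    proof -
      have "\<nu> \<bullet> m = b" using \<nu> by auto
      moreover have "\<nu> \<bullet> m = (\<nu> \<bullet> x + \<nu> \<bullet> y) / 2" by (simp add: m_def midpoint_def inner_add_right)
      ultimately show ?thesis by simp
    qed
    have "A1 \<inter> A2 \<subseteq> {z. \<nu> \<bullet> z = b}"
    proof (cases "\<nu> \<bullet> x \<le> b")
      case True
      have "A1 \<subseteq> {z. \<nu> \<bullet> z \<le> b}" unfolding A1_def using True \<nu>(2)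
        by (intro hull_minimal) (auto simp: convex_halfspace_le)
      moreover have "A2 \<subseteq> {z. \<nu> \<bullet> z \<ge> b}" unfolding A2_def using True \<nu>(2) mid
        by (intro hull_minimal) (auto simp: convex_halfspace_ge)
      ultimately show ?thesis by force
    next
      case False
      have "A1 \<subseteq> {z. \<nu> \<bullet> z \<ge> b}" unfolding A1_def using False \<nu>(2)
        by (intro hull_minimal) (auto simp: convex_halfspace_ge)
      moreover have "A2 \<subseteq> {z. \<nu> \<bullet> z \<le> b}" unfolding A2_def using False \<nu>(2) mid
        by (intro hull_minimal) (auto simp: convex_halfspace_le)
      ultimately show ?thesis by force
    qed
    then show ?thesis using negligible_hyperplane[of \<nu> b] \<nu>(1) negligible_subset by blast
  qed
  have "measure lebesgue A1 + measure lebesgue A2 = measure lebesgue (A1 \<union> A2)"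
    using neg ms measure_Un3[of A1 lebesgue A2] negligible_imp_measure0 by fastforce
  also have "\<dots> \<le> measure lebesgue A" using sub ms by (intro measure_mono_fmeasurable) auto
  finally show "measure lebesgue (convex hull (insert x (insert m Y)))
           \<le> (1 - (1/2) ^ DIM('a)) * measure lebesgue (convex hull (insert x (insert y Y)))"
    using lo unfolding A_def[symmetric] A1_def[symmetric] by (simp add: algebra_simps)
  show "convex hull (insert x (insert m Y)) \<subseteq> convex hull (insert x (insert y Y))"
    using sub by (simp add: A_def A1_def)
  have "measure lebesgue A1 > 0" using lo(1) vA
    by (smt (verit) mult_pos_pos zero_less_power half_gt_zero_iff)
  then show "interior (convex hull (insert x (insert m Y))) \<noteq> {}"
    using negligible_convex_interior[of A1] by (auto simp: A1_def negligible_imp_measure0)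
qed

text \<open>Nonempty interior is preferred to affine independence, to which it is equivalent for lists of
  this length, because it passes to the halves of a simplex by comparison of sets.\<close>

definition nondegenerate :: "('n::finite) tagged \<Rightarrow> bool" where
  "nondegenerate K \<longleftrightarrow> length (fst K) = CARD('n) + 1 \<and> interior (elem K) \<noteq> {}"

lemma nondegenerate_iff:
  fixes K :: "('n::finite) tagged"
  shows "nondegenerate K \<longleftrightarrow>
    length (fst K) = CARD('n) + 1 \<and> distinct (fst K) \<and> \<not> affine_dependent (set (fst K))"
proof (cases "length (fst K) = CARD('n) + 1")
  case len: True
  show ?thesis
  proof
    assume "nondegenerate K"
    then have int: "interior (convex hull (set (fst K))) \<noteq> {}"
      by (auto simp: nondegenerate_def elem_def)
    then have "\<not> card (set (fst K)) \<le> DIM(real^'n)"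
      using empty_interior_convex_hull[of "set (fst K)"] by auto
    then have c: "card (set (fst K)) = Suc (DIM(real^'n))"
      using card_length[of "fst K"] len by simp
    then show "length (fst K) = CARD('n) + 1 \<and> distinct (fst K) \<and> \<not> affine_dependent (set (fst K))"
      using len int interior_convex_hull_eq_empty[OF c] by (simp add: card_distinct)
  next
    assume r: "length (fst K) = CARD('n) + 1 \<and> distinct (fst K) \<and> \<not> affine_dependent (set (fst K))"
    then have c: "card (set (fst K)) = Suc (DIM(real^'n))" by (simp add: distinct_card)
    then show "nondegenerate K"
      using r interior_convex_hull_eq_empty[OF c] by (simp add: nondegenerate_def elem_def)
  qed
qed (auto simp: nondegenerate_def)

lemma is_mesh_nondegenerate: "is_mesh \<Omega> \<T> \<Longrightarrow> K \<in> \<T> \<Longrightarrow> nondegenerate K"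
  by (auto simp: is_mesh_def nondegenerate_iff)

lemma compact_elem [simp]: "compact (elem K)" and convex_elem [simp]: "convex (elem K)"
  and closed_elem [simp]: "closed (elem K)"
  by (auto simp: elem_def finite_imp_compact_convex_hull compact_imp_closed)

lemma lmeasurable_elem [simp]: "elem K \<in> lmeasurable"
  by (simp add: lmeasurable_compact)

lemma vol_pos: "nondegenerate K \<Longrightarrow> vol K > 0"
  unfolding vol_def nondegenerate_def
  by (metis convex_elem lmeasurable_elem negligible_convex_interior negligible_iff_measure
      zero_less_measure_iff)

lemma children_nondegenerate:
  fixes K :: "('n::finite) tagged"
  assumes K: "nondegenerate K" and K': "K' \<in> children K"
  shows "nondegenerate K' \<and> elem K' \<subseteq> elem K \<and> vol K' \<le> (1 - (1/2) ^ CARD('n)) * vol K"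
proof -
  have len: "length (fst K) = CARD('n) + 1" using K by (simp add: nondegenerate_def)
  have "CARD('n) \<ge> 1" by (simp add: Suc_leI)
  then obtain x zs where x: "fst K = x # zs" "zs \<noteq> []" using len
    by (cases "fst K"; fastforce)
  define ys where "ys = butlast zs"
  define y where "y = last zs"
  have f: "fst K = x # ys @ [y]" using x by (simp add: ys_def y_def)
  have lys: "Suc (length ys) = CARD('n)" using len f by simp
  have cys: "card (set ys) < DIM(real^'n)" using card_length[of ys] lys by simp
  have el: "elem K = convex hull (insert x (insert y (set ys)))"
    "elem K = convex hull (insert y (insert x (set ys)))"
    by (auto simp: elem_def f insert_commute)
  define m where "m = midpoint x y"
  define \<gamma>' where "\<gamma>' = (snd K + 1) mod (length (fst K) - 1)"
  have ch: "children K = {(x # m # ys, \<gamma>'),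
      (y # m # take (snd K) ys @ rev (drop (snd K) ys), \<gamma>')}"
    unfolding children_def Let_def using f by (simp add: m_def \<gamma>'_def)
  have st: "set (take (snd K) ys) \<union> set (drop (snd K) ys) = set ys"
    by (metis append_take_drop_id set_append)
  have int: "interior (elem K) \<noteq> {}" using K by (simp add: nondegenerate_def)
  from K' consider "K' = (x # m # ys, \<gamma>')"
    | "K' = (y # m # take (snd K) ys @ rev (drop (snd K) ys), \<gamma>')" by (auto simp: ch)
  then show ?thesis
  proof cases
    case 1
    then have "elem K' = convex hull (insert x (insert (midpoint x y) (set ys)))"
      by (simp add: elem_def m_def)
    then show ?thesis
      using bisected_simplex[of "set ys" x y] cys int 1 lys
      by (simp add: nondegenerate_def vol_def el(1))
  next
    case 2
    then have "elem K' = convex hull (insert y (insert (midpoint y x) (set ys)))"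
      by (simp add: elem_def m_def st midpoint_sym)
    then show ?thesis
      using bisected_simplex[of "set ys" y x] cys int 2 lys
      by (simp add: nondegenerate_def vol_def el(2))
  qed
qed

text \<open>The factor comes from \<open>bisected_simplex\<close>.  The relation is stated for arbitrary sets of
  simplices, since completion passes through meshes with hanging nodes.\<close>

definition descends :: "('n::finite) mesh \<Rightarrow> 'n mesh \<Rightarrow> bool" where
  "descends \<T> \<S> \<longleftrightarrow> (\<forall>K'\<in>\<S>. K' \<in> \<T> \<or> (\<exists>K\<in>\<T>. elem K' \<subseteq> elem K \<and>
     vol K' \<le> (1 - (1/2) ^ CARD('n)) * vol K))"

lemma vol_nonneg [simp]: "0 \<le> vol K"
  by (simp add: vol_def)

lemma descends_refl: "descends \<T> \<T>"
  by (auto simp: descends_def)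

lemma descends_trans:
  fixes \<T> :: "('n::finite) mesh"
  assumes 1: "descends \<T> \<S>" and 2: "descends \<S> \<R>"
  shows "descends \<T> \<R>"
  unfolding descends_def
proof
  fix K'' assume "K'' \<in> \<R>"
  let ?q = "1 - (1/2) ^ CARD('n) :: real"
  have q: "0 \<le> ?q" "?q \<le> 1" by (simp_all add: power_le_one)
  from 2 \<open>K'' \<in> \<R>\<close> consider "K'' \<in> \<S>"
    | K' where "K' \<in> \<S>" "elem K'' \<subseteq> elem K'" "vol K'' \<le> ?q * vol K'"
    by (auto simp: descends_def)
  then show "K'' \<in> \<T> \<or> (\<exists>K\<in>\<T>. elem K'' \<subseteq> elem K \<and> vol K'' \<le> ?q * vol K)"
  proof cases
    case 1
    then show ?thesis using \<open>descends \<T> \<S>\<close> by (auto simp: descends_def)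
  next
    case 2
    from \<open>descends \<T> \<S>\<close> \<open>K' \<in> \<S>\<close> consider "K' \<in> \<T>"
      | K where "K \<in> \<T>" "elem K' \<subseteq> elem K" "vol K' \<le> ?q * vol K"
      by (auto simp: descends_def)
    then show ?thesis
    proof cases
      case (2 K)
      have "?q * vol K' \<le> vol K'" using q by (simp add: mult_left_le_one_le)
      then have "vol K'' \<le> vol K'" using \<open>vol K'' \<le> ?q * vol K'\<close> by (rule order_trans[rotated])
      then show ?thesis using 2 \<open>elem K'' \<subseteq> elem K'\<close> by (meson order_trans)
    qed (use 2 in blast)
  qed
qed

lemma bisect_nondegenerate:
  assumes "\<forall>K\<in>\<T>. nondegenerate K" "\<M> \<subseteq> \<T>"
  shows "(\<forall>K\<in>bisect \<T> \<M>. nondegenerate K) \<and> descends \<T> (bisect \<T> \<M>)"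
  using assms children_nondegenerate unfolding bisect_def descends_def by blast

text \<open>Both properties are invariants of the completion loop.\<close>

lemma NVB_nondegenerate:
  assumes nd: "\<forall>K\<in>\<T>. nondegenerate K" and sub: "\<M> \<subseteq> \<T>" and nvb: "NVB \<T> \<M> = Some \<T>'"
  shows "(\<forall>K\<in>\<T>'. nondegenerate K) \<and> descends (bisect \<T> \<M>) \<T>'"
proof -
  let ?I = "\<lambda>\<S>. (\<forall>K\<in>\<S>. nondegenerate K) \<and> descends (bisect \<T> \<M>) \<S>"
  show ?thesis
  proof (rule while_option_rule[where P = ?I, OF _ nvb[unfolded NVB_def]])
    show "?I (bisect \<T> \<M>)" using bisect_nondegenerate[OF nd sub] descends_refl by blast
  next
    fix \<S> assume I: "?I \<S>"
    have "hanging \<S> \<subseteq> \<S>" by (auto simp: hanging_def)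
    with I bisect_nondegenerate[of \<S> "hanging \<S>"] show "?I (bisect \<S> (hanging \<S>))"
      using descends_trans by blast
  qed
qed

lemma refinements_descend:
  assumes "\<T>' \<in> refinements \<T>" "\<forall>K\<in>\<T>. nondegenerate K"
  shows "(\<forall>K\<in>\<T>'. nondegenerate K) \<and> descends \<T> \<T>'"
  using assms
proof induction
  case base
  then show ?case by (simp add: descends_refl)
next
  case (step \<S> \<M> \<S>')
  then show ?case
    using NVB_nondegenerate[of \<S> \<M> \<S>'] bisect_nondegenerate[of \<S> \<M>] descends_trans by metis
qed

lemma refinements_trans:
  assumes "\<R> \<in> refinements \<S>" "\<S> \<in> refinements \<T>"
  shows "\<R> \<in> refinements \<T>"
  using assms by induction (auto intro: refinements.step)

text \<open>The intersection is a face of both simplices, and a face that meets the interior is the whole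
  simplex.\<close>

lemma mesh_interior_unique:
  fixes \<T> :: "('n::finite) mesh"
  assumes m: "is_mesh \<Omega> \<T>" and K: "K \<in> \<T>" "K' \<in> \<T>" and x: "x \<in> interior (elem K)" "x \<in> elem K'"
  shows "K = K'"
proof -
  have tri: "triangulation (elem ` \<T>)" and inj: "inj_on elem \<T>" using m by (auto simp: is_mesh_def)
  then have f1: "(elem K \<inter> elem K') face_of elem K" and f2: "(elem K' \<inter> elem K) face_of elem K'"
    using K by (auto simp: triangulation_def)
  have "elem K \<inter> elem K' = elem K"
  proof (rule ccontr)
    assume "\<not> ?thesis"
    from face_of_disjoint_interior[OF f1 this] x interior_subset show False by auto
  qed
  then have sub: "elem K \<subseteq> elem K'" by blast
  have x': "x \<in> interior (elem K')" using x(1) interior_mono[OF sub] by auto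
  have "elem K' \<inter> elem K = elem K'"
  proof (rule ccontr)
    assume "\<not> ?thesis"
    from face_of_disjoint_interior[OF f2 this] x x' interior_subset show False by auto
  qed
  then show ?thesis using sub inj K by (metis Int_absorb1 inj_onD)
qed

lemma mesh_overlap_negligible:
  assumes m: "is_mesh \<Omega> \<T>" and K: "K \<in> \<T>" "K' \<in> \<T>" and "K \<noteq> K'"
  shows "negligible (elem K \<inter> elem K')"
proof -
  have "interior (elem K \<inter> elem K') = {}"
    using mesh_interior_unique[OF m K] \<open>K \<noteq> K'\<close> interior_subset by auto
  then show ?thesis by (simp add: negligible_convex_interior convex_Int)
qed

lemma mesh_sub_unique:
  assumes m: "is_mesh \<Omega> \<T>" and K: "K1 \<in> \<T>" "K2 \<in> \<T>" and "nondegenerate K'"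
    and sub: "elem K' \<subseteq> elem K1" "elem K' \<subseteq> elem K2"
  shows "K1 = K2"
proof -
  obtain x where x: "x \<in> interior (elem K')" using \<open>nondegenerate K'\<close> by (auto simp: nondegenerate_def)
  have "x \<in> interior (elem K1)" "x \<in> elem K2"
    using x sub interior_mono[OF sub(1)] interior_subset[of "elem K'"] by auto
  then show ?thesis by (rule mesh_interior_unique[OF m K])
qed

text \<open>Whatever descends from a bisected element has strictly smaller volume, and it cannot coincide with
  another element of the old mesh, since these do not overlap.\<close>

lemma NVB_refines_marked:
  fixes \<T> :: "('n::finite) mesh"
  assumes m: "is_mesh \<Omega> \<T>" and sub: "\<M> \<subseteq> \<T>" and nvb: "NVB \<T> \<M> = Some \<T>'"
  shows "\<M> \<inter> \<T>' = {}"
proof (rule ccontr)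
  assume "\<M> \<inter> \<T>' \<noteq> {}"
  then obtain K where K: "K \<in> \<M>" "K \<in> \<T>'" by blast
  let ?q = "1 - (1/2) ^ CARD('n) :: real"
  have nd: "\<forall>K\<in>\<T>. nondegenerate K" using is_mesh_nondegenerate[OF m] by blast
  have d: "descends (bisect \<T> \<M>) \<T>'" using NVB_nondegenerate[OF nd sub nvb] by blast
  have q: "0 \<le> ?q" "?q < 1" by (simp_all add: power_le_one)
  have ex: "\<exists>K0\<in>\<T>. elem K1 \<subseteq> elem K0 \<and> vol K1 \<le> ?q * vol K0"
    if "K1 \<in> bisect \<T> \<M>" "K1 \<notin> \<T> - \<M>" for K1
  proof -
    from that obtain K0 where K0: "K0 \<in> \<M>" "K1 \<in> children K0" by (auto simp: bisect_def)
    then have "K0 \<in> \<T>" using sub by auto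
    with children_nondegenerate[OF _ K0(2)] nd show ?thesis by auto
  qed
  have ex': "\<exists>K0\<in>\<T>. elem K1 \<subseteq> elem K0 \<and> vol K1 \<le> vol K0" if K1: "K1 \<in> bisect \<T> \<M>" for K1
  proof (cases "K1 \<in> \<T> - \<M>")
    case False
    then obtain K0 where K0: "K0 \<in> \<T>" "elem K1 \<subseteq> elem K0" "vol K1 \<le> ?q * vol K0"
      using ex[OF K1] by blast
    have "?q * vol K0 \<le> vol K0" using q by (simp add: mult_left_le_one_le)
    with K0 show ?thesis by (metis order_trans)
  qed auto
  have "\<exists>K0\<in>\<T>. elem K \<subseteq> elem K0 \<and> vol K \<le> ?q * vol K0"
  proof (cases "K \<in> bisect \<T> \<M>")
    case True
    then show ?thesis using ex K by blast
  next
    case False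
    then obtain K1 where K1: "K1 \<in> bisect \<T> \<M>" "elem K \<subseteq> elem K1" "vol K \<le> ?q * vol K1"
      using d K unfolding descends_def by blast
    obtain K0 where K0: "K0 \<in> \<T>" "elem K1 \<subseteq> elem K0" "vol K1 \<le> vol K0" using ex'[OF K1(1)] by blast
    have "vol K \<le> ?q * vol K0"
      using K1(3) mult_left_mono[OF K0(3) q(1)] by linarith
    then show ?thesis using K0 K1 by blast
  qed
  then obtain K0 where K0: "K0 \<in> \<T>" "elem K \<subseteq> elem K0" "vol K \<le> ?q * vol K0" by blast
  have "nondegenerate K" using nd K sub by blast
  with mesh_sub_unique[OF m K0(1) _ this K0(2), of K] K sub have "K0 = K" by auto
  with K0(3) q vol_pos[OF \<open>nondegenerate K\<close>] show False
    using mult_strict_right_mono[OF q(2), of "vol K"] by simp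
qed

section \<open>Facets of the simplices of a mesh\<close>

lemma facets_eq:
  fixes K :: "('n::finite) tagged"
  assumes "nondegenerate K"
  shows "facets K = {E. E facet_of elem K}"
proof -
  have d: "\<not> affine_dependent (set (fst K))" "card (set (fst K)) \<ge> 2"
    using assms by (auto simp: nondegenerate_iff distinct_card Suc_leI)
  show ?thesis
    unfolding facets_def elem_def
    using facet_of_convex_hull_affine_independent_alt[OF d(1)] d(2) by auto
qed

lemma finite_facets [simp]: "finite (facets K)"
  by (simp add: facets_def)

lemma aff_dim_elem: "nondegenerate (K :: ('n::finite) tagged) \<Longrightarrow> aff_dim (elem K) = int CARD('n)"
  by (simp add: nondegenerate_def aff_dim_nonempty_interior)

lemma facet_props:
  fixes K :: "('n::finite) tagged"
  assumes "nondegenerate K" "E \<in> facets K"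
  shows "E face_of elem K" "E \<noteq> {}" "aff_dim E = int CARD('n) - 1" "E \<subseteq> elem K" "E \<noteq> elem K"
    "compact E" "convex E"
proof -
  have f: "E face_of elem K" "E \<noteq> {}" "aff_dim E = aff_dim (elem K) - 1"
    using assms(2) unfolding facets_eq[OF assms(1)] facet_of_def by simp_all
  then show "E face_of elem K" "E \<noteq> {}" "aff_dim E = int CARD('n) - 1"
    using aff_dim_elem[OF assms(1)] by simp_all
  show "E \<subseteq> elem K" "compact E" "convex E"
    using face_of_imp_subset[OF f(1)] face_of_imp_compact[OF _ _ f(1)] face_of_imp_convex[OF f(1)]
    by simp_all
  show "E \<noteq> elem K" using f(3) by auto
qed

text \<open>Facets are recognised as proper faces that contain a set of codimension one; this is how a facet
  of a fine element inside two coarse elements determines their common facet.\<close>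

lemma facetI:
  fixes K :: "('n::finite) tagged"
  assumes "nondegenerate K" "F face_of elem K" "F \<noteq> elem K" "E \<subseteq> F" "aff_dim E \<ge> int CARD('n) - 1"
    "CARD('n) \<ge> 2"
  shows "F \<in> facets K"
proof -
  have "aff_dim F < aff_dim (elem K)"
    using face_of_aff_dim_lt[of "elem K" F] assms by simp
  moreover have "aff_dim E \<le> aff_dim F" using assms(4) by (rule aff_dim_subset)
  ultimately have "aff_dim F = aff_dim (elem K) - 1" "F \<noteq> {}"
    using assms(5,6) aff_dim_elem[OF assms(1)] by auto
  then show ?thesis using assms(2) by (simp add: facets_eq[OF assms(1)] facet_of_def)
qed

lemma frontier_elem:
  fixes K :: "('n::finite) tagged"
  assumes "nondegenerate K"
  shows "frontier (elem K) = \<Union> (facets K)"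
proof -
  have "\<not> affine_dependent (set (fst K))" using assms by (auto simp: nondegenerate_iff)
  from rel_frontier_convex_hull_cases[OF this]
  have "rel_frontier (elem K) = \<Union> (facets K)" by (auto simp: elem_def facets_def)
  moreover have "affine hull (elem K) = UNIV"
    using assms affine_hull_nonempty_interior by (auto simp: nondegenerate_def)
  ultimately show ?thesis by (metis rel_frontier_frontier)
qed

text \<open>Such hulls of few points are null sets for the surface measure.\<close>

lemma proper_face_of_facet:
  fixes K :: "('n::finite) tagged"
  assumes "nondegenerate K" "E \<in> facets K" "F face_of E" "F \<noteq> E"
  shows "\<exists>V. finite V \<and> card V < CARD('n) \<and> F = convex hull V"
proof -
  obtain x where x: "x \<in> set (fst K)" "E = convex hull (set (fst K) - {x})"
    using assms(2) by (auto simp: facets_def)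
  have "compact (set (fst K) - {x})" by (simp add: finite_imp_compact)
  then obtain V where V: "V \<subseteq> set (fst K) - {x}" "F = convex hull V"
    using face_of_convex_hull_subset assms(3) x(2) by metis
  have "V \<noteq> set (fst K) - {x}" using V x assms(4) by auto
  then have "card V < card (set (fst K) - {x})" using V by (intro psubset_card_mono) auto
  moreover have "card (set (fst K) - {x}) = CARD('n)"
    using assms(1) x by (simp add: nondegenerate_iff distinct_card)
  moreover have "finite V" using V finite_subset by auto
  ultimately show ?thesis using V(2) by auto
qed

lemma facet_rel_interior_disjoint:
  fixes K :: "('n::finite) tagged"
  assumes K: "nondegenerate K" and E: "E \<in> facets K" "E' \<in> facets K" "E \<noteq> E'"
  shows "rel_interior E \<inter> E' = {}"
proof (rule ccontr)
  assume ne: "rel_interior E \<inter> E' \<noteq> {}"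
  have f: "E \<inter> E' face_of elem K" using facet_props[OF K E(1)] facet_props[OF K E(2)] by (simp add: face_of_Int)
  then have "E \<inter> E' face_of E" using facet_props(4)[OF K E(1)] 
    by (meson Int_lower1 face_of_subset)
  have "E \<inter> E' = E"
  proof (rule ccontr)
    assume "E \<inter> E' \<noteq> E"
    from face_of_disjoint_rel_interior[OF \<open>E \<inter> E' face_of E\<close> this] ne rel_interior_subset[of E]
    show False by auto
  qed
  then have "E \<subseteq> E'" by auto
  then have "E face_of E'"
    using face_of_subset[OF facet_props(1)[OF K E(1)] _ facet_props(4)[OF K E(2)]] by simp
  then have "aff_dim E < aff_dim E'"
    using E(3) facet_props(7)[OF K E(2)] by (intro face_of_aff_dim_lt) auto
  then show False using facet_props(3)[OF K E(1)] facet_props(3)[OF K E(2)] by simp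
qed

text \<open>A small ball around a relative interior point of a facet meets the boundary of the simplex only in
  that facet.  So the open half ball, which is connected, cannot leave the simplex.\<close>

lemma half_ball_subset_elem:
  fixes K :: "('n::finite) tagged"
  assumes K: "nondegenerate K" and E: "E \<in> facets K" and x: "x \<in> rel_interior E"
    and h: "E \<subseteq> {y. \<nu> \<bullet> y = b}" "elem K \<subseteq> {y. \<nu> \<bullet> y \<le> b}" "\<nu> \<noteq> 0"
  shows "\<exists>r>0. ball x r \<inter> {y. \<nu> \<bullet> y < b} \<subseteq> interior (elem K)"
proof -
  let ?F = "\<Union> (facets K - {E})"
  have "closed ?F" using facet_props(6)[OF K] by (intro closed_Union) (auto simp: compact_imp_closed)
  moreover have "x \<notin> ?F" using facet_rel_interior_disjoint[OF K E] x by auto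
  ultimately obtain r where r: "r > 0" "ball x r \<inter> ?F = {}"
    by (metis Compl_iff open_Compl open_contains_ball disjoint_eq_subset_Compl)
  let ?D = "ball x r \<inter> {y. \<nu> \<bullet> y < b}"
  have "?D \<inter> frontier (elem K) = {}" unfolding frontier_elem[OF K] using r(2) h(1) by auto
  moreover have "connected ?D" by (intro convex_connected convex_Int convex_halfspace_lt convex_ball)
  moreover have "?D \<inter> elem K \<noteq> {}"
  proof -
    have "x \<in> closure (interior (elem K))"
      using x rel_interior_subset facet_props(4)[OF K E] K
      by (metis closed_elem closure_closed convex_closure_interior convex_elem nondegenerate_def subsetD)
    then obtain y where y: "y \<in> interior (elem K)" "dist y x < r"
      using r(1) closure_approachable by blast
    have "y \<in> interior {y. \<nu> \<bullet> y \<le> b}" using y(1) interior_mono[OF h(2)] by auto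
    then have "\<nu> \<bullet> y < b" using h(3) by (simp add: interior_halfspace_le)
    moreover have "y \<in> elem K" using y(1) interior_subset by fast
    ultimately have "y \<in> ?D \<inter> elem K" using y(2) by (auto simp: dist_commute)
    then show ?thesis by blast
  qed
  ultimately have "?D - elem K = {}" using connected_Int_frontier by blast
  then have "?D \<subseteq> elem K" by auto
  moreover have "open ?D" by (intro open_Int open_ball open_halfspace_lt)
  ultimately show ?thesis using r(1) interior_maximal by blast
qed

text \<open>All vertices but one lie in the facet, so the simplex lies on one side of its hyperplane.\<close>

lemma facet_hyperplane:
  fixes K :: "('n::finite) tagged"
  assumes K: "nondegenerate K" and E: "E \<in> facets K"
  obtains \<nu> b where "norm \<nu> = 1" "E \<subseteq> {y. \<nu> \<bullet> y = b}" "elem K \<subseteq> {y. \<nu> \<bullet> y \<le> b}"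
proof -
  have "aff_dim E < DIM(real^'n)" using facet_props(3)[OF K E] by simp
  then obtain a c where a: "a \<noteq> 0" "E \<subseteq> {y. a \<bullet> y = c}" using aff_lowdim_subset_hyperplane by blast
  obtain p where p: "p \<in> set (fst K)" "E = convex hull (set (fst K) - {p})"
    using E by (auto simp: facets_def)
  define s where "s = (if a \<bullet> p \<le> c then 1 else - 1 :: real)"
  have "elem K \<subseteq> {y. (s *\<^sub>R a) \<bullet> y \<le> s * c}"
    unfolding elem_def
  proof (rule hull_minimal)
    show "set (fst K) \<subseteq> {y. (s *\<^sub>R a) \<bullet> y \<le> s * c}"
    proof
      fix y assume y: "y \<in> set (fst K)"
      show "y \<in> {y. (s *\<^sub>R a) \<bullet> y \<le> s * c}"
      proof (cases "y = p")
        case False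
        then have "y \<in> E" using y p by (auto intro: hull_inc)
        then show ?thesis using a(2) by auto
      qed (auto simp: s_def)
    qed
  qed (rule convex_halfspace_le)
  moreover have "s \<noteq> 0" by (simp add: s_def)
  ultimately have 1: "elem K \<subseteq> {y. ((1 / norm a) *\<^sub>R s *\<^sub>R a) \<bullet> y \<le> s * c / norm a}"
    using a(1) by (auto simp: divide_right_mono)
  have "norm ((1 / norm a) *\<^sub>R s *\<^sub>R a) = 1" using a(1) by (simp add: s_def)
  moreover have "E \<subseteq> {y. ((1 / norm a) *\<^sub>R s *\<^sub>R a) \<bullet> y = s * c / norm a}"
    using a(2) by auto
  ultimately show thesis using that 1 by blast
qed

text \<open>A vector that is orthogonal to the facet is determined by its product with one further edge, since
  the edges of a nondegenerate simplex span the space; length and sign fix that product.\<close>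

lemma facet_normal_unique:
  fixes K :: "('n::finite) tagged"
  assumes K: "nondegenerate K" and E: "E \<in> facets K"
  shows "\<exists>!\<nu>. norm \<nu> = 1 \<and> (\<forall>x\<in>E. \<forall>y\<in>E. \<nu> \<bullet> (y - x) = 0) \<and> (\<forall>x\<in>E. \<forall>y\<in>elem K. \<nu> \<bullet> (y - x) \<le> 0)"
    (is "\<exists>!\<nu>. ?P \<nu>")
proof -
  obtain \<nu> b where "norm \<nu> = 1" "E \<subseteq> {y. \<nu> \<bullet> y = b}" "elem K \<subseteq> {y. \<nu> \<bullet> y \<le> b}"
    using facet_hyperplane[OF K E] by blast
  then have ex: "?P \<nu>" by (auto simp: inner_diff_right subset_iff)
  have uniq: "\<nu>1 = \<nu>2" if P: "?P \<nu>1" "?P \<nu>2" for \<nu>1 \<nu>2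
  proof -
    obtain p where p: "p \<in> set (fst K)" "E = convex hull (set (fst K) - {p})"
      using E by (auto simp: facets_def)
    obtain e where e: "e \<in> E" using facet_props(2)[OF K E] by blast
    obtain z r where z: "r > 0" "ball z r \<subseteq> elem K"
      using K by (metis ex_in_conv mem_interior nondegenerate_def)
    \<comment> \<open>A vector that is orthogonal to all edges from e vanishes.\<close>
    have orth: "w = 0" if w: "\<And>y. y \<in> set (fst K) \<Longrightarrow> w \<bullet> (y - e) = 0" for w :: "real^'n"
    proof -
      have "elem K \<subseteq> {y. w \<bullet> y = w \<bullet> e}" unfolding elem_def
        using w by (intro hull_minimal convex_hyperplane) (auto simp: inner_diff_right)
      then have *: "w \<bullet> y = w \<bullet> e" if "y \<in> ball z r" for y using that z by auto
      show "w = 0"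
      proof (rule ccontr)
        assume "w \<noteq> 0"
        have "z + (r / (2 * norm w)) *\<^sub>R w \<in> ball z r" using z(1) \<open>w \<noteq> 0\<close> by (simp add: dist_norm)
        from *[OF this] *[of z] z(1) have "(r / (2 * norm w)) * (w \<bullet> w) = 0"
          by (simp add: inner_add_right)
        then show False using \<open>w \<noteq> 0\<close> z(1) by simp
      qed
    qed
    have onE: "y \<in> E" if "y \<in> set (fst K)" "y \<noteq> p" for y using that p by (auto intro: hull_inc)
    have pe: "\<nu>i \<bullet> (p - e) < 0" if Pi: "?P \<nu>i" for \<nu>i
    proof (rule ccontr)
      assume n: "\<not> \<nu>i \<bullet> (p - e) < 0"
      have "p \<in> elem K" using p by (auto simp: elem_def intro: hull_inc)
      with Pi e n have z0: "\<nu>i \<bullet> (p - e) = 0" by force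
      have "\<nu>i = 0"
      proof (rule orth)
        fix y assume "y \<in> set (fst K)"
        then show "\<nu>i \<bullet> (y - e) = 0" using z0 Pi e onE by (cases "y = p") auto
      qed
      then show False using Pi by simp
    qed
    define s t where "s = - (\<nu>1 \<bullet> (p - e))" and "t = - (\<nu>2 \<bullet> (p - e))"
    have st: "s > 0" "t > 0" using pe P by (auto simp: s_def t_def)
    have "t *\<^sub>R \<nu>1 - s *\<^sub>R \<nu>2 = 0"
    proof (rule orth)
      fix y assume "y \<in> set (fst K)"
      then show "(t *\<^sub>R \<nu>1 - s *\<^sub>R \<nu>2) \<bullet> (y - e) = 0"
        using P e onE by (cases "y = p") (auto simp: inner_diff_left s_def t_def)
    qed
    then have eq: "t *\<^sub>R \<nu>1 = s *\<^sub>R \<nu>2" by simp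
    then have "norm (t *\<^sub>R \<nu>1) = norm (s *\<^sub>R \<nu>2)" by simp
    then have "t = s" using P st by simp
    with eq st show ?thesis by simp
  qed
  show ?thesis
  proof (rule ex1I[of ?P \<nu>])
    show "?P \<nu>" by (fact ex)
    show "\<nu>' = \<nu>" if "?P \<nu>'" for \<nu>' by (fact uniq[OF that ex])
  qed
qed

lemma facet_normal_sub:
  fixes K :: "('n::finite) tagged"
  assumes K: "nondegenerate K" "E \<in> facets K" and K': "nondegenerate K'" "E' \<in> facets K'"
    and sub: "elem K' \<subseteq> elem K" "E' \<subseteq> E"
  shows "facet_normal K' E' = facet_normal K E"
proof -
  have "norm (facet_normal K E) = 1 \<and> (\<forall>x\<in>E. \<forall>y\<in>E. facet_normal K E \<bullet> (y - x) = 0) \<and>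
      (\<forall>x\<in>E. \<forall>y\<in>elem K. facet_normal K E \<bullet> (y - x) \<le> 0)"
    unfolding facet_normal_def by (rule theI'[OF facet_normal_unique[OF K]])
  then have "norm (facet_normal K E) = 1 \<and> (\<forall>x\<in>E'. \<forall>y\<in>E'. facet_normal K E \<bullet> (y - x) = 0) \<and>
      (\<forall>x\<in>E'. \<forall>y\<in>elem K'. facet_normal K E \<bullet> (y - x) \<le> 0)"
    using subsetD[OF sub(1)] subsetD[OF sub(2)] by simp
  then show ?thesis
    unfolding facet_normal_def[of K' E'] by (rule the1_equality[OF facet_normal_unique[OF K']])
qed

text \<open>Both simplices contain a small half ball at a relative interior point of the facet.\<close>

lemma same_side_overlap:
  fixes K1 K2 :: "('n::finite) tagged"
  assumes K: "nondegenerate K1" "nondegenerate K2" and E: "E \<in> facets K1" "E \<in> facets K2"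
    and h: "E \<subseteq> {y. \<nu> \<bullet> y = b}" "elem K1 \<subseteq> {y. \<nu> \<bullet> y \<le> b}" "elem K2 \<subseteq> {y. \<nu> \<bullet> y \<le> b}" "\<nu> \<noteq> 0"
  shows "interior (elem K1) \<inter> interior (elem K2) \<noteq> {}"
proof -
  obtain x where x: "x \<in> rel_interior E"
    using facet_props(2,7)[OF K(1) E(1)] rel_interior_eq_empty by blast
  obtain r1 where r1: "r1 > 0" "ball x r1 \<inter> {y. \<nu> \<bullet> y < b} \<subseteq> interior (elem K1)"
    using half_ball_subset_elem[OF K(1) E(1) x h(1,2,4)] by blast
  obtain r2 where r2: "r2 > 0" "ball x r2 \<inter> {y. \<nu> \<bullet> y < b} \<subseteq> interior (elem K2)"
    using half_ball_subset_elem[OF K(2) E(2) x h(1,3,4)] by blast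
  define r where "r = min r1 r2"
  define y where "y = x - (r / (2 * norm \<nu>)) *\<^sub>R \<nu>"
  have r: "r > 0" using r1 r2 by (simp add: r_def)
  have "\<nu> \<bullet> x = b" using x h(1) rel_interior_subset by auto
  then have "\<nu> \<bullet> y < b" using r h(4) by (simp add: y_def inner_diff_right)
  moreover have "y \<in> ball x r1" "y \<in> ball x r2"
    using r h(4) by (auto simp: y_def dist_norm r_def)
  ultimately have "y \<in> interior (elem K1)" "y \<in> interior (elem K2)" using r1(2) r2(2) by auto
  then show ?thesis by blast
qed

lemma facet_sides:
  fixes K K' :: "('n::finite) tagged"
  assumes K': "nondegenerate K'" "E \<in> facets K'" and h: "E \<subseteq> {y. \<nu> \<bullet> y = b}"
  shows "elem K' \<subseteq> {y. \<nu> \<bullet> y \<le> b} \<or> elem K' \<subseteq> {y. (- \<nu>) \<bullet> y \<le> - b}"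
proof -
  obtain p where p: "p \<in> set (fst K')" "E = convex hull (set (fst K') - {p})"
    using K'(2) by (auto simp: facets_def)
  have on: "\<nu> \<bullet> y = b" if "y \<in> set (fst K')" "y \<noteq> p" for y
  proof -
    have "y \<in> E" using that p by (auto intro: hull_inc)
    then show ?thesis using h by auto
  qed
  show ?thesis
  proof (cases "\<nu> \<bullet> p \<le> b")
    case True
    then have "set (fst K') \<subseteq> {y. \<nu> \<bullet> y \<le> b}" using on by force
    then show ?thesis unfolding elem_def by (simp add: hull_minimal convex_halfspace_le)
  next
    case False
    then have "set (fst K') \<subseteq> {y. (- \<nu>) \<bullet> y \<le> - b}" using on by force
    then have "elem K' \<subseteq> {y. (- \<nu>) \<bullet> y \<le> - b}" unfolding elem_def
      by (rule hull_minimal) (rule convex_halfspace_le)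
    then show ?thesis ..
  qed
qed

lemma mesh_interiors_disjoint:
  assumes "is_mesh \<Omega> \<T>" "K \<in> \<T>" "K' \<in> \<T>" "K \<noteq> K'"
  shows "interior (elem K) \<inter> interior (elem K') = {}"
proof (rule ccontr)
  assume "\<not> ?thesis"
  then obtain x where "x \<in> interior (elem K)" "x \<in> interior (elem K')" by auto
  then have "x \<in> elem K'" using interior_subset[of "elem K'"] by auto
  then show False using mesh_interior_unique[OF assms(1-3)] \<open>x \<in> interior (elem K)\<close> assms(4) by auto
qed

text \<open>Of three elements with a common facet, two lie on the same side of it.\<close>

lemma facet_nbs_unique:
  fixes \<T> :: "('n::finite) mesh"
  assumes m: "is_mesh \<Omega> \<T>" and K: "K \<in> \<T>" and E: "E \<in> facets K"
    and nb: "K1 \<in> facet_nbs \<T> K E" "K2 \<in> facet_nbs \<T> K E"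
  shows "K1 = K2"
proof (rule ccontr)
  assume ne: "K1 \<noteq> K2"
  have mem: "K1 \<in> \<T>" "K2 \<in> \<T>" "K1 \<noteq> K" "K2 \<noteq> K" "E \<in> facets K1" "E \<in> facets K2"
    using nb by (auto simp: facet_nbs_def)
  note nd = is_mesh_nondegenerate[OF m]
  obtain \<nu> b where h: "norm \<nu> = 1" "E \<subseteq> {y. \<nu> \<bullet> y = b}" "elem K \<subseteq> {y. \<nu> \<bullet> y \<le> b}"
    using facet_hyperplane[OF nd[OF K] E] by blast
  have E': "E \<subseteq> {y. (- \<nu>) \<bullet> y = - b}" using h by auto
  have nz: "\<nu> \<noteq> 0" "- \<nu> \<noteq> 0" using h(1) by auto
  note disj = mesh_interiors_disjoint[OF m]
  have s: "elem L \<subseteq> {y. (- \<nu>) \<bullet> y \<le> - b}" if L: "L \<in> {K1, K2}" for L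
  proof -
    have L': "L \<in> \<T>" "E \<in> facets L" "K \<noteq> L" using L mem by auto
    have "\<not> elem L \<subseteq> {y. \<nu> \<bullet> y \<le> b}"
    proof
      assume "elem L \<subseteq> {y. \<nu> \<bullet> y \<le> b}"
      from same_side_overlap[OF nd[OF K] nd[OF L'(1)] E L'(2) h(2,3) this nz(1)]
        disj[OF K L'(1,3)] show False by (rule notE)
    qed
    with facet_sides[OF nd[OF L'(1)] L'(2) h(2)] show ?thesis by (metis (no_types))
  qed
  have "elem K1 \<subseteq> {y. (- \<nu>) \<bullet> y \<le> - b}" "elem K2 \<subseteq> {y. (- \<nu>) \<bullet> y \<le> - b}"
    by (rule s, simp)+
  from same_side_overlap[OF nd[OF mem(1)] nd[OF mem(2)] mem(5,6) E' this nz(2)]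
    disj[OF mem(1,2) ne] show False by (rule notE)
qed

text \<open>The half balls in the two elements lie on different sides of the facet and form a ball.\<close>

lemma inner_facet_interior:
  fixes \<T> :: "('n::finite) mesh"
  assumes m: "is_mesh \<Omega> \<T>" and K: "K \<in> \<T>" and E: "E \<in> facets K"
    and nb: "K1 \<in> facet_nbs \<T> K E" and x: "x \<in> rel_interior E"
  shows "x \<in> interior (closure \<Omega>)"
proof -
  have mem: "K1 \<in> \<T>" "K1 \<noteq> K" "E \<in> facets K1" using nb by (auto simp: facet_nbs_def)
  note nd = is_mesh_nondegenerate[OF m]
  obtain \<nu> b where h: "norm \<nu> = 1" "E \<subseteq> {y. \<nu> \<bullet> y = b}" "elem K \<subseteq> {y. \<nu> \<bullet> y \<le> b}"
    using facet_hyperplane[OF nd[OF K] E] by blast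
  have E': "E \<subseteq> {y. (- \<nu>) \<bullet> y = - b}" using h by auto
  have nz: "\<nu> \<noteq> 0" "- \<nu> \<noteq> 0" using h(1) by auto
  have disj: "interior (elem K) \<inter> interior (elem K1) = {}"
    using mesh_interiors_disjoint[OF m K mem(1)] mem(2) by simp
  have "\<not> elem K1 \<subseteq> {y. \<nu> \<bullet> y \<le> b}"
  proof
    assume "elem K1 \<subseteq> {y. \<nu> \<bullet> y \<le> b}"
    from same_side_overlap[OF nd[OF K] nd[OF mem(1)] E mem(3) h(2,3) this nz(1)] disj
    show False by (rule notE)
  qed
  with facet_sides[OF nd[OF mem(1)] mem(3) h(2)] have s: "elem K1 \<subseteq> {y. (- \<nu>) \<bullet> y \<le> - b}"
    by (metis (no_types))
  obtain r1 where r1: "r1 > 0" "ball x r1 \<inter> {y. \<nu> \<bullet> y < b} \<subseteq> interior (elem K)"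
    using half_ball_subset_elem[OF nd[OF K] E x h(2,3) nz(1)] by blast
  obtain r2 where r2: "r2 > 0" "ball x r2 \<inter> {y. (- \<nu>) \<bullet> y < - b} \<subseteq> interior (elem K1)"
    using half_ball_subset_elem[OF nd[OF mem(1)] mem(3) x E' s nz(2)] by blast
  define r where "r = min r1 r2"
  have cl: "elem L \<subseteq> closure \<Omega>" if "L \<in> \<T>" for L using m that by (auto simp: is_mesh_def)
  have "ball x r \<subseteq> closure \<Omega>"
  proof
    fix y assume y: "y \<in> ball x r"
    consider "\<nu> \<bullet> y < b" | "\<nu> \<bullet> y > b" | "\<nu> \<bullet> y = b" by linarith
    then show "y \<in> closure \<Omega>"
    proof cases
      case 1
      then have "y \<in> interior (elem K)" using r1 y by (auto simp: r_def)
      then have "y \<in> elem K" using interior_subset by fast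
      then show ?thesis using cl[OF K] by blast
    next
      case 2
      then have "y \<in> interior (elem K1)" using r2 y by (auto simp: r_def)
      then have "y \<in> elem K1" using interior_subset by fast
      then show ?thesis using cl[OF mem(1)] by blast
    next
      case 3
      have "y \<in> closure (elem K)"
      proof (rule closure_approachable[THEN iffD2], intro allI impI)
        fix e :: real assume "e > 0"
        obtain \<rho> where \<rho>: "\<rho> = r - dist x y" "\<rho> > 0" using y by simp
        obtain t where t: "t > 0" "t < e" "t < \<rho>"
          using \<open>e > 0\<close> \<rho>(2) field_lbound_gt_zero by metis
        let ?z = "y - t *\<^sub>R \<nu>"
        have "dist y ?z = t" using t h(1) by (simp add: dist_norm)
        then have "?z \<in> ball x r1" using t \<rho>(1) dist_triangle[of x ?z y] by (simp add: r_def)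
        moreover have "\<nu> \<bullet> ?z < b" using 3 t(1) h(1) by (simp add: inner_diff_right nz)
        ultimately have "?z \<in> interior (elem K)" using r1(2) by auto
        then have "?z \<in> elem K" using interior_subset by fast
        moreover have "dist ?z y < e" using \<open>dist y ?z = t\<close> t by (simp add: dist_commute)
        ultimately show "\<exists>z\<in>elem K. dist z y < e" by blast
      qed
      then show ?thesis using cl[OF K] by auto
    qed
  qed
  moreover have "r > 0" using r1 r2 by (simp add: r_def)
  ultimately show ?thesis by (auto simp: mem_interior)
qed

text \<open>Near a boundary point the domain is a strict epigraph, and the points below the graph do not
  belong to its closure.\<close>

lemma lipschitz_interior_closure:
  assumes "lipschitz_domain \<Omega>"
  shows "interior (closure \<Omega>) = \<Omega>"
proof
  have op: "open \<Omega>" using assms by (simp add: lipschitz_domain_def)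
  then show "\<Omega> \<subseteq> interior (closure \<Omega>)" by (simp add: interior_maximal closure_subset)
  show "interior (closure \<Omega>) \<subseteq> \<Omega>"
  proof
    fix x assume xi: "x \<in> interior (closure \<Omega>)"
    show "x \<in> \<Omega>"
    proof (rule ccontr)
      assume "x \<notin> \<Omega>"
      moreover have "x \<in> closure \<Omega>" using xi interior_subset by blast
      ultimately have "x \<in> frontier \<Omega>" using op by (simp add: frontier_def interior_open)
      moreover have "\<forall>x\<in>frontier \<Omega>. \<exists>r>0. \<exists>e h L. norm e = 1 \<and> L-lipschitz_on UNIV h \<and>
          \<Omega> \<inter> ball x r = {y \<in> ball x r. h (y - (y \<bullet> e) *\<^sub>R e) < y \<bullet> e}"
        using assms unfolding lipschitz_domain_def by (elim conjE)
      ultimately have "\<exists>r>0. \<exists>e h L. norm e = 1 \<and> L-lipschitz_on UNIV h \<and>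
          \<Omega> \<inter> ball x r = {y \<in> ball x r. h (y - (y \<bullet> e) *\<^sub>R e) < y \<bullet> e}"
        by (rule bspec[rotated])
      then obtain r e h L where r: "r > 0" "norm e = 1" "L-lipschitz_on UNIV h"
        "\<Omega> \<inter> ball x r = {y \<in> ball x r. h (y - (y \<bullet> e) *\<^sub>R e) < y \<bullet> e}"
        by (elim exE conjE)
      have "continuous_on UNIV h" using r(3) by (rule lipschitz_on_continuous_on)
      then have cont: "continuous_on UNIV (\<lambda>y. h (y - (y \<bullet> e) *\<^sub>R e))"
        by (rule continuous_on_compose2) (auto intro!: continuous_intros)
      obtain d where d: "d > 0" "ball x d \<subseteq> closure \<Omega>" using xi by (auto simp: mem_interior)
      define t where "t = min d r / 2"
      have t: "t > 0" "t < d" "t < r" using d r by (auto simp: t_def)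
      define y where "y = x - t *\<^sub>R e"
      have ye: "y - (y \<bullet> e) *\<^sub>R e = x - (x \<bullet> e) *\<^sub>R e"
        using r(2) by (simp add: y_def inner_diff_left scaleR_diff_left flip: power2_norm_eq_inner)
      have "\<not> h (x - (x \<bullet> e) *\<^sub>R e) < x \<bullet> e" using \<open>x \<notin> \<Omega>\<close> r(1,4) by auto
      moreover have "y \<bullet> e = x \<bullet> e - t" using r(2) by (simp add: y_def inner_diff_left flip: power2_norm_eq_inner)
      ultimately have gt: "y \<bullet> e < h (y - (y \<bullet> e) *\<^sub>R e)" using t ye by auto
      let ?U = "ball x r \<inter> {y. y \<bullet> e < h (y - (y \<bullet> e) *\<^sub>R e)}"
      have "open ?U"
        by (intro open_Int open_ball open_Collect_less cont continuous_intros)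
      moreover have "y \<in> ?U" using gt t r(2) by (simp add: y_def dist_norm)
      moreover have "z \<notin> \<Omega>" if "z \<in> ?U" for z
      proof
        assume "z \<in> \<Omega>"
        with that have "z \<in> \<Omega> \<inter> ball x r" by simp
        then show False using that unfolding r(4) by simp
      qed
      then have "?U \<inter> \<Omega> = {}" by auto
      ultimately have "y \<notin> closure \<Omega>" using open_Int_closure_eq_empty[of ?U \<Omega>] by auto
      moreover have "y \<in> ball x d" using t r(2) by (simp add: y_def dist_norm)
      ultimately show False using d(2) by blast
    qed
  qed
qed

text \<open>Interiors of elements lie in the domain, because it is the interior of its closure.\<close>

lemma frontier_subset_facets:
  assumes lip: "lipschitz_domain \<Omega>" and m: "is_mesh \<Omega> \<T>"
  shows "frontier \<Omega> \<subseteq> (\<Union>K\<in>\<T>. frontier (elem K))"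
proof
  fix x assume x: "x \<in> frontier \<Omega>"
  have "open \<Omega>" using lip by (simp add: lipschitz_domain_def)
  then have x': "x \<in> closure \<Omega>" "x \<notin> \<Omega>" using x by (auto simp: frontier_def interior_open)
  then obtain K where K: "K \<in> \<T>" "x \<in> elem K" using m unfolding is_mesh_def by blast
  have "elem K \<subseteq> closure \<Omega>" using m K by (auto simp: is_mesh_def)
  then have "interior (elem K) \<subseteq> \<Omega>" using interior_mono lipschitz_interior_closure[OF lip] by metis
  then show "x \<in> (\<Union>K\<in>\<T>. frontier (elem K))" using K x' by (auto simp: frontier_def)
qed

section \<open>Surface measure of facets\<close>

text \<open>A finite cover is padded with empty sets, which have diameter zero; \<open>m > 0\<close> makes their
  contribution vanish.\<close>

lemma hausdorff_pre_finite_cover: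
  fixes C :: "'i \<Rightarrow> 'a::metric_space set"
  assumes J: "finite J" and cov: "A \<subseteq> (\<Union>j\<in>J. C j)" and m: "m > 0" and D: "D \<ge> 0" "D \<le> \<delta>"
    and C: "\<And>j. j \<in> J \<Longrightarrow> bounded (C j) \<and> diameter (C j) \<le> D"
  shows "hausdorff_pre m \<delta> A \<le> ennreal (real (card J) * (unit_ball_vol (real m) * (D / 2) ^ m))"
proof -
  obtain h where h: "bij_betw h {..<card J} J" using J bij_betw_from_nat_into_finite by blast
  define B where "B i = (if i < card J then C (h i) else {})" for i
  have hJ: "h i \<in> J" if "i < card J" for i using h that by (auto simp: bij_betw_def)
  have B: "bounded (B i) \<and> diameter (B i) \<le> \<delta>" for i
    using C[OF hJ] D by (auto simp: B_def intro: order_trans)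
  have covB: "A \<subseteq> (\<Union>i. B i)"
  proof
    fix x assume "x \<in> A"
    then obtain j where j: "j \<in> J" "x \<in> C j" using cov by blast
    have "j \<in> h ` {..<card J}" using h j(1) by (simp add: bij_betw_def)
    then obtain i where "i < card J" "h i = j" by auto
    then show "x \<in> (\<Union>i. B i)" using j by (auto simp: B_def intro!: exI[of _ i])
  qed
  let ?w = "\<lambda>i. ennreal (unit_ball_vol (real m) * (diameter (B i) / 2) ^ m)"
  have "hausdorff_pre m \<delta> A \<le> (\<Sum>i. ?w i)"
    unfolding hausdorff_pre_def by (rule INF_lower) (use B covB in auto)
  also have "\<dots> = (\<Sum>i<card J. ?w i)"
    by (rule suminf_finite) (use m in \<open>auto simp: B_def\<close>)
  also have "\<dots> \<le> (\<Sum>i<card J. ennreal (unit_ball_vol (real m) * (D / 2) ^ m))"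
  proof (rule sum_mono)
    fix i assume "i \<in> {..<card J}"
    then have "bounded (B i)" "diameter (B i) \<le> D" using C[OF hJ] by (auto simp: B_def)
    then show "?w i \<le> ennreal (unit_ball_vol (real m) * (D / 2) ^ m)"
      by (intro ennreal_leI mult_left_mono power_mono divide_right_mono) (auto simp: diameter_ge_0)
  qed
  also have "\<dots> = ennreal (real (card J) * (unit_ball_vol (real m) * (D / 2) ^ m))"
    using D by (simp add: ennreal_mult ennreal_of_nat_eq_real_of_nat)
  finally show ?thesis .
qed

text \<open>The parameter cube of the edges that start in one vertex is cut into a grid.  This covers the hull
  of \<open>k + 1\<close> points by \<open>n ^ k\<close> cells of diameter at most \<open>D / n\<close>.  For \<open>n\<close> to infinity their
  \<open>m\<close>-dimensional content stays bounded if \<open>k = m\<close> and vanishes if \<open>k < m\<close>.\<close>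

lemma hausdorff_outer_convex_hull:
  fixes V :: "'a::euclidean_space set"
  assumes V: "finite V" "card V = Suc k" and m: "m > 0" and km: "k \<le> m"
  obtains c where "hausdorff_outer m (convex hull V) \<le> ennreal c" "k < m \<Longrightarrow> c = 0" "c \<ge> 0"
proof -
  obtain v where v: "v \<in> V" using V by fastforce
  define W where "W = V - {v}"
  have W: "finite W" "card W = k" "V = insert v W" "v \<notin> W" using V v by (auto simp: W_def)
  define D where "D = (\<Sum>w\<in>W. norm (w - v))"
  have D: "D \<ge> 0" by (simp add: D_def sum_nonneg)
  let ?b = "unit_ball_vol (real m)"
  have pre: "hausdorff_pre m \<delta> (convex hull V) \<le> ennreal (real (n ^ k) * (?b * (D / real n / 2) ^ m))"
    if n: "n > 0" "D / real n \<le> \<delta>" for n \<delta>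
  proof -
    define J where "J = W \<rightarrow>\<^sub>E {..<n}"
    define C where "C j = {v + (\<Sum>w\<in>W. u w *\<^sub>R (w - v)) |u.
      \<forall>w\<in>W. real (j w) / real n \<le> u w \<and> u w \<le> (real (j w) + 1) / real n}" for j :: "'a \<Rightarrow> nat"
    have diamC: "dist x y \<le> D / real n" if xy: "x \<in> C j" "y \<in> C j" for x y j
    proof -
      from xy obtain u u' where x: "x = v + (\<Sum>w\<in>W. u w *\<^sub>R (w - v))"
        "\<And>w. w \<in> W \<Longrightarrow> real (j w) / real n \<le> u w \<and> u w \<le> (real (j w) + 1) / real n"
        and y: "y = v + (\<Sum>w\<in>W. u' w *\<^sub>R (w - v))"
        "\<And>w. w \<in> W \<Longrightarrow> real (j w) / real n \<le> u' w \<and> u' w \<le> (real (j w) + 1) / real n"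
        unfolding C_def by blast
      have "x - y = (\<Sum>w\<in>W. (u w - u' w) *\<^sub>R (w - v))"
        by (simp add: x(1) y(1) sum_subtractf scaleR_diff_left)
      then have "dist x y \<le> (\<Sum>w\<in>W. \<bar>u w - u' w\<bar> * norm (w - v))"
        unfolding dist_norm by (metis (no_types, lifting) norm_scaleR norm_sum sum.cong)
      also have "\<dots> \<le> (\<Sum>w\<in>W. (1 / real n) * norm (w - v))"
      proof (intro sum_mono mult_right_mono)
        fix w assume "w \<in> W"
        from x(2)[OF this] y(2)[OF this] show "\<bar>u w - u' w\<bar> \<le> 1 / real n"
          by (auto simp: add_divide_distrib)
      qed simp
      also have "\<dots> = D / real n" by (simp add: D_def sum_divide_distrib)
      finally show ?thesis .
    qed
    have bd: "bounded (C j) \<and> diameter (C j) \<le> D / real n" for j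
    proof
      show "bounded (C j)"
      proof (cases "C j = {}")
        case False
        then obtain x where "x \<in> C j" by auto
        then show ?thesis using diamC unfolding bounded_def by blast
      qed auto
      show "diameter (C j) \<le> D / real n"
        using diamC D by (intro diameter_le) (auto simp: dist_norm)
    qed
    have cov: "convex hull V \<subseteq> (\<Union>j\<in>J. C j)"
    proof
      fix x assume "x \<in> convex hull V"
      then obtain u where u: "\<And>w. w \<in> V \<Longrightarrow> 0 \<le> u w" "sum u V = 1" "(\<Sum>w\<in>V. u w *\<^sub>R w) = x"
        using V(1) by (auto simp: convex_hull_finite)
      have s: "u v + sum u W = 1" "u v *\<^sub>R v + (\<Sum>w\<in>W. u w *\<^sub>R w) = x" using u(2,3) W by auto
      have u1: "0 \<le> u w \<and> u w \<le> 1" if "w \<in> W" for w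
      proof -
        have "u w \<le> sum u V" using u(1) that V(1) W(3) by (intro member_le_sum) auto
        then show ?thesis using u that W(3) by simp
      qed
      have "u v = 1 - sum u W" using s(1) by simp
      then have x: "x = v + (\<Sum>w\<in>W. u w *\<^sub>R (w - v))"
        using s(2)[symmetric]
        by (simp add: scaleR_diff_right sum_subtractf scaleR_left_diff_distrib flip: scaleR_left.sum)
      \<comment> \<open>The minimum puts parameters equal to \<open>1\<close> into the last cell.\<close>
      define j where "j = (\<lambda>w\<in>W. min (n - 1) (nat \<lfloor>u w * real n\<rfloor>))"
      have "j \<in> J" using n(1) by (auto simp: J_def j_def)
      moreover have "x \<in> C j"
      proof -
        have "real (j w) / real n \<le> u w \<and> u w \<le> (real (j w) + 1) / real n" if w: "w \<in> W" for w
        proof -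
          have un: "0 \<le> u w * real n" "u w * real n \<le> real n" using u1[OF w] n by (auto simp: mult_left_le_one_le)
          define f where "f = nat \<lfloor>u w * real n\<rfloor>"
          have f: "real f \<le> u w * real n" "u w * real n < real f + 1"
            using un by (auto simp: f_def) 
          have jw: "j w = min (n - 1) f" using w by (simp add: j_def f_def)
          have "real (j w) \<le> u w * real n" using f(1) unfolding jw by (auto simp: min_def)
          moreover have "u w * real n \<le> real (j w) + 1"
            using f(2) un(2) n(1) unfolding jw by (auto simp: min_def of_nat_diff)
          ultimately show ?thesis using n(1) by (simp add: field_simps)
        qed
        then show ?thesis unfolding C_def using x by blast
      qed
      ultimately show "x \<in> (\<Union>j\<in>J. C j)" by blast
    qed
    have "finite J" "card J = n ^ k" using W by (auto simp: J_def card_PiE finite_PiE)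
    then show ?thesis
      using hausdorff_pre_finite_cover[OF _ cov m _ n(2) bd] D n by simp
  qed
  define c where "c = (if k < m then 0 else ?b * (D / 2) ^ m)"
  have c0: "c \<ge> 0" using D by (simp add: c_def)
  have "hausdorff_pre m \<delta> (convex hull V) \<le> ennreal c" if \<delta>: "\<delta> > 0" for \<delta>
  proof -
    have lim: "(\<lambda>n. ennreal (real (n ^ k) * (?b * (D / real n / 2) ^ m))) \<longlonglongrightarrow> ennreal c"
    proof (rule tendsto_ennrealI)
      have eq: "real (n ^ k) * (?b * (D / real n / 2) ^ m) = (?b * (D / 2) ^ m) * (1 / real n) ^ (m - k)"
        if "n > 0" for n
      proof -
        have "(D / real n / 2) ^ m = (D / 2) ^ m * ((1 / real n) ^ k * (1 / real n) ^ (m - k))"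
          using km by (simp add: power_divide flip: power_add)
        moreover have "real (n ^ k) * (1 / real n) ^ k = 1" using that by (simp add: power_divide)
        ultimately show ?thesis by (simp add: algebra_simps)
      qed
      have "(\<lambda>n. (?b * (D / 2) ^ m) * (1 / real n) ^ (m - k)) \<longlonglongrightarrow> c"
      proof (cases "k < m")
        case True
        have "(\<lambda>n. 1 / real n) \<longlonglongrightarrow> 0" by (rule lim_1_over_n)
        then have "(\<lambda>n. (1 / real n) ^ (m - k)) \<longlonglongrightarrow> 0 ^ (m - k)" by (rule tendsto_power)
        then have "(\<lambda>n. (1 / real n) ^ (m - k)) \<longlonglongrightarrow> 0" using True by (simp add: power_0_left)
        from tendsto_mult_right_zero[OF this] show ?thesis using True by (simp add: c_def)
      next
        case False
        then show ?thesis using km by (simp add: c_def)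
      qed
      then show "(\<lambda>n. real (n ^ k) * (?b * (D / real n / 2) ^ m)) \<longlonglongrightarrow> c"
      proof (rule Lim_transform_eventually)
        show "\<forall>\<^sub>F n in sequentially. (?b * (D / 2) ^ m) * (1 / real n) ^ (m - k)
            = real (n ^ k) * (?b * (D / real n / 2) ^ m)"
          using eventually_gt_at_top[of "0::nat"] by eventually_elim (rule eq[symmetric])
      qed
    qed
    obtain N :: nat where N: "D / \<delta> < real N" using reals_Archimedean2 by blast
    have "hausdorff_pre m \<delta> (convex hull V) \<le> ennreal (real (n ^ k) * (?b * (D / real n / 2) ^ m))"
      if "n \<ge> Suc N" for n
    proof (rule pre)
      show "n > 0" using that by simp
      have "D / \<delta> \<le> real n" using N that by linarith
      then show "D / real n \<le> \<delta>" using \<delta> \<open>n > 0\<close> by (simp add: field_simps)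
    qed
    then show ?thesis using lim by (intro tendsto_lowerbound[OF lim]) (auto simp: eventually_sequentially)
  qed
  then have "hausdorff_outer m (convex hull V) \<le> ennreal c"
    unfolding hausdorff_outer_def by (intro SUP_least) auto
  then show thesis using that c0 by (auto simp: c_def)
qed

lemma sets_surface_measure [simp]: "sets surface_measure = sets borel"
  and space_surface_measure [simp]: "space surface_measure = UNIV"
  using sets.sigma_sets_eq[of borel] by (auto simp: surface_measure_def sets_measure_of_conv space_measure_of_conv)

text \<open>By the convention for \<open>measure_of\<close> the left-hand side is either the outer measure or zero.\<close>

lemma emeasure_surface_measure_le:
  "emeasure surface_measure (A :: (real^'n) set) \<le> hausdorff_outer (CARD('n) - 1) A"
  unfolding surface_measure_def by (simp add: emeasure_measure_of_conv)

lemma convex_hull_surface_null: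
  fixes V :: "(real^'n) set"
  assumes V: "finite V" "card V < CARD('n)" and n: "CARD('n) \<ge> 2"
  shows "convex hull V \<in> null_sets surface_measure"
proof (cases "V = {}")
  case False
  then obtain k where k: "card V = Suc k" using V by (metis card_eq_0_iff not0_implies_Suc)
  have "0 < CARD('n) - 1" "k \<le> CARD('n) - 1" using V(2) n k by auto
  from hausdorff_outer_convex_hull[OF V(1) k this]
  obtain c where c: "hausdorff_outer (CARD('n) - 1) (convex hull V) \<le> ennreal c"
    "k < CARD('n) - 1 \<Longrightarrow> c = 0" "c \<ge> 0" by blast
  have "c = 0" using c(2) V(2) k by simp
  then have "emeasure surface_measure (convex hull V) \<le> 0"
    using c(1) emeasure_surface_measure_le[of "convex hull V"] by simp
  moreover have "convex hull V \<in> sets borel"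
    using V(1) by (simp add: borel_compact finite_imp_compact_convex_hull)
  ultimately show ?thesis by (simp add: null_sets_def)
qed simp

lemma facet_surface_finite:
  fixes K :: "('n::finite) tagged"
  assumes K: "nondegenerate K" "E \<in> facets K" and n: "CARD('n) \<ge> 2"
  shows "emeasure surface_measure E < \<infinity>"
proof -
  obtain x where x: "x \<in> set (fst K)" "E = convex hull (set (fst K) - {x})"
    using K by (auto simp: facets_def)
  have "card (set (fst K) - {x}) = Suc (CARD('n) - 1)"
    using K(1) x by (simp add: nondegenerate_iff distinct_card)
  then obtain c where "hausdorff_outer (CARD('n) - 1) E \<le> ennreal c"
    using hausdorff_outer_convex_hull[of "set (fst K) - {x}" "CARD('n) - 1" "CARD('n) - 1"] n x(2) by auto
  with emeasure_surface_measure_le[of E] show ?thesis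
    by (metis ennreal_less_top infinity_ennreal_def order_le_less_trans)
qed

lemma facet_surface_sets:
  "nondegenerate K \<Longrightarrow> E \<in> facets K \<Longrightarrow> E \<in> sets surface_measure"
  by (simp add: borel_compact facet_props(6))

lemma rel_boundary_facet_null:
  fixes K :: "('n::finite) tagged"
  assumes K: "nondegenerate K" "E \<in> facets K" and n: "CARD('n) \<ge> 2" and F: "F face_of E" "F \<noteq> E"
  shows "F \<in> null_sets surface_measure"
  using proper_face_of_facet[OF K F] convex_hull_surface_null[OF _ _ n] by blast

text \<open>The relative boundary of a facet is the union of hulls of one vertex less.\<close>

lemma facet_boundary_null:
  fixes K :: "('n::finite) tagged"
  assumes K: "nondegenerate K" "E \<in> facets K" and n: "CARD('n) \<ge> 2"
  shows "E - rel_interior E \<in> null_sets surface_measure"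
proof -
  obtain x where x: "x \<in> set (fst K)" "E = convex hull (set (fst K) - {x})"
    using K by (auto simp: facets_def)
  let ?V = "set (fst K) - {x}"
  have ind: "\<not> affine_dependent ?V"
    using K(1) affine_independent_subset[of "set (fst K)" ?V] by (auto simp: nondegenerate_iff)
  have card: "card ?V = CARD('n)" using K(1) x by (simp add: nondegenerate_iff distinct_card)
  have "E - rel_interior E = rel_frontier E"
    using facet_props(6)[OF K] by (simp add: rel_frontier_def compact_imp_closed)
  also have "\<dots> = (\<Union>y\<in>?V. convex hull (?V - {y}))"
    unfolding x(2) rel_frontier_convex_hull_cases[OF ind] by auto
  also have "\<dots> \<in> null_sets surface_measure"
  proof (rule null_sets.finite_UN)
    fix y assume "y \<in> ?V"
    then have "card (?V - {y}) < card ?V" by (intro psubset_card_mono) auto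
    then show "convex hull (?V - {y}) \<in> null_sets surface_measure"
      using n card by (intro convex_hull_surface_null) auto
  qed simp
  finally show ?thesis .
qed

text \<open>For the load term this is used with Lebesgue measure and elements, for the jump terms with surface
  measure and facets.\<close>

lemma sum_integral_almost_disjoint:
  fixes w :: "'a \<Rightarrow> real"
  assumes I: "finite I" and A: "\<And>i. i \<in> I \<Longrightarrow> A i \<in> sets M \<and> A i \<subseteq> B" and B: "B \<in> sets M"
    and null: "\<And>i j. i \<in> I \<Longrightarrow> j \<in> I \<Longrightarrow> i \<noteq> j \<Longrightarrow> A i \<inter> A j \<in> null_sets M"
    and w: "set_integrable M B w" "\<And>x. 0 \<le> w x"
  shows "(\<Sum>i\<in>I. LINT x:A i|M. w x) \<le> (LINT x:B|M. w x)"
proof -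
  have int: "set_integrable M (A i) w" if "i \<in> I" for i
    using set_integrable_subset[OF w(1)] A[OF that] by blast
  have "(\<Sum>i\<in>I. LINT x:A i|M. w x) = (LINT x|M. (\<Sum>i\<in>I. indicator (A i) x *\<^sub>R w x))"
    unfolding set_lebesgue_integral_def
    by (rule Bochner_Integration.integral_sum[symmetric]) (use int in \<open>auto simp: set_integrable_def\<close>)
  also have "\<dots> \<le> (LINT x|M. indicator B x *\<^sub>R w x)"
  proof (rule integral_mono_AE)
    show "integrable M (\<lambda>x. \<Sum>i\<in>I. indicator (A i) x *\<^sub>R w x)"
      using int by (intro Bochner_Integration.integrable_sum) (auto simp: set_integrable_def)
    show "integrable M (\<lambda>x. indicator B x *\<^sub>R w x)" using w(1) by (simp add: set_integrable_def)
    have "AE x in M. \<forall>i\<in>I. \<forall>j\<in>I. i \<noteq> j \<longrightarrow> x \<notin> A i \<inter> A j"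
    proof (intro AE_finite_allI[OF I])
      fix i j assume ij: "i \<in> I" "j \<in> I"
      show "AE x in M. i \<noteq> j \<longrightarrow> x \<notin> A i \<inter> A j"
        using AE_not_in[OF null[OF ij]] by (cases "i = j") auto
    qed
    then show "AE x in M. (\<Sum>i\<in>I. indicator (A i) x *\<^sub>R w x) \<le> indicator B x *\<^sub>R w x"
    proof eventually_elim
      case (elim x)
      show ?case
      proof (cases "\<exists>i\<in>I. x \<in> A i")
        case True
        then obtain i where i: "i \<in> I" "x \<in> A i" by blast
        have "(\<Sum>j\<in>I. indicator (A j) x *\<^sub>R w x) = (\<Sum>j\<in>{i}. indicator (A j) x *\<^sub>R w x)"
          by (rule sum.mono_neutral_right) (use I i elim in \<open>auto simp: indicator_def\<close>)
        also have "\<dots> = indicator B x *\<^sub>R w x" using i A[OF i(1)] by (auto simp: indicator_def)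
        finally show ?thesis by simp
      next
        case False
        then show ?thesis using w(2) by (simp add: indicator_def)
      qed
    qed
  qed
  finally show ?thesis by (simp add: set_lebesgue_integral_def)
qed

section \<open>Weak gradients of affine functions\<close>

text \<open>The first two conditions on a test function, with the gradient as explicit data.\<close>

definition C1_fun :: "(real^'n \<Rightarrow> real) \<Rightarrow> (real^'n \<Rightarrow> real^'n) \<Rightarrow> bool" where
  "C1_fun \<phi> d\<phi> \<longleftrightarrow>
     (\<forall>x. (\<phi> has_derivative (\<lambda>h. d\<phi> x \<bullet> h)) (at x)) \<and> continuous_on UNIV d\<phi>"

lemma C1_fun_continuous: "C1_fun \<phi> d\<phi> \<Longrightarrow> continuous_on UNIV \<phi>"
  unfolding C1_fun_def by (meson has_derivative_continuous continuous_at_imp_continuous_on)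

lemma C1_fun_mult:
  assumes "C1_fun f df" "C1_fun g dg"
  shows "C1_fun (\<lambda>x. f x * g x) (\<lambda>x. f x *\<^sub>R dg x + g x *\<^sub>R df x)"
  unfolding C1_fun_def
proof (intro conjI allI)
  fix x
  have "((\<lambda>x. f x * g x) has_derivative (\<lambda>h. f x * (dg x \<bullet> h) + (df x \<bullet> h) * g x)) (at x)"
    using assms by (intro has_derivative_mult) (auto simp: C1_fun_def)
  then show "((\<lambda>x. f x * g x) has_derivative (\<lambda>h. (f x *\<^sub>R dg x + g x *\<^sub>R df x) \<bullet> h)) (at x)"
    by (simp add: inner_add_left mult.commute)
qed (use assms C1_fun_continuous in \<open>auto simp: C1_fun_def intro!: continuous_intros\<close>)

lemma C1_fun_compose:
  fixes f :: "real^'n \<Rightarrow> real"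
  assumes f: "C1_fun f df" and g: "\<And>y. (g has_real_derivative g' y) (at y)" "continuous_on UNIV g'"
  shows "C1_fun (\<lambda>x. g (f x)) (\<lambda>x. g' (f x) *\<^sub>R df x)"
  unfolding C1_fun_def
proof (intro conjI allI)
  fix x
  have "(g \<circ> f has_derivative (*) (g' (f x)) \<circ> (\<lambda>h. df x \<bullet> h)) (at x)"
    using f g(1)[of "f x"] unfolding C1_fun_def has_field_derivative_def
    by (intro diff_chain_at) auto
  then show "((\<lambda>x. g (f x)) has_derivative (\<lambda>h. (g' (f x) *\<^sub>R df x) \<bullet> h)) (at x)"
    by (simp add: o_def)
  show "continuous_on UNIV (\<lambda>x. g' (f x) *\<^sub>R df x)"
    using f C1_fun_continuous[OF f]
    by (auto simp: C1_fun_def intro!: continuous_intros continuous_on_compose2[OF g(2)])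
qed

lemma C1_fun_affine: "C1_fun (\<lambda>x. a \<bullet> x + c) (\<lambda>x. a)"
  by (auto simp: C1_fun_def intro!: derivative_eq_intros)

lemma C1_fun_prod:
  assumes "finite I" "\<And>i. i \<in> I \<Longrightarrow> \<exists>df. C1_fun (f i) df"
  shows "\<exists>df. C1_fun (\<lambda>x. \<Prod>i\<in>I. f i x) df"
  using assms
proof (induction I)
  case empty
  have "C1_fun (\<lambda>x. 0 \<bullet> x + 1) (\<lambda>x. 0)" by (rule C1_fun_affine)
  then show ?case by auto
next
  case (insert i I)
  have "\<exists>df. C1_fun (f i) df" "\<exists>dg. C1_fun (\<lambda>x. \<Prod>i\<in>I. f i x) dg"
    using insert.prems[of i] insert.IH insert.prems by blast+
  then obtain df dg where "C1_fun (f i) df" "C1_fun (\<lambda>x. \<Prod>i\<in>I. f i x) dg" by (elim exE)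
  from C1_fun_mult[OF this] show ?case using insert by auto
qed

text \<open>The square of the positive part is the building block of continuously differentiable functions
  with compact support.\<close>

lemma derivative_max_square:
  "((\<lambda>t. (max 0 t)\<^sup>2) has_real_derivative 2 * max 0 t) (at (t::real))"
proof -
  consider "t > 0" | "t < 0" | "t = 0" by linarith
  then show ?thesis
  proof cases
    case 1
    have "((\<lambda>t. t\<^sup>2) has_real_derivative 2 * t) (at t)" by (auto intro!: derivative_eq_intros)
    then have "((\<lambda>t. (max 0 t)\<^sup>2) has_real_derivative 2 * t) (at t)"
      by (rule DERIV_cong_ev[THEN iffD1, rotated -1, OF _ refl _ refl])
        (use 1 in \<open>auto intro!: eventually_mono[OF eventually_nhds_in_open[of "{0<..}" t]]\<close>)
    then show ?thesis using 1 by simp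
  next
    case 2
    have "((\<lambda>t. 0) has_real_derivative 0) (at t)" by simp
    then have "((\<lambda>t. (max 0 t)\<^sup>2) has_real_derivative 0) (at t)"
      by (rule DERIV_cong_ev[THEN iffD1, rotated -1, OF _ refl _ refl])
        (use 2 in \<open>auto intro!: eventually_mono[OF eventually_nhds_in_open[of "{..<0}" t]]\<close>)
    then show ?thesis using 2 by simp
  next
    case 3
    have "((\<lambda>h::real. (max 0 h)\<^sup>2 / h) \<longlongrightarrow> 0) (at 0)"
    proof (rule Lim_null_comparison)
      show "\<forall>\<^sub>F h in at 0. norm ((max 0 h)\<^sup>2 / h) \<le> \<bar>h\<bar>"
        by (auto simp: eventually_at_filter max_def power2_eq_square)
      show "((\<lambda>h::real. \<bar>h\<bar>) \<longlongrightarrow> 0) (at 0)" by (auto intro!: tendsto_eq_intros)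
    qed
    then show ?thesis using 3 by (simp add: DERIV_def)
  qed
qed

lemma C1_fun_support:
  assumes F: "C1_fun F dF" and C: "closed C" "\<And>x. x \<notin> C \<Longrightarrow> F x = 0" and x: "x \<notin> C"
  shows "dF x = 0"
proof -
  have der: "(F has_derivative (\<lambda>h. dF x \<bullet> h)) (at x)" using F by (auto simp: C1_fun_def)
  have "eventually (\<lambda>y. y \<in> - C) (nhds x)"
    using x C(1) by (intro eventually_nhds_in_open) auto
  then have ev: "eventually (\<lambda>y. 0 = F y) (at x)" and "0 = F x"
    using C(2) x by (auto simp: eventually_at_filter elim: eventually_mono)
  have "(F has_derivative (\<lambda>h. 0)) (at x)"
    by (rule has_derivative_transform_eventually[OF has_derivative_const ev \<open>0 = F x\<close>]) simp
  from has_derivative_unique[OF der this] have "dF x \<bullet> h = 0" for h by metis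
  then show "dF x = 0" by (metis inner_eq_zero_iff)
qed

text \<open>By translation invariance the integrals of difference quotients vanish, and they converge to that of
  the derivative by dominated convergence.\<close>

lemma integral_derivative_zero:
  fixes F :: "real^'n \<Rightarrow> real"
  assumes F: "C1_fun F dF" and C: "compact C" "\<And>x. x \<notin> C \<Longrightarrow> F x = 0"
  shows "integrable lborel (\<lambda>x. dF x \<bullet> e)" "(LINT x|lborel. dF x \<bullet> e) = 0"
proof -
  have der: "\<And>x. (F has_derivative (\<lambda>h. dF x \<bullet> h)) (at x)" and contd: "continuous_on UNIV dF"
    using F by (auto simp: C1_fun_def)
  have cont: "continuous_on UNIV F" using F by (rule C1_fun_continuous)
  have dF0: "dF x = 0" if "x \<notin> C" for x
    using C1_fun_support[OF F _ C(2) that] C(1) by (simp add: compact_imp_closed)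
  have "bounded (dF ` C)" using C(1) contd by (intro compact_imp_bounded compact_continuous_image)
      (auto intro: continuous_on_subset)
  then obtain B where B0: "\<And>x. x \<in> C \<Longrightarrow> norm (dF x) \<le> B" "B > 0"
    unfolding bounded_pos by auto
  have B: "norm (dF x) \<le> B" for x using B0 dF0[of x] by (cases "x \<in> C") auto
  have lip: "\<bar>F (x + y) - F x\<bar> \<le> B * norm y" for x y
  proof -
    have "norm (F (x + y) - F x) \<le> B * norm (x + y - x)"
    proof (rule differentiable_bound[of UNIV])
      show "onorm (\<lambda>h. dF z \<bullet> h) \<le> B" for z
      proof (rule onorm_le)
        fix h
        have "norm (dF z \<bullet> h) \<le> norm (dF z) * norm h" by (simp add: Cauchy_Schwarz_ineq2)
        also have "\<dots> \<le> B * norm h" using B[of z] by (rule mult_right_mono) simp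
        finally show "norm (dF z \<bullet> h) \<le> B * norm h" .
      qed
    qed (use der in auto)
    then show ?thesis by simp
  qed
  \<comment> \<open>The difference quotients \<open>g n\<close> live on a common ball, since the step sizes are at most \<open>1\<close>.\<close>
  define t where "t n = 1 / real (Suc n)" for n
  have t: "0 < t n" "t n \<le> 1" for n by (auto simp: t_def)
  define g where "g n x = (F (x + t n *\<^sub>R e) - F x) / t n" for n x
  obtain R0 where R0: "\<And>x. x \<in> C \<Longrightarrow> norm x \<le> R0" using compact_imp_bounded[OF C(1)] by (auto simp: bounded_iff)
  define R where "R = R0 + norm e"
  have supp: "g n x = 0" if "norm x > R" for n x
  proof -
    have "norm (t n *\<^sub>R e) \<le> norm e" using t[of n] by (simp add: mult_left_le_one_le)
    then have "norm (x + t n *\<^sub>R e) > R0" using that norm_triangle_ineq4[of "x + t n *\<^sub>R e" "t n *\<^sub>R e"]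
      by (simp add: R_def)
    then have "x + t n *\<^sub>R e \<notin> C" using R0[of "x + t n *\<^sub>R e"] by auto
    moreover have "R0 < norm x" using that norm_ge_zero[of e] unfolding R_def by linarith
    then have "x \<notin> C" using R0[of x] by auto
    ultimately show ?thesis by (simp add: g_def C(2))
  qed
  have dom: "norm (g n x) \<le> indicator (cball 0 R) x * (B * norm e)" for n x
  proof (cases "norm x > R")
    case False
    have "\<bar>F (x + t n *\<^sub>R e) - F x\<bar> \<le> B * norm e * t n" using lip[of x "t n *\<^sub>R e"] t[of n] by (simp add: mult_ac)
    then have "norm (g n x) \<le> B * norm e" using t[of n] by (simp add: g_def divide_le_eq)
    then show ?thesis using False by simp
  qed (simp add: supp B0(2) less_imp_le)
  have lim: "(\<lambda>n. g n x) \<longlonglongrightarrow> dF x \<bullet> e" for x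
  proof -
    have "((\<lambda>s. F (x + s *\<^sub>R e)) has_derivative (\<lambda>s. dF x \<bullet> (s *\<^sub>R e))) (at 0)"
      by (rule has_derivative_compose[of "\<lambda>s. x + s *\<^sub>R e" "\<lambda>s. s *\<^sub>R e" 0 UNIV F])
        (auto intro!: derivative_eq_intros der)
    then have "((\<lambda>s. F (x + s *\<^sub>R e)) has_real_derivative dF x \<bullet> e) (at 0)"
      by (simp add: has_field_derivative_def lambda_one[symmetric] mult_commute_abs)
    then have "((\<lambda>s. (F (x + s *\<^sub>R e) - F x) / s) \<longlongrightarrow> dF x \<bullet> e) (at 0)" by (simp add: DERIV_def)
    moreover have "filterlim t (at 0) sequentially"
      unfolding filterlim_at using t LIMSEQ_inverse_real_of_nat
      by (auto simp: t_def[abs_def] inverse_eq_divide)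
    ultimately show ?thesis unfolding g_def by (rule filterlim_compose)
  qed
  have meas: "F \<in> borel_measurable borel" "dF \<in> borel_measurable borel"
    using cont contd by (auto intro: borel_measurable_continuous_onI)
  have intF: "integrable lborel F"
  proof -
    have "integrable lborel (\<lambda>x. indicator C x *\<^sub>R F x)"
      by (rule borel_integrable_compact[OF C(1)]) (use cont continuous_on_subset in blast)
    moreover have "(\<lambda>x. indicator C x *\<^sub>R F x) = F"
    proof
      show "indicator C x *\<^sub>R F x = F x" for x using C(2)[of x] by (cases "x \<in> C") auto
    qed
    ultimately show ?thesis by simp
  qed
  have zero: "(LINT x|lborel. g n x) = 0" for n
  proof -
    let ?c = "t n *\<^sub>R e"
    have d: "distr lborel borel ((+) ?c) = lborel" by (rule lborel_distr_plus)
    have "(LINT x|lborel. F x) = (LINT x|distr lborel borel ((+) ?c). F x)" using d by simp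
    also have "\<dots> = (LINT x|lborel. F (?c + x))"
      by (rule integral_distr) (use meas in auto)
    finally have eq: "(LINT x|lborel. F (x + ?c)) = (LINT x|lborel. F x)" by (simp add: add.commute)
    have "integrable (distr lborel borel ((+) ?c)) F" using d intF by simp
    then have "integrable lborel (\<lambda>x. F (?c + x))"
      by (subst (asm) integrable_distr_eq) (use meas in auto)
    then have "(LINT x|lborel. F (x + ?c) - F x) = 0" using eq intF by (simp add: add.commute)
    then show ?thesis by (simp add: g_def)
  qed
  have dc: "integrable lborel (\<lambda>x. dF x \<bullet> e) \<and> (\<lambda>n. LINT x|lborel. g n x) \<longlonglongrightarrow> (LINT x|lborel. dF x \<bullet> e)"
  proof (intro conjI)
    have m1: "(\<lambda>x. dF x \<bullet> e) \<in> borel_measurable lborel" "\<And>n. g n \<in> borel_measurable lborel"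
      unfolding g_def using meas by (auto intro!: borel_measurable_continuous_onI continuous_intros contd
          continuous_on_compose2[OF cont])
    have iw: "integrable lborel (\<lambda>x::real^'n. indicator (cball 0 R) x * (B * norm e))"
      using emeasure_lborel_cball_finite[of "0::real^'n" R]
      by (intro integrable_mult_left) (simp add: integrable_indicator_iff)
    have al: "AE x in lborel. (\<lambda>n. g n x) \<longlonglongrightarrow> dF x \<bullet> e" by (rule AE_I2) (rule lim)
    have ab: "AE x in lborel. norm (g n x) \<le> indicator (cball 0 R) x * (B * norm e)" for n
      by (rule AE_I2) (rule dom)
    show "integrable lborel (\<lambda>x. dF x \<bullet> e)"
      by (rule integrable_dominated_convergence[OF m1(1) m1(2) iw al ab])
    show "(\<lambda>n. LINT x|lborel. g n x) \<longlonglongrightarrow> (LINT x|lborel. dF x \<bullet> e)"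
      by (rule integral_dominated_convergence[OF m1(1) m1(2) iw al ab])
  qed
  then show "integrable lborel (\<lambda>x. dF x \<bullet> e)" by simp
  from dc have "(\<lambda>n. 0) \<longlonglongrightarrow> (LINT x|lborel. dF x \<bullet> e)" unfolding zero by simp
  then show "(LINT x|lborel. dF x \<bullet> e) = 0" by (simp add: LIMSEQ_const_iff)
qed

text \<open>A product of squared positive parts is positive exactly on the box; the functions
  \<open>1 - (max 0 (1 - n t))\<^sup>2\<close> of its value \<open>t\<close> tend to the indicator of \<open>t > 0\<close>.\<close>

lemma box_test_functions:
  fixes a b :: "real^'n"
  obtains \<phi> where "\<And>n. \<exists>d\<phi>. C1_fun (\<phi> n) d\<phi>" "\<And>n x. 0 \<le> \<phi> n x \<and> \<phi> n x \<le> 1"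
    "\<And>n x. x \<notin> box a b \<Longrightarrow> \<phi> n x = 0" "\<And>x. (\<lambda>n. \<phi> n x) \<longlonglongrightarrow> indicator (box a b) x"
proof -
  define p where "p t = (max 0 t)\<^sup>2" for t :: real
  define m where "m x = (\<Prod>i\<in>UNIV. p (x $ i - a $ i) * p (b $ i - x $ i))" for x :: "real^'n"
  define \<phi> where "\<phi> n x = 1 - p (1 - real n * m x)" for n x
  have pC: "\<exists>df. C1_fun (\<lambda>x. p (f x)) df" if "C1_fun f df" for f :: "real^'n \<Rightarrow> real" and df
  proof -
    have "continuous_on UNIV (\<lambda>y::real. 2 * max 0 y)" by (intro continuous_intros)
    from C1_fun_compose[OF that derivative_max_square this] show ?thesis unfolding p_def by blast
  qed
  have "\<exists>df. C1_fun m df"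
    unfolding m_def[abs_def]
  proof (rule C1_fun_prod)
    fix i :: 'n
    have 1: "C1_fun (\<lambda>x. x $ i - a $ i) (\<lambda>x. axis i 1)" and 2: "C1_fun (\<lambda>x. b $ i - x $ i) (\<lambda>x. - axis i 1)"
      using C1_fun_affine[of "axis i 1" "- (a $ i)"] C1_fun_affine[of "- axis i 1" "b $ i"]
      by (simp_all add: inner_axis' algebra_simps)
    show "\<exists>df. C1_fun (\<lambda>x. p (x $ i - a $ i) * p (b $ i - x $ i)) df"
      using pC[OF 1] pC[OF 2] C1_fun_mult by blast
  qed simp
  then obtain dm where dm: "C1_fun m dm" ..
  have m0: "m x \<ge> 0" for x by (auto simp: m_def p_def intro!: prod_nonneg)
  have mbox: "m x > 0 \<longleftrightarrow> x \<in> box a b" for x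
  proof -
    have p0: "p t \<noteq> 0 \<longleftrightarrow> t > 0" for t by (auto simp: p_def max_def)
    have "m x > 0 \<longleftrightarrow> m x \<noteq> 0" using m0[of x] by linarith
    also have "\<dots> \<longleftrightarrow> (\<forall>i. p (x $ i - a $ i) \<noteq> 0 \<and> p (b $ i - x $ i) \<noteq> 0)" by (simp add: m_def)
    also have "\<dots> \<longleftrightarrow> x \<in> box a b" by (simp add: p0 mem_box_cart)
    finally show ?thesis .
  qed
  show thesis
  proof (rule that[of \<phi>])
    show "\<exists>d\<phi>. C1_fun (\<phi> n) d\<phi>" for n
    proof -
      have "C1_fun (\<lambda>x. 1 - (max 0 (1 - real n * m x))\<^sup>2)
          (\<lambda>x. (- (2 * max 0 (1 - real n * m x) * (0 - real n))  * 1) *\<^sub>R dm x)"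
      proof (rule C1_fun_compose[OF dm, where g = "\<lambda>y. 1 - (max 0 (1 - real n * y))\<^sup>2"
            and g' = "\<lambda>y. - (2 * max 0 (1 - real n * y) * (0 - real n))  * 1"])
        fix y
        have "((\<lambda>y. (max 0 (1 - real n * y))\<^sup>2) has_real_derivative
            2 * max 0 (1 - real n * y) * (0 - real n)) (at y)"
          by (rule DERIV_chain2[OF derivative_max_square]) (auto intro!: derivative_eq_intros)
        then show "((\<lambda>y. 1 - (max 0 (1 - real n * y))\<^sup>2) has_real_derivative
            - (2 * max 0 (1 - real n * y) * (0 - real n)) * 1) (at y)"
          using DERIV_diff[OF DERIV_const[of 1]] by fastforce
      qed (intro continuous_intros)
      then show ?thesis by (auto simp: \<phi>_def[abs_def] p_def)
    qed
    show "0 \<le> \<phi> n x \<and> \<phi> n x \<le> 1" for n x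
    proof -
      have "max 0 (1 - real n * m x) \<le> 1" "0 \<le> max 0 (1 - real n * m x)" using m0[of x] by simp_all
      then have "(max 0 (1 - real n * m x))\<^sup>2 \<le> 1" by (metis power_le_one)
      then show ?thesis by (simp add: \<phi>_def p_def)
    qed
    show "\<phi> n x = 0" if "x \<notin> box a b" for n x
      using that mbox[of x] m0[of x] by (simp add: \<phi>_def p_def)
    show "(\<lambda>n. \<phi> n x) \<longlonglongrightarrow> indicator (box a b) x" for x
    proof (cases "x \<in> box a b")
      case False
      then have "m x = 0" using mbox[of x] m0[of x] by linarith
      then show ?thesis using False by (simp add: \<phi>_def p_def)
    next
      case True
      then have "m x > 0" using mbox by simp
      then obtain N :: nat where N: "1 / m x < real N" using reals_Archimedean2 by blast
      have "\<phi> n x = 1" if "n \<ge> N" for n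
      proof -
        have "1 / m x \<le> real n" using N that by linarith
        then have "1 \<le> real n * m x" using \<open>m x > 0\<close> by (simp add: divide_le_eq)
        then show ?thesis by (simp add: \<phi>_def p_def)
      qed
      then have "eventually (\<lambda>n. \<phi> n x = 1) sequentially" by (auto simp: eventually_sequentially)
      then show ?thesis using True by (simp add: tendsto_eventually)
    qed
  qed
qed

text \<open>By dominated convergence along the functions of \<open>box_test_functions\<close> all integrals over boxes
  inside the open set vanish, and almost everywhere the function is the limit of its means over small
  cubes.\<close>

lemma fundamental_lemma_variations:
  fixes H :: "real^'n \<Rightarrow> real"
  assumes H: "integrable lebesgue H" and O: "open O1"
    and z: "\<And>\<phi> d\<phi>. test_function O1 \<phi> d\<phi> \<Longrightarrow> (LINT x|lebesgue. H x * \<phi> x) = 0"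
  shows "\<exists>N. negligible N \<and> (\<forall>x\<in>O1 - N. H x = 0)"
proof -
  have box0: "integral (cbox a b) H = 0" if ab: "cbox a b \<subseteq> O1" for a b
  proof -
    obtain \<phi> where \<phi>: "\<And>n. \<exists>d\<phi>. C1_fun (\<phi> n) d\<phi>" "\<And>n x. 0 \<le> \<phi> n x \<and> \<phi> n x \<le> 1"
      "\<And>n x. x \<notin> box a b \<Longrightarrow> \<phi> n x = 0" "\<And>x. (\<lambda>n. \<phi> n x) \<longlonglongrightarrow> indicator (box a b) x"
      using box_test_functions[of a b] by metis
    have "(LINT x|lebesgue. H x * \<phi> n x) = 0" for n
    proof -
      obtain d\<phi> where d: "C1_fun (\<phi> n) d\<phi>" using \<phi>(1) by blast
      have "test_function O1 (\<phi> n) d\<phi>"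
        unfolding test_function_def using d ab \<phi>(3) box_subset_cbox[of a b]
        by (auto simp: C1_fun_def intro!: exI[of _ "cbox a b"])
      then show ?thesis by (rule z)
    qed
    moreover have m: "\<phi> n \<in> borel_measurable lebesgue" for n
    proof -
      have "continuous_on UNIV (\<phi> n)" using \<phi>(1) C1_fun_continuous by blast
      then have "\<phi> n \<in> borel_measurable borel" by (rule borel_measurable_continuous_onI)
      then show ?thesis by (intro measurable_completion) simp
    qed
    have "(\<lambda>n. LINT x|lebesgue. H x * \<phi> n x) \<longlonglongrightarrow> (LINT x|lebesgue. H x * indicator (box a b) x)"
    proof (rule integral_dominated_convergence[where w = "\<lambda>x. norm (H x)"])
      show "AE x in lebesgue. norm (H x * \<phi> n x) \<le> norm (H x)" for n
        using \<phi>(2) by (auto simp: abs_mult mult_right_le_one_le)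
      show "AE x in lebesgue. (\<lambda>n. H x * \<phi> n x) \<longlonglongrightarrow> H x * indicator (box a b) x"
        using \<phi>(4) by (auto intro!: tendsto_mult)
      show "(\<lambda>x. H x * indicat_real (box a b) x) \<in> borel_measurable lebesgue"
        using H by (intro borel_measurable_times borel_measurable_indicator) auto
    qed (use H m in auto)
    ultimately have "(LINT x|lebesgue. H x * indicator (box a b) x) = 0"
      by (simp add: LIMSEQ_const_iff)
    then have "(LINT x:box a b|lebesgue. H x) = 0" by (simp add: set_lebesgue_integral_def mult.commute)
    moreover have "set_integrable lebesgue (box a b) H"
      using H unfolding set_integrable_def by (intro integrable_mult_indicator) auto
    ultimately have "integral (box a b) H = 0" by (simp add: set_lebesgue_integral_eq_integral)
    then show ?thesis by (simp add: integral_open_interval)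
  qed
  have "H integrable_on cbox a b" for a b
  proof -
    have "set_integrable lebesgue (cbox a b) H"
      using H unfolding set_integrable_def by (intro integrable_mult_indicator) auto
    then show ?thesis by (rule set_lebesgue_integral_eq_integral)
  qed
  then obtain N where N: "negligible N"
    "\<And>x e. \<lbrakk>x \<notin> N; 0 < e\<rbrakk> \<Longrightarrow> \<exists>d>0. \<forall>h. 0 < h \<and> h < d \<longrightarrow>
       norm (integral (cbox x (x + h *\<^sub>R One)) H /\<^sub>R h ^ DIM(real^'n) - H x) < e"
    using integrable_ccontinuous_explicit[of H] by metis
  have "H x = 0" if x: "x \<in> O1" "x \<notin> N" for x
  proof (rule ccontr)
    assume "H x \<noteq> 0"
    then obtain d where d: "d > 0" "\<And>h. 0 < h \<Longrightarrow> h < d \<Longrightarrow>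
        norm (integral (cbox x (x + h *\<^sub>R One)) H /\<^sub>R h ^ DIM(real^'n) - H x) < norm (H x)"
      using N(2)[OF x(2), of "norm (H x)"] by auto
    obtain r where r: "r > 0" "cball x r \<subseteq> O1" using O x(1) open_contains_cball by blast
    define M where "M = norm (One :: real^'n) + 1"
    have M: "M > 0" by (simp add: M_def add_nonneg_pos)
    obtain h where h: "0 < h" "h < d" "h < r / M"
      using field_lbound_gt_zero[of d "r / M"] d(1) r(1) M by auto
    have "cbox x (x + h *\<^sub>R One) \<subseteq> cball x r"
    proof
      fix y assume y: "y \<in> cbox x (x + h *\<^sub>R One)"
      have "norm (y - x) \<le> norm (h *\<^sub>R (One :: real^'n))"
      proof (rule norm_le_componentwise_cart)
        fix i
        have "x $ i \<le> y $ i \<and> y $ i \<le> x $ i + h * One $ i" using y by (simp add: mem_box_cart)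
        then show "norm ((y - x) $ i) \<le> norm ((h *\<^sub>R One :: real^'n) $ i)" by simp
      qed
      also have "\<dots> \<le> h * M" using h(1) by (simp add: M_def)
      also have "\<dots> \<le> r" using h(3) M by (simp add: field_simps)
      finally show "y \<in> cball x r" by (simp add: dist_norm norm_minus_commute)
    qed
    then have "integral (cbox x (x + h *\<^sub>R One)) H = 0" using r(2) box0 by blast
    then show False using d(2)[OF h(1,2)] by simp
  qed
  with N(1) show ?thesis by blast
qed

text \<open>The product of an affine function and a test function is continuously differentiable with compact
  support, so the integral of its partial derivatives vanishes.  This is integration by parts, and
  the fundamental lemma identifies the weak gradient.\<close>

lemma weak_gradient_affine:
  fixes \<Omega> :: "(real^'n) set"
  assumes \<Omega>: "\<Omega> \<in> lmeasurable" and O: "open O1" "O1 \<subseteq> \<Omega>"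
    and G: "weak_gradient \<Omega> v G" and v: "\<And>x. x \<in> O1 \<Longrightarrow> v x = A *v x + c"
  shows "\<exists>N. negligible N \<and> (\<forall>x\<in>O1 - N. G x = A)"
proof -
  have \<Omega>s: "\<Omega> \<in> sets lebesgue" using \<Omega> by auto
  have comp: "\<exists>N. negligible N \<and> (\<forall>x\<in>O1 - N. G x $ i $ j = A $ i $ j)" for i j
  proof -
    have L2: "G \<in> borel_measurable (lebesgue_on \<Omega>)" "integrable (lebesgue_on \<Omega>) (\<lambda>x. (norm (G x))\<^sup>2)"
      using G by (auto simp: weak_gradient_def L2_def)
    have mG: "(\<lambda>x. G x $ i $ j) \<in> borel_measurable (lebesgue_on \<Omega>)"
    proof -
      have "(\<lambda>M::real^'n^'n. M $ i $ j) \<in> borel_measurable borel"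
        by (intro borel_measurable_continuous_onI continuous_intros)
      from measurable_compose[OF L2(1) this] show ?thesis .
    qed
    have one: "integrable (lebesgue_on \<Omega>) (\<lambda>x. 1 :: real)"
    proof -
      have "emeasure lebesgue \<Omega> < \<infinity>" using \<Omega> unfolding fmeasurable_def by blast
      from integrable_real_indicator[OF \<Omega>s this] show ?thesis using \<Omega>s by (simp add: integrable_restrict_space)
    qed
    have intG: "integrable (lebesgue_on \<Omega>) (\<lambda>x. G x $ i $ j)"
    proof (rule Bochner_Integration.integrable_bound[OF Bochner_Integration.integrable_add[OF one L2(2)] mG])
      show "AE x in lebesgue_on \<Omega>. norm (G x $ i $ j) \<le> norm (1 + (norm (G x))\<^sup>2)"
      proof (rule AE_I2)
        fix x
        have "\<bar>G x $ i $ j\<bar> \<le> norm (G x)" using component_le_norm_cart[of "G x $ i" j]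
            Finite_Cartesian_Product.norm_nth_le[of "G x" i] by simp
        also have "norm (G x) \<le> 1 + (norm (G x))\<^sup>2"
          using sum_squares_bound[of "norm (G x)" 1] norm_ge_zero[of "G x"]
          by (simp only: power_one mult_1_right mult.right_neutral)
        finally show "norm (G x $ i $ j) \<le> norm (1 + (norm (G x))\<^sup>2)" by simp
      qed
    qed
    define H where "H x = indicator \<Omega> x * (G x $ i $ j - A $ i $ j)" for x
    have intH: "integrable lebesgue H"
    proof -
      have "integrable (lebesgue_on \<Omega>) (\<lambda>x. G x $ i $ j - A $ i $ j)"
        using intG integrable_mult_right[OF one, of "A $ i $ j"] by (intro Bochner_Integration.integrable_diff) auto
      then show ?thesis using \<Omega>s by (simp add: H_def[abs_def] integrable_restrict_space)
    qed
    have "(LINT x|lebesgue. H x * \<phi> x) = 0" if t: "test_function O1 \<phi> d\<phi>" for \<phi> d\<phi>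
    proof -
      obtain C where C: "compact C" "C \<subseteq> O1" "\<And>x. x \<notin> C \<Longrightarrow> \<phi> x = 0"
        using t by (auto simp: test_function_def)
      have C1: "C1_fun \<phi> d\<phi>" using t by (auto simp: test_function_def C1_fun_def)
      have t': "test_function \<Omega> \<phi> d\<phi>" using t O by (auto simp: test_function_def)
      have d0: "d\<phi> x = 0" if "x \<notin> C" for x
        using C1_fun_support[OF C1 _ C(3) that] C(1) by (simp add: compact_imp_closed)
      have cont: "continuous_on UNIV \<phi>" using C1 C1_fun_continuous by blast
      let ?V = "\<lambda>x. A $ i \<bullet> x + c $ i"
      have int\<phi>: "integrable lborel \<phi>"
      proof -
        have "integrable lborel (\<lambda>x. indicator C x *\<^sub>R \<phi> x)"
          by (rule borel_integrable_compact[OF C(1)]) (use cont continuous_on_subset in blast)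
        moreover have "(\<lambda>x. indicator C x *\<^sub>R \<phi> x) = \<phi>"
        proof
          show "indicator C x *\<^sub>R \<phi> x = \<phi> x" for x using C(3)[of x] by (cases "x \<in> C") auto
        qed
        ultimately show ?thesis by simp
      qed
      note F = C1_fun_mult[OF C1_fun_affine[of "A $ i" "c $ i"] C1]
      have F0: "?V x * \<phi> x = 0" if "x \<notin> C" for x using C(3)[OF that] by simp
      have der: "(?V x *\<^sub>R d\<phi> x + \<phi> x *\<^sub>R A $ i) \<bullet> axis j 1 = ?V x * d\<phi> x $ j + A $ i $ j * \<phi> x" for x
        by (simp add: inner_add_left inner_axis)
      have iF: "integrable lborel (\<lambda>x. ?V x * d\<phi> x $ j + A $ i $ j * \<phi> x)"
        "(LINT x|lborel. ?V x * d\<phi> x $ j + A $ i $ j * \<phi> x) = 0"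
        using integral_derivative_zero[OF F C(1) F0, of "axis j 1"] unfolding der by auto
      have iV: "integrable lborel (\<lambda>x. ?V x * d\<phi> x $ j)"
        using Bochner_Integration.integrable_diff[OF iF(1) integrable_mult_right[OF int\<phi>, of "A $ i $ j"]] by simp
      have "(LINT x|lborel. ?V x * d\<phi> x $ j) + A $ i $ j * (LINT x|lborel. \<phi> x) = 0"
        using iF(2) iV int\<phi> by (simp add: Bochner_Integration.integral_add)
      moreover have "(LINT x|lborel. ?V x * d\<phi> x $ j) = (LINT x|lebesgue. ?V x * d\<phi> x $ j)"
        "(LINT x|lborel. \<phi> x) = (LINT x|lebesgue. \<phi> x)"
        using iV int\<phi> by (simp_all add: integral_completion)
      moreover have "(LINT x|lebesgue. ?V x * d\<phi> x $ j) = (LINT x|lebesgue_on \<Omega>. v x $ i * d\<phi> x $ j)"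
      proof -
        \<comment> \<open>Outside the support both sides vanish, so only values of \<open>v\<close> in the open set matter.\<close>
        have eq: "?V x * d\<phi> x $ j = indicator \<Omega> x *\<^sub>R (v x $ i * d\<phi> x $ j)" for x
        proof (cases "x \<in> C")
          case True
          then have "x \<in> O1" "x \<in> \<Omega>" using C O by auto
          then show ?thesis using v by (simp add: matrix_vector_mul_component)
        qed (simp add: d0)
        show ?thesis unfolding eq using \<Omega>s by (simp add: integral_restrict_space)
      qed
      moreover have "(LINT x|lebesgue_on \<Omega>. v x $ i * d\<phi> x $ j) = - (LINT x|lebesgue_on \<Omega>. G x $ i $ j * \<phi> x)"
        using G t' unfolding weak_gradient_def by blast
      ultimately have eq: "(LINT x|lebesgue_on \<Omega>. G x $ i $ j * \<phi> x) = A $ i $ j * (LINT x|lebesgue. \<phi> x)"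
        by simp
      have m\<phi>: "\<phi> \<in> borel_measurable lebesgue"
        using int\<phi> by (intro measurable_completion) auto
      have "bounded (\<phi> ` C)" using C(1) cont by (intro compact_imp_bounded compact_continuous_image)
          (auto intro: continuous_on_subset)
      then obtain B where B: "\<And>x. x \<in> C \<Longrightarrow> norm (\<phi> x) \<le> B" "B > 0" unfolding bounded_pos by auto
      have B': "\<bar>\<phi> x\<bar> \<le> B" for x using B C(3)[of x] by (cases "x \<in> C") auto
      have iG\<phi>: "integrable (lebesgue_on \<Omega>) (\<lambda>x. G x $ i $ j * \<phi> x)"
      proof (rule Bochner_Integration.integrable_bound[OF integrable_mult_left[OF intG, of B]])
        show "(\<lambda>x. G x $ i $ j * \<phi> x) \<in> borel_measurable (lebesgue_on \<Omega>)"
          using mG m\<phi> by (intro borel_measurable_times) (auto simp: measurable_restrict_space1)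
        show "AE x in lebesgue_on \<Omega>. norm (G x $ i $ j * \<phi> x) \<le> norm (G x $ i $ j * B)"
          using B' B(2) by (auto simp: abs_mult intro!: mult_left_mono)
      qed
      then have i1: "integrable lebesgue (\<lambda>x. indicator \<Omega> x *\<^sub>R (G x $ i $ j * \<phi> x))"
        using \<Omega>s by (simp add: integrable_restrict_space)
      have i2: "integrable lebesgue \<phi>" using int\<phi> by (simp add: integrable_completion)
      have H\<phi>: "H x * \<phi> x = indicator \<Omega> x *\<^sub>R (G x $ i $ j * \<phi> x) - A $ i $ j * \<phi> x" for x
        using C(3)[of x] C(2) O(2) by (cases "x \<in> \<Omega>") (auto simp: H_def algebra_simps)
      have "(LINT x|lebesgue. H x * \<phi> x) =
          (LINT x|lebesgue. indicator \<Omega> x *\<^sub>R (G x $ i $ j * \<phi> x)) - A $ i $ j * (LINT x|lebesgue. \<phi> x)"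
        unfolding H\<phi> using i1 i2 by (simp add: Bochner_Integration.integral_diff)
      also have "(LINT x|lebesgue. indicator \<Omega> x *\<^sub>R (G x $ i $ j * \<phi> x)) = (LINT x|lebesgue_on \<Omega>. G x $ i $ j * \<phi> x)"
        using \<Omega>s by (simp add: integral_restrict_space)
      finally show ?thesis using eq by simp
    qed
    then obtain N where N: "negligible N" "\<forall>x\<in>O1 - N. H x = 0"
      using fundamental_lemma_variations[OF intH O(1)] by blast
    have "G x $ i $ j = A $ i $ j" if "x \<in> O1 - N" for x
    proof -
      have "x \<in> \<Omega>" "H x = 0" using that N(2) O(2) by auto
      then show ?thesis by (simp add: H_def)
    qed
    then show ?thesis using N(1) by blast
  qed
  then obtain N where N: "\<And>i j. negligible (N i j)" "\<And>i j x. x \<in> O1 - N i j \<Longrightarrow> G x $ i $ j = A $ i $ j"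
    by metis
  have "negligible (\<Union>i. \<Union>j. N i j)" using N(1) by (intro negligible_Union) auto
  moreover have "G x = A" if "x \<in> O1 - (\<Union>i. \<Union>j. N i j)" for x
    using that N(2) by (simp add: vec_eq_iff)
  ultimately show ?thesis by blast
qed

section \<open>Integrals of elementwise constant functions\<close>

lemma AE_lebesgue_on_iff:
  assumes "S \<in> sets lebesgue"
  shows "(AE x in lebesgue_on S. P x) \<longleftrightarrow> (\<exists>N. negligible N \<and> (\<forall>x\<in>S - N. P x))"
proof -
  have "(AE x in lebesgue_on S. P x) \<longleftrightarrow> (AE x in lebesgue. x \<in> S \<longrightarrow> P x)"
    using assms by (simp add: AE_restrict_space_iff)
  also have "\<dots> \<longleftrightarrow> (\<exists>N. negligible N \<and> (\<forall>x\<in>S - N. P x))"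
    unfolding eventually_ae_filter negligible_iff_null_sets by auto
  finally show ?thesis .
qed

lemma AE_lebesgue_onI:
  assumes "S \<in> sets lebesgue" "negligible N" "\<And>x. x \<in> S - N \<Longrightarrow> P x"
  shows "AE x in lebesgue_on S. P x"
  using assms by (auto simp: AE_lebesgue_on_iff)

text \<open>Completeness of Lebesgue measure.  Elementwise constant functions are given only up to null sets,
  and Bochner integrals of nonmeasurable functions are zero by convention.\<close>

lemma borel_measurable_AE_lebesgue_on:
  assumes S: "S \<in> sets lebesgue" and f: "f \<in> borel_measurable (lebesgue_on S)"
    and eq: "AE x in lebesgue_on S. f x = g x"
  shows "g \<in> borel_measurable (lebesgue_on S)"
proof (rule measurableI)
  fix B :: "'b set" assume B: "B \<in> sets borel"
  have "f -` B \<inter> space (lebesgue_on S) \<in> sets (lebesgue_on S)" using f B by (rule measurable_sets)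
  then have "f -` B \<inter> S \<in> sets lebesgue" using S by (simp add: sets_restrict_space_iff)
  moreover have ae: "AE x in lebesgue. (x \<in> f -` B \<inter> S) = (x \<in> g -` B \<inter> S)"
    using eq S by (auto simp: AE_restrict_space_iff elim: eventually_mono)
  ultimately have "g -` B \<inter> S \<in> sets lebesgue"
    by (intro completion.in_sets_AE[OF ae]) simp_all
  then show "g -` B \<inter> space (lebesgue_on S) \<in> sets (lebesgue_on S)"
    using S by (simp add: sets_restrict_space_iff)
qed auto

lemma elem_sets [simp]: "elem K \<in> sets lebesgue"
  using lmeasurable_elem[of K] by (rule fmeasurableD)

lemma AE_elem_unique:
  assumes K: "nondegenerate K" and 1: "AE x in lebesgue_on (elem K). F x = c"
    and 2: "AE x in lebesgue_on (elem K). F x = c'"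
  shows "c = c'"
proof -
  obtain N N' where N: "negligible N" "\<forall>x\<in>elem K - N. F x = c" "negligible N'" "\<forall>x\<in>elem K - N'. F x = c'"
    using 1 2 by (auto simp: AE_lebesgue_on_iff)
  have "\<not> negligible (elem K)" using vol_pos[OF K] negligible_imp_measure0 by (force simp: vol_def)
  then have "\<not> elem K \<subseteq> N \<union> N'" using N negligible_subset negligible_Un by blast
  then show ?thesis using N by auto
qed

lemma elem_value_eq:
  assumes K: "nondegenerate K" and "AE x in lebesgue_on (elem K). F x = c"
  shows "elem_value K F = c"
  unfolding elem_value_def using assms AE_elem_unique[OF K] by (intro the_equality) auto

lemma AE_elem_value:
  assumes K: "nondegenerate K" "K \<in> \<T>" and "elementwise_const \<T> F"
  shows "AE x in lebesgue_on (elem K). F x = elem_value K F"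
  using assms elem_value_eq[OF K(1)] unfolding elementwise_const_def by metis

lemma AE_elem_subset:
  assumes "elem K' \<subseteq> elem K" "AE x in lebesgue_on (elem K). P x"
  shows "AE x in lebesgue_on (elem K'). P x"
  using assms by (auto simp: AE_lebesgue_on_iff)

lemma elem_interior_subset:
  assumes "lipschitz_domain \<Omega>" "is_mesh \<Omega> \<T>" "K \<in> \<T>"
  shows "interior (elem K) \<subseteq> \<Omega>"
proof -
  have "elem K \<subseteq> closure \<Omega>" using assms by (auto simp: is_mesh_def)
  then show ?thesis using interior_mono lipschitz_interior_closure[OF assms(1)] by metis
qed

lemma negligible_frontier_elem: "negligible (frontier (elem K))"
  by (simp add: negligible_convex_frontier)

lemma domain_lmeasurable:
  assumes "lipschitz_domain \<Omega>" shows "\<Omega> \<in> lmeasurable" "\<Omega> \<in> sets lebesgue" "open \<Omega>"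
  using assms lmeasurable_open by (auto simp: lipschitz_domain_def)

text \<open>An element may stick out of the open domain only with its boundary.\<close>

lemma AE_domain_elem:
  assumes lip: "lipschitz_domain \<Omega>" and m: "is_mesh \<Omega> \<T>" and K: "K \<in> \<T>"
    and "AE x in lebesgue_on \<Omega>. P x"
  shows "AE x in lebesgue_on (elem K). P x"
proof -
  obtain N where N: "negligible N" "\<forall>x\<in>\<Omega> - N. P x"
    using assms domain_lmeasurable[OF lip] by (auto simp: AE_lebesgue_on_iff)
  have "P x" if "x \<in> elem K - (N \<union> frontier (elem K))" for x
    using that N(2) elem_interior_subset[OF lip m K] by (auto simp: frontier_def)
  moreover have "negligible (N \<union> frontier (elem K))" using N negligible_frontier_elem by simp
  ultimately show ?thesis by (intro AE_lebesgue_onI[of "elem K" "N \<union> frontier (elem K)"]) auto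
qed

lemma AE_mesh_domain:
  assumes lip: "lipschitz_domain \<Omega>" and m: "is_mesh \<Omega> \<T>"
    and P: "\<And>K. K \<in> \<T> \<Longrightarrow> AE x in lebesgue_on (elem K). P x"
  shows "AE x in lebesgue_on \<Omega>. P x"
proof -
  obtain N where N: "\<And>K. K \<in> \<T> \<Longrightarrow> negligible (N K)" "\<And>K x. K \<in> \<T> \<Longrightarrow> x \<in> elem K - N K \<Longrightarrow> P x"
    using P unfolding AE_lebesgue_on_iff[OF elem_sets] by metis
  have "\<Omega> \<subseteq> (\<Union>K\<in>\<T>. elem K)" "finite \<T>"
    using m closure_subset[of \<Omega>] unfolding is_mesh_def by auto
  then have "negligible (\<Union>K\<in>\<T>. N K)" "\<And>x. x \<in> \<Omega> - (\<Union>K\<in>\<T>. N K) \<Longrightarrow> P x"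
    using N by (auto intro!: negligible_Union)
  then show ?thesis by (rule AE_lebesgue_onI[OF domain_lmeasurable(2)[OF lip]])
qed

lemma mesh_finite: "is_mesh \<Omega> \<T> \<Longrightarrow> finite \<T>"
  unfolding is_mesh_def by (elim conjE)

lemma AE_elem_only:
  assumes m: "is_mesh \<Omega> \<T>" and K: "K \<in> \<T>"
  shows "AE x in lebesgue_on (elem K). \<forall>K'\<in>\<T>. x \<in> elem K' \<longrightarrow> K' = K"
proof -
  let ?N = "\<Union>K'\<in>\<T> - {K}. elem K \<inter> elem K'"
  have "finite \<T>" by (rule mesh_finite[OF m])
  have "negligible ?N"
  proof (rule negligible_Union)
    show "finite ((\<lambda>K'. elem K \<inter> elem K') ` (\<T> - {K}))" using \<open>finite \<T>\<close> by simp
    fix t assume "t \<in> (\<lambda>K'. elem K \<inter> elem K') ` (\<T> - {K})"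
    then obtain K' where "K' \<in> \<T>" "K \<noteq> K'" "t = elem K \<inter> elem K'" by auto
    then show "negligible t" using mesh_overlap_negligible[OF m K] by simp
  qed
  then show ?thesis by (rule AE_lebesgue_onI[OF elem_sets]) auto
qed

lemma sum_indicator_elem:
  assumes fin: "finite \<T>" and K: "K \<in> \<T>" "x \<in> elem K" "\<forall>K'\<in>\<T>. x \<in> elem K' \<longrightarrow> K' = K"
  shows "(\<Sum>K'\<in>\<T>. indicator (elem K') x *\<^sub>R c K') = (c K :: 'b :: real_vector)"
proof -
  have "(\<Sum>K'\<in>\<T>. indicator (elem K') x *\<^sub>R c K') = (\<Sum>K'\<in>{K}. indicator (elem K') x *\<^sub>R c K')"
  proof (rule sum.mono_neutral_right)
    show "\<forall>K'\<in>\<T> - {K}. indicator (elem K') x *\<^sub>R c K' = 0"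
    proof
      fix K' assume "K' \<in> \<T> - {K}"
      then have "x \<notin> elem K'" using K(3) by blast
      then show "indicator (elem K') x *\<^sub>R c K' = 0" by simp
    qed
  qed (use fin K(1) in simp_all)
  then show ?thesis using K(2) by simp
qed

lemma elementwise_const_sum:
  fixes F :: "real^'n \<Rightarrow> 'b :: real_vector"
  assumes lip: "lipschitz_domain \<Omega>" and m: "is_mesh \<Omega> \<T>" and F: "elementwise_const \<T> F"
  shows "AE x in lebesgue_on \<Omega>. F x = (\<Sum>K\<in>\<T>. indicator (elem K) x *\<^sub>R elem_value K F)"
proof (rule AE_mesh_domain[OF lip m])
  fix K assume K: "K \<in> \<T>"
  have fin: "finite \<T>" by (rule mesh_finite[OF m])
  have "AE x in lebesgue_on (elem K). x \<in> elem K" by (rule AE_I2) simp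
  with AE_elem_value[OF is_mesh_nondegenerate[OF m K] K F] AE_elem_only[OF m K]
  show "AE x in lebesgue_on (elem K). F x = (\<Sum>K\<in>\<T>. indicator (elem K) x *\<^sub>R elem_value K F)"
  proof eventually_elim
    case (elim x)
    then show ?case by (simp add: sum_indicator_elem[OF fin K])
  qed
qed

lemma emeasure_elem_domain:
  assumes lip: "lipschitz_domain \<Omega>" and m: "is_mesh \<Omega> \<T>" and K: "K \<in> \<T>"
  shows "emeasure lebesgue (\<Omega> \<inter> elem K) = ennreal (vol K)"
proof -
  have "negligible (elem K - \<Omega>)"
    using negligible_subset[OF negligible_frontier_elem[of K]] elem_interior_subset[OF lip m K]
    by (auto simp: frontier_def)
  then have "measure lebesgue (\<Omega> \<inter> elem K) = measure lebesgue (elem K)"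
    by (intro measure_negligible_symdiff) (auto elim: negligible_subset)
  moreover have "\<Omega> \<inter> elem K \<in> lmeasurable" using domain_lmeasurable[OF lip] by (intro fmeasurable.Int) auto
  ultimately show ?thesis by (simp add: vol_def emeasure_eq_measure2)
qed

text \<open>The function agrees almost everywhere with a finite sum of indicators of elements.\<close>

lemma mesh_integral:
  fixes h :: "real^'n \<Rightarrow> real"
  assumes lip: "lipschitz_domain \<Omega>" and m: "is_mesh \<Omega> \<T>" and h: "elementwise_const \<T> h"
  shows "integrable (lebesgue_on \<Omega>) h" "(LINT x|lebesgue_on \<Omega>. h x) = (\<Sum>K\<in>\<T>. vol K * elem_value K h)"
proof -
  note \<Omega> = domain_lmeasurable[OF lip]
  have hb: "has_bochner_integral (lebesgue_on \<Omega>) (\<lambda>x. \<Sum>K\<in>\<T>. indicator (elem K) x *\<^sub>R elem_value K h)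
      (\<Sum>K\<in>\<T>. vol K * elem_value K h)"
  proof (rule has_bochner_integral_sum)
    fix K assume K: "K \<in> \<T>"
    have "has_bochner_integral lebesgue (indicator (\<Omega> \<inter> elem K)) (measure lebesgue (\<Omega> \<inter> elem K))"
      using \<Omega> emeasure_elem_domain[OF lip m K]
      by (intro has_bochner_integral_real_indicator) auto
    then have "has_bochner_integral lebesgue (\<lambda>x. indicator \<Omega> x *\<^sub>R indicator (elem K) x :: real) (vol K)"
      using emeasure_elem_domain[OF lip m K] by (simp add: measure_def indicator_inter_arith flip: indicator_inter_arith)
    then have "has_bochner_integral (lebesgue_on \<Omega>) (indicator (elem K)) (vol K)"
      using \<Omega>(2) by (simp add: has_bochner_integral_restrict_space)
    then show "has_bochner_integral (lebesgue_on \<Omega>) (\<lambda>x. indicator (elem K) x *\<^sub>R elem_value K h) (vol K * elem_value K h)"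
      by (auto intro: has_bochner_integral_mult_left)
  qed
  have ae: "AE x in lebesgue_on \<Omega>. (\<Sum>K\<in>\<T>. indicator (elem K) x *\<^sub>R elem_value K h) = h x"
    using elementwise_const_sum[OF lip m h] by (auto elim: eventually_mono)
  have "h \<in> borel_measurable (lebesgue_on \<Omega>)"
    by (rule borel_measurable_AE_lebesgue_on[OF \<Omega>(2) _ ae]) (use hb in \<open>auto simp: has_bochner_integral.simps\<close>)
  then have "has_bochner_integral (lebesgue_on \<Omega>) h (\<Sum>K\<in>\<T>. vol K * elem_value K h)"
    using hb ae by (subst has_bochner_integral_cong_AE[symmetric, OF _ _ ae]) (auto simp: has_bochner_integral.simps)
  then show "integrable (lebesgue_on \<Omega>) h" "(LINT x|lebesgue_on \<Omega>. h x) = (\<Sum>K\<in>\<T>. vol K * elem_value K h)"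
    by (auto simp: has_bochner_integral_iff)
qed

lemma mesh_nn_integral:
  fixes h :: "real^'n \<Rightarrow> ennreal"
  assumes lip: "lipschitz_domain \<Omega>" and m: "is_mesh \<Omega> \<T>" and h: "elementwise_const \<T> h"
  shows "(\<integral>\<^sup>+x. h x \<partial>lebesgue_on \<Omega>) = (\<Sum>K\<in>\<T>. ennreal (vol K) * elem_value K h)"
proof -
  have fin: "finite \<T>" by (rule mesh_finite[OF m])
  note \<Omega> = domain_lmeasurable[OF lip]
  have ae: "AE x in lebesgue_on \<Omega>. h x = (\<Sum>K\<in>\<T>. elem_value K h * indicator (elem K) x)"
  proof (rule AE_mesh_domain[OF lip m])
    fix K assume K: "K \<in> \<T>"
    have "AE x in lebesgue_on (elem K). x \<in> elem K" by (rule AE_I2) simp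
    with AE_elem_value[OF is_mesh_nondegenerate[OF m K] K h] AE_elem_only[OF m K]
    show "AE x in lebesgue_on (elem K). h x = (\<Sum>K\<in>\<T>. elem_value K h * indicator (elem K) x)"
    proof eventually_elim
      case (elim x)
      have "(\<Sum>K'\<in>\<T>. elem_value K' h * indicator (elem K') x) = (\<Sum>K'\<in>{K}. elem_value K' h * indicator (elem K') x)"
      proof (rule sum.mono_neutral_right)
        show "\<forall>K'\<in>\<T> - {K}. elem_value K' h * indicator (elem K') x = 0"
        proof
          fix K' assume "K' \<in> \<T> - {K}"
          then have "x \<notin> elem K'" using elim by blast
          then show "elem_value K' h * indicator (elem K') x = 0" by simp
        qed
      qed (use fin K in simp_all)
      then show ?case using elim by simp
    qed
  qed
  have "(\<integral>\<^sup>+x. h x \<partial>lebesgue_on \<Omega>) = (\<integral>\<^sup>+x. (\<Sum>K\<in>\<T>. elem_value K h * indicator (elem K) x) \<partial>lebesgue_on \<Omega>)"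
    by (rule nn_integral_cong_AE[OF ae])
  also have "\<dots> = (\<Sum>K\<in>\<T>. \<integral>\<^sup>+x. elem_value K h * indicator (elem K) x \<partial>lebesgue_on \<Omega>)"
    by (rule nn_integral_sum) (auto intro!: borel_measurable_times_ennreal measurable_restrict_space1 borel_measurable_indicator)
  also have "\<dots> = (\<Sum>K\<in>\<T>. ennreal (vol K) * elem_value K h)"
  proof (rule sum.cong[OF refl])
    fix K assume K: "K \<in> \<T>"
    have "(\<integral>\<^sup>+x. elem_value K h * indicator (elem K) x \<partial>lebesgue_on \<Omega>) =
        (\<integral>\<^sup>+x. elem_value K h * indicator (\<Omega> \<inter> elem K) x \<partial>lebesgue)"
      using \<Omega>(2) by (subst nn_integral_restrict_space) (auto intro!: nn_integral_cong simp: indicator_def)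
    also have "\<dots> = elem_value K h * emeasure lebesgue (\<Omega> \<inter> elem K)"
      using \<Omega>(2) by (intro nn_integral_cmult_indicator) auto
    finally show "(\<integral>\<^sup>+x. elem_value K h * indicator (elem K) x \<partial>lebesgue_on \<Omega>) = ennreal (vol K) * elem_value K h"
      unfolding emeasure_elem_domain[OF lip m K] by (simp add: mult.commute)
  qed
  finally show ?thesis .
qed

lemma elementwise_const_measurable:
  fixes F :: "real^'n \<Rightarrow> 'b :: euclidean_space"
  assumes lip: "lipschitz_domain \<Omega>" and m: "is_mesh \<Omega> \<T>" and F: "elementwise_const \<T> F"
  shows "F \<in> borel_measurable (lebesgue_on \<Omega>)"
proof (rule borel_measurable_AE_lebesgue_on)
  show "(\<lambda>x. \<Sum>K\<in>\<T>. indicator (elem K) x *\<^sub>R elem_value K F) \<in> borel_measurable (lebesgue_on \<Omega>)"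
    by (intro borel_measurable_sum borel_measurable_scaleR measurable_restrict_space1 borel_measurable_indicator) auto
  show "AE x in lebesgue_on \<Omega>. (\<Sum>K\<in>\<T>. indicator (elem K) x *\<^sub>R elem_value K F) = F x"
    using elementwise_const_sum[OF lip m F] by (auto elim: eventually_mono)
qed (rule domain_lmeasurable[OF lip])

lemma elementwise_const_comp:
  assumes "elementwise_const \<T> F" shows "elementwise_const \<T> (\<lambda>x. h (F x))"
  using assms unfolding elementwise_const_def by (metis (mono_tags, lifting) eventually_mono)

lemma elementwise_const_comp2:
  assumes F: "elementwise_const \<T> F" and G: "elementwise_const \<T> G"
  shows "elementwise_const \<T> (\<lambda>x. h (F x) (G x))"
  unfolding elementwise_const_def
proof
  fix K assume "K \<in> \<T>"
  then obtain c d where "AE x in lebesgue_on (elem K). F x = c" "AE x in lebesgue_on (elem K). G x = d"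
    using F G unfolding elementwise_const_def by blast
  then have "AE x in lebesgue_on (elem K). h (F x) (G x) = h c d" by eventually_elim simp
  then show "\<exists>c. AE x in lebesgue_on (elem K). h (F x) (G x) = c" by blast
qed

lemma elem_value_comp:
  assumes K: "nondegenerate K" "K \<in> \<T>" and F: "elementwise_const \<T> F"
  shows "elem_value K (\<lambda>x. h (F x)) = h (elem_value K F)"
  using AE_elem_value[OF K F] by (intro elem_value_eq[OF K(1)]) (auto elim: eventually_mono)

text \<open>Pointwise operations, such as applying the hardening tensor to the plastic strain, act on the
  constants.\<close>

lemma elem_value_comp2:
  assumes K: "nondegenerate K" "K \<in> \<T>" and F: "elementwise_const \<T> F" and G: "elementwise_const \<T> G"
  shows "elem_value K (\<lambda>x. h (F x) (G x)) = h (elem_value K F) (elem_value K G)"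
proof (rule elem_value_eq[OF K(1)])
  show "AE x in lebesgue_on (elem K). h (F x) (G x) = h (elem_value K F) (elem_value K G)"
    using AE_elem_value[OF K F] AE_elem_value[OF K G] by eventually_elim simp
qed

lemma mesh_L2_inner:
  fixes F G :: "real^'n \<Rightarrow> 'b :: euclidean_space"
  assumes lip: "lipschitz_domain \<Omega>" and m: "is_mesh \<Omega> \<T>"
    and F: "elementwise_const \<T> F" and G: "elementwise_const \<T> G"
  shows "L2_inner (lebesgue_on \<Omega>) F G = (\<Sum>K\<in>\<T>. vol K * (elem_value K F \<bullet> elem_value K G))"
  unfolding L2_inner_def mesh_integral(2)[OF lip m elementwise_const_comp2[OF F G, of inner]]
  by (rule sum.cong[OF refl]) (simp add: elem_value_comp2[OF is_mesh_nondegenerate[OF m] _ F G])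

lemma mesh_L2_nrm:
  fixes F :: "real^'n \<Rightarrow> 'b :: euclidean_space"
  assumes lip: "lipschitz_domain \<Omega>" and m: "is_mesh \<Omega> \<T>" and F: "elementwise_const \<T> F"
  shows "(L2_nrm (lebesgue_on \<Omega>) F)\<^sup>2 = (\<Sum>K\<in>\<T>. vol K * (norm (elem_value K F))\<^sup>2)"
proof -
  have "L2_nrm (lebesgue_on \<Omega>) F = sqrt (L2_inner (lebesgue_on \<Omega>) F F)"
    by (simp add: L2_nrm_def L2_inner_def power2_norm_eq_inner)
  then show ?thesis unfolding mesh_L2_inner[OF lip m F F]
    by (simp add: sum_nonneg power2_norm_eq_inner)
qed

lemma elementwise_const_L2:
  fixes F :: "real^'n \<Rightarrow> 'b :: euclidean_space"
  assumes lip: "lipschitz_domain \<Omega>" and m: "is_mesh \<Omega> \<T>" and F: "elementwise_const \<T> F"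
  shows "L2 (lebesgue_on \<Omega>) F"
  using elementwise_const_measurable[OF assms] mesh_integral(1)[OF lip m elementwise_const_comp[OF F]]
  by (simp add: L2_def)

text \<open>The gradient is some weak gradient, and all of them agree on the interior of the element.\<close>

lemma grad_affine:
  assumes lip: "lipschitz_domain \<Omega>" and m: "is_mesh \<Omega> \<T>" and K: "K \<in> \<T>"
    and v: "H1 \<Omega> v" and aff: "\<And>x. x \<in> elem K \<Longrightarrow> v x = A *v x + c"
  shows "AE x in lebesgue_on (elem K). grad \<Omega> v x = A"
proof -
  have "weak_gradient \<Omega> v (grad \<Omega> v)" using v unfolding grad_def H1_def by (metis someI_ex)
  moreover have "v x = A *v x + c" if "x \<in> interior (elem K)" for x
    using aff that interior_subset by blast
  ultimately obtain N where N: "negligible N" "\<forall>x\<in>interior (elem K) - N. grad \<Omega> v x = A"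
    using weak_gradient_affine[OF domain_lmeasurable(1)[OF lip] open_interior elem_interior_subset[OF lip m K]]
    by metis
  have "negligible (N \<union> frontier (elem K))" using N negligible_frontier_elem by simp
  then show ?thesis
    by (rule AE_lebesgue_onI[OF elem_sets]) (use N(2) in \<open>auto simp: frontier_def\<close>)
qed

section \<open>Linearity of weak gradients and traces\<close>

lemma le_one_plus_square: "t \<le> 1 + t\<^sup>2" for t :: real
proof -
  have "0 \<le> (t - 1/2)\<^sup>2" by simp
  also have "\<dots> = t\<^sup>2 - t + 1/4" by (simp add: power2_eq_square algebra_simps)
  finally show ?thesis by linarith
qed

lemma integrable_inner_L2:
  assumes F: "L2 M F" and G: "L2 M G"
  shows "integrable M (\<lambda>x. F x \<bullet> G x)"
proof (rule Bochner_Integration.integrable_bound)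
  show "integrable M (\<lambda>x. (norm (F x))\<^sup>2 + (norm (G x))\<^sup>2)" using F G by (auto simp: L2_def)
  show "(\<lambda>x. F x \<bullet> G x) \<in> borel_measurable M" using F G by (auto simp: L2_def)
  show "AE x in M. norm (F x \<bullet> G x) \<le> norm ((norm (F x))\<^sup>2 + (norm (G x))\<^sup>2)"
  proof (rule AE_I2)
    fix x
    have "\<bar>F x \<bullet> G x\<bar> \<le> norm (F x) * norm (G x)" by (rule Cauchy_Schwarz_ineq2)
    also have "\<dots> \<le> (norm (F x))\<^sup>2 + (norm (G x))\<^sup>2"
      using sum_squares_bound[of "norm (F x)" "norm (G x)"] norm_ge_zero[of "F x"] norm_ge_zero[of "G x"]
        mult_nonneg_nonneg[of "norm (F x)" "norm (G x)"] by linarith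
    finally show "norm (F x \<bullet> G x) \<le> norm ((norm (F x))\<^sup>2 + (norm (G x))\<^sup>2)" by simp
  qed
qed

lemma L2_add:
  assumes F: "L2 M F" and G: "L2 M G"
  shows "L2 M (\<lambda>x. F x + G x)"
proof -
  have "integrable M (\<lambda>x. (norm (F x))\<^sup>2 + 2 * (F x \<bullet> G x) + (norm (G x))\<^sup>2)"
    using F G integrable_inner_L2[OF F G] by (auto simp: L2_def)
  moreover have "(norm (F x + G x))\<^sup>2 = (norm (F x))\<^sup>2 + 2 * (F x \<bullet> G x) + (norm (G x))\<^sup>2" for x
    by (simp add: power2_norm_eq_inner inner_add_left inner_add_right inner_commute)
  ultimately show ?thesis using F G by (auto simp: L2_def)
qed

lemma L2_scaleR: "L2 M F \<Longrightarrow> L2 M (\<lambda>x. a *\<^sub>R F x)"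
  by (auto simp: L2_def power_mult_distrib)

lemma L2_component_integrable:
  fixes F :: "'a \<Rightarrow> real^'n"
  assumes F: "L2 M F" and one: "integrable M (\<lambda>x. 1 :: real)"
    and \<phi>: "\<phi> \<in> borel_measurable M" "\<And>x. \<bar>\<phi> x\<bar> \<le> B"
  shows "integrable M (\<lambda>x. F x $ i * \<phi> x)"
proof (rule Bochner_Integration.integrable_bound)
  show "integrable M (\<lambda>x. B * (1 + (norm (F x))\<^sup>2))" using F one by (auto simp: L2_def)
  have "(\<lambda>v::real^'n. v $ i) \<in> borel_measurable borel"
    by (intro borel_measurable_continuous_onI continuous_intros)
  from measurable_compose[OF _ this] have "(\<lambda>x. F x $ i) \<in> borel_measurable M" using F by (auto simp: L2_def)
  then show "(\<lambda>x. F x $ i * \<phi> x) \<in> borel_measurable M" using \<phi>(1) by simp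
  show "AE x in M. norm (F x $ i * \<phi> x) \<le> norm (B * (1 + (norm (F x))\<^sup>2))"
  proof (rule AE_I2)
    fix x
    have B: "0 \<le> B" using \<phi>(2)[of x] by linarith
    have "\<bar>F x $ i\<bar> * \<bar>\<phi> x\<bar> \<le> (1 + (norm (F x))\<^sup>2) * B"
      using \<phi>(2)[of x] component_le_norm_cart[of "F x" i] le_one_plus_square[of "norm (F x)"]
      by (intro mult_mono) auto
    then show "norm (F x $ i * \<phi> x) \<le> norm (B * (1 + (norm (F x))\<^sup>2))"
      using B by (simp add: abs_mult mult.commute)
  qed
qed

lemma domain_integrable_one:
  assumes "S \<in> lmeasurable" shows "integrable (lebesgue_on S) (\<lambda>x. c :: real)"
proof -
  have "S \<in> sets lebesgue" "emeasure lebesgue S < \<infinity>" using assms unfolding fmeasurable_def by blast+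
  from integrable_real_indicator[OF this] have "integrable (lebesgue_on S) (\<lambda>x. 1 :: real)"
    using assms by (simp add: integrable_restrict_space fmeasurableD)
  from integrable_mult_left[OF this, of c] show ?thesis by simp
qed

lemma C1_fun_bounded:
  assumes "C1_fun \<phi> d\<phi>" "compact C" "\<And>x. x \<notin> C \<Longrightarrow> \<phi> x = 0"
  obtains B where "\<And>x. \<bar>\<phi> x\<bar> \<le> B" "\<And>x. norm (d\<phi> x) \<le> B"
proof -
  have "bounded (\<phi> ` C)" "bounded (d\<phi> ` C)"
    using assms C1_fun_continuous[OF assms(1)] unfolding C1_fun_def
    by (intro compact_imp_bounded compact_continuous_image; blast intro: continuous_on_subset)+
  then obtain B1 B2 where B: "\<And>x. x \<in> C \<Longrightarrow> norm (\<phi> x) \<le> B1" "\<And>x. x \<in> C \<Longrightarrow> norm (d\<phi> x) \<le> B2"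
    by (auto simp: bounded_iff)
  have "\<bar>\<phi> x\<bar> \<le> max 0 (max B1 B2)" for x using B(1)[of x] assms(3)[of x] by (cases "x \<in> C") auto
  moreover have "norm (d\<phi> x) \<le> max 0 (max B1 B2)" for x
    using B(2)[of x] C1_fun_support[OF assms(1) compact_imp_closed[OF assms(2)] assms(3)]
    by (cases "x \<in> C") auto
  ultimately show thesis using that by blast
qed

text \<open>Linearity has to be checked on the integrals that define the weak gradient; the products with a
  test function are integrable because the function is square integrable and the domain bounded.\<close>

lemma weak_gradient_linear:
  assumes lip: "lipschitz_domain \<Omega>" and v: "L2 (lebesgue_on \<Omega>) v" "weak_gradient \<Omega> v G"
    and w: "L2 (lebesgue_on \<Omega>) w" "weak_gradient \<Omega> w G'"
  shows "weak_gradient \<Omega> (\<lambda>x. v x + a *\<^sub>R w x) (\<lambda>x. G x + a *\<^sub>R G' x)"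
  unfolding weak_gradient_def
proof (intro conjI allI impI)
  have L: "L2 (lebesgue_on \<Omega>) G" "L2 (lebesgue_on \<Omega>) G'" using v w by (auto simp: weak_gradient_def)
  then show "L2 (lebesgue_on \<Omega>) (\<lambda>x. G x + a *\<^sub>R G' x)" by (intro L2_add L2_scaleR)
  fix \<phi> d\<phi> i j assume t: "test_function \<Omega> \<phi> d\<phi>"
  note one = domain_integrable_one[OF domain_lmeasurable(1)[OF lip]]
  have C1: "C1_fun \<phi> d\<phi>" using t by (auto simp: test_function_def C1_fun_def)
  obtain C where C: "compact C" "\<And>x. x \<notin> C \<Longrightarrow> \<phi> x = 0" using t by (auto simp: test_function_def)
  obtain B where B: "\<And>x. \<bar>\<phi> x\<bar> \<le> B" "\<And>x. norm (d\<phi> x) \<le> B" using C1_fun_bounded[OF C1 C] by blast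
  have B': "\<bar>d\<phi> x $ j\<bar> \<le> B" for x using component_le_norm_cart[of "d\<phi> x" j] B(2)[of x] by linarith
  have meas: "\<phi> \<in> borel_measurable (lebesgue_on \<Omega>)" "(\<lambda>x. d\<phi> x $ j) \<in> borel_measurable (lebesgue_on \<Omega>)"
    using C1 C1_fun_continuous[OF C1]
    by (auto simp: C1_fun_def intro!: measurable_restrict_space1 measurable_completion
        borel_measurable_continuous_onI continuous_on_component)
  have comp: "L2 (lebesgue_on \<Omega>) (\<lambda>x. F x $ i)" if "L2 (lebesgue_on \<Omega>) F" for F :: "real^'a \<Rightarrow> real^'a^'a"
  proof -
    have "(\<lambda>M::real^'a^'a. M $ i) \<in> borel_measurable borel"
      by (intro borel_measurable_continuous_onI continuous_intros)
    from measurable_compose[OF _ this] have m: "(\<lambda>x. F x $ i) \<in> borel_measurable (lebesgue_on \<Omega>)"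
      using that by (auto simp: L2_def)
    have "integrable (lebesgue_on \<Omega>) (\<lambda>x. (norm (F x $ i))\<^sup>2)"
      by (rule Bochner_Integration.integrable_bound[of _ "\<lambda>x. (norm (F x))\<^sup>2"])
        (use that m in \<open>auto simp: L2_def intro!: AE_I2 power_mono Finite_Cartesian_Product.norm_nth_le\<close>)
    with m show ?thesis by (simp add: L2_def)
  qed
  have i1: "integrable (lebesgue_on \<Omega>) (\<lambda>x. v x $ i * d\<phi> x $ j)" "integrable (lebesgue_on \<Omega>) (\<lambda>x. w x $ i * d\<phi> x $ j)"
    using L2_component_integrable[OF _ one meas(2) B'] v(1) w(1) by auto
  have i2: "integrable (lebesgue_on \<Omega>) (\<lambda>x. G x $ i $ j * \<phi> x)" "integrable (lebesgue_on \<Omega>) (\<lambda>x. G' x $ i $ j * \<phi> x)"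
    using L2_component_integrable[OF comp[OF L(1)] one meas(1) B(1)] L2_component_integrable[OF comp[OF L(2)] one meas(1) B(1)]
    by auto
  have e1: "(LINT x|lebesgue_on \<Omega>. v x $ i * d\<phi> x $ j) = - (LINT x|lebesgue_on \<Omega>. G x $ i $ j * \<phi> x)"
    and e2: "(LINT x|lebesgue_on \<Omega>. w x $ i * d\<phi> x $ j) = - (LINT x|lebesgue_on \<Omega>. G' x $ i $ j * \<phi> x)"
    using v(2) w(2) t unfolding weak_gradient_def by blast+
  have "(LINT x|lebesgue_on \<Omega>. (v x + a *\<^sub>R w x) $ i * d\<phi> x $ j) =
      (LINT x|lebesgue_on \<Omega>. v x $ i * d\<phi> x $ j + a * (w x $ i * d\<phi> x $ j))"
    by (simp add: algebra_simps)
  also have "\<dots> = (LINT x|lebesgue_on \<Omega>. v x $ i * d\<phi> x $ j) + a * (LINT x|lebesgue_on \<Omega>. w x $ i * d\<phi> x $ j)"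
    using i1 by simp
  also have "\<dots> = - ((LINT x|lebesgue_on \<Omega>. G x $ i $ j * \<phi> x) + a * (LINT x|lebesgue_on \<Omega>. G' x $ i $ j * \<phi> x))"
    unfolding e1 e2 by simp
  also have "\<dots> = - (LINT x|lebesgue_on \<Omega>. G x $ i $ j * \<phi> x + a * (G' x $ i $ j * \<phi> x))" using i2 by simp
  also have "\<dots> = - (LINT x|lebesgue_on \<Omega>. (G x + a *\<^sub>R G' x) $ i $ j * \<phi> x)" by (simp add: algebra_simps)
  finally show "(LINT x|lebesgue_on \<Omega>. (v x + a *\<^sub>R w x) $ i * d\<phi> x $ j) =
      - (LINT x|lebesgue_on \<Omega>. (G x + a *\<^sub>R G' x) $ i $ j * \<phi> x)" .
qed

lemma L2_integrable_on_subset: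
  fixes F :: "real^'n \<Rightarrow> 'b::euclidean_space"
  assumes \<Omega>: "\<Omega> \<in> lmeasurable" and A: "A \<in> sets lebesgue" "A \<subseteq> \<Omega>" and F: "L2 (lebesgue_on \<Omega>) F"
  shows "integrable (lebesgue_on A) F"
proof -
  have \<Omega>s: "\<Omega> \<in> sets lebesgue" using \<Omega> by (rule fmeasurableD)
  have "integrable (lebesgue_on \<Omega>) F"
  proof (rule Bochner_Integration.integrable_bound)
    show "integrable (lebesgue_on \<Omega>) (\<lambda>x. 1 + (norm (F x))\<^sup>2)"
      using F domain_integrable_one[OF \<Omega>] by (auto simp: L2_def)
    show "F \<in> borel_measurable (lebesgue_on \<Omega>)" using F by (simp add: L2_def)
    have "norm (F x) \<le> norm (1 + (norm (F x))\<^sup>2)" for x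
      using le_one_plus_square[of "norm (F x)"] by simp
    then show "AE x in lebesgue_on \<Omega>. norm (F x) \<le> norm (1 + (norm (F x))\<^sup>2)" by simp
  qed
  then have "set_integrable lebesgue \<Omega> F" using \<Omega>s by (simp add: integrable_restrict_space set_integrable_def)
  then have "set_integrable lebesgue A F" using A by (rule set_integrable_subset)
  then show ?thesis using A by (simp add: integrable_restrict_space set_integrable_def)
qed

text \<open>Traces are limits of means, and means over small balls are linear on square integrable
  functions.\<close>

lemma V_space_linear:
  assumes lip: "lipschitz_domain (Dom P)" and v: "v \<in> V_space P" and w: "w \<in> V_space P"
  shows "(\<lambda>x. v x + a *\<^sub>R w x) \<in> V_space P"
proof -
  let ?\<Omega> = "Dom P"
  have L: "L2 (lebesgue_on ?\<Omega>) v" "L2 (lebesgue_on ?\<Omega>) w" using v w by (auto simp: V_space_def H1_def)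
  obtain G G' where "weak_gradient ?\<Omega> v G" "weak_gradient ?\<Omega> w G'" using v w by (auto simp: V_space_def H1_def)
  from weak_gradient_linear[OF lip L(1) this(1) L(2) this(2)]
  have H: "H1 ?\<Omega> (\<lambda>x. v x + a *\<^sub>R w x)" using L2_add[OF L(1) L2_scaleR[OF L(2)]] by (auto simp: H1_def)
  note \<Omega> = domain_lmeasurable[OF lip]
  have mean: "ball_mean ?\<Omega> (\<lambda>x. v x + a *\<^sub>R w x) x r = ball_mean ?\<Omega> v x r + a *\<^sub>R ball_mean ?\<Omega> w x r" for x r
  proof -
    have s: "ball x r \<inter> ?\<Omega> \<in> sets lebesgue" "ball x r \<inter> ?\<Omega> \<subseteq> ?\<Omega>" using \<Omega>(2) by auto
    from L2_integrable_on_subset[OF \<Omega>(1) s L(1)] L2_integrable_on_subset[OF \<Omega>(1) s L(2)]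
    show ?thesis by (simp add: ball_mean_def scaleR_add_right)
  qed
  have "AE x in restrict_space surface_measure (GamD P). has_bd_trace ?\<Omega> v x 0"
    "AE x in restrict_space surface_measure (GamD P). has_bd_trace ?\<Omega> w x 0"
    using v w by (auto simp: V_space_def)
  then have "AE x in restrict_space surface_measure (GamD P). has_bd_trace ?\<Omega> (\<lambda>x. v x + a *\<^sub>R w x) x 0"
  proof eventually_elim
    case (elim x)
    from tendsto_add[OF elim(1)[unfolded has_bd_trace_def] tendsto_scaleR[OF tendsto_const[of a] elim(2)[unfolded has_bd_trace_def]]]
    show ?case unfolding has_bd_trace_def mean[abs_def] by simp
  qed
  with H show ?thesis by (simp add: V_space_def)
qed

section \<open>Discrete displacements\<close>

definition V_disc :: "('n::finite) plasticity \<Rightarrow> 'n mesh \<Rightarrow> (real^'n \<Rightarrow> real^'n) set" where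
  "V_disc P \<T> = {v \<in> V_space P. \<forall>K\<in>\<T>. \<exists>A c. \<forall>x\<in>elem K. v x = A *v x + c}"

lemma X_disc_iff:
  "(v, q, \<beta>) \<in> X_disc P \<T> \<longleftrightarrow> v \<in> V_disc P \<T> \<and>
     q \<in> Q_space P \<and> elementwise_const \<T> q \<and> \<beta> \<in> M_space P \<and> elementwise_const \<T> \<beta>"
  by (auto simp: X_disc_def X_space_def V_disc_def)

lemma V_disc_linear:
  assumes lip: "lipschitz_domain (Dom P)" and v: "v \<in> V_disc P \<T>" and w: "w \<in> V_disc P \<T>"
  shows "(\<lambda>x. v x + a *\<^sub>R w x) \<in> V_disc P \<T>"
proof -
  have "\<exists>A c. \<forall>x\<in>elem K. v x + a *\<^sub>R w x = A *v x + c" if K: "K \<in> \<T>" for K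
  proof -
    obtain A c B d where A: "\<forall>x\<in>elem K. v x = A *v x + c" and B: "\<forall>x\<in>elem K. w x = B *v x + d"
      using v w K unfolding V_disc_def by blast
    have "v x + a *\<^sub>R w x = (A + a *\<^sub>R B) *v x + (c + a *\<^sub>R d)" if "x \<in> elem K" for x
      using A B that
      by (simp add: matrix_vector_mult_add_rdistrib scaleR_matrix_vector_assoc scaleR_add_right)
    then show ?thesis by blast
  qed
  then show ?thesis using V_space_linear[OF lip] v w by (auto simp: V_disc_def)
qed

lemma V_disc_diff:
  assumes "lipschitz_domain (Dom P)" "v \<in> V_disc P \<T>" "w \<in> V_disc P \<T>"
  shows "(\<lambda>x. v x - w x) \<in> V_disc P \<T>" "(\<lambda>x. v x + w x) \<in> V_disc P \<T>" "(\<lambda>x. 0) \<in> V_disc P \<T>"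
  using V_disc_linear[OF assms, of "-1"] V_disc_linear[OF assms, of "1"]
    V_disc_linear[OF assms(1,2,2), of "-1"] by simp_all

lemma V_disc_continuous:
  assumes m: "is_mesh (Dom P) \<T>" and w: "w \<in> V_disc P \<T>"
  shows "continuous_on (closure (Dom P)) w"
proof -
  have "continuous_on (elem K) w" if K: "K \<in> \<T>" for K
  proof -
    obtain A c where "\<forall>x\<in>elem K. w x = A *v x + c" using w K unfolding V_disc_def by blast
    moreover have "continuous_on (elem K) (\<lambda>x. A *v x + c)"
      by (intro continuous_intros matrix_vector_mult_linear_continuous_on)
    ultimately show ?thesis by (simp cong: continuous_on_cong)
  qed
  then have "continuous_on (\<Union>K\<in>\<T>. elem K) w"
    by (intro continuous_on_closed_Union) (auto intro: mesh_finite[OF m])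
  moreover have "(\<Union>K\<in>\<T>. elem K) = closure (Dom P)" using m unfolding is_mesh_def by (elim conjE)
  ultimately show ?thesis by simp
qed

text \<open>By continuity the means over small balls converge to the value at the centre.\<close>

lemma bd_trace_continuous:
  assumes lip: "lipschitz_domain \<Omega>" and w: "continuous_on (closure \<Omega>) w" and x: "x \<in> frontier \<Omega>"
  shows "bd_trace \<Omega> w x = w x"
proof -
  note \<Omega> = domain_lmeasurable[OF lip]
  have xc: "x \<in> closure \<Omega>" using x by (simp add: frontier_def)
  have "compact (closure \<Omega>)" using lip by (simp add: lipschitz_domain_def)
  have "has_bd_trace \<Omega> w x (w x)"
    unfolding has_bd_trace_def
  proof (rule tendstoI)
    fix e :: real assume e: "e > 0"
    obtain d where d: "d > 0" "\<And>y. y \<in> closure \<Omega> \<Longrightarrow> dist y x < d \<Longrightarrow> dist (w y) (w x) < e / 2"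
      using w xc e unfolding continuous_on_iff by (metis half_gt_zero)
    have "dist (ball_mean \<Omega> w x r) (w x) < e" if r: "0 < r" "r < d" for r
    proof -
      let ?A = "ball x r \<inter> \<Omega>"
      have Ao: "open ?A" using \<Omega>(3) by (intro open_Int) auto
      have Am: "?A \<in> lmeasurable" "?A \<in> sets lebesgue" using \<Omega> by (auto intro!: fmeasurable.Int)
      have "?A \<noteq> {}"
      proof -
        obtain y where "y \<in> \<Omega>" "dist y x < r" using xc r(1) closure_approachable by blast
        then have "y \<in> ?A" by (simp add: dist_commute)
        then show ?thesis by blast
      qed
      then have "\<not> negligible ?A" using Ao open_not_negligible by blast
      then have mA: "measure lebesgue ?A > 0" using Am(1) negligible_iff_measure zero_less_measure_iff by blast
      have int1: "integrable (lebesgue_on ?A) w"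
      proof -
        have "continuous_on ?A w" using w closure_subset continuous_on_subset by (metis inf.coboundedI2)
        then have meas: "w \<in> borel_measurable (lebesgue_on ?A)"
          using Am(2) by (rule continuous_imp_measurable_on_sets_lebesgue)
        obtain B where B: "\<And>y. y \<in> closure \<Omega> \<Longrightarrow> norm (w y) \<le> B"
          using compact_imp_bounded[OF compact_continuous_image[OF w \<open>compact (closure \<Omega>)\<close>]]
          by (auto simp: bounded_iff)
        show ?thesis
        proof (rule Bochner_Integration.integrable_bound[OF domain_integrable_one[OF Am(1), of B] meas])
          show "AE y in lebesgue_on ?A. norm (w y) \<le> norm B"
          proof (rule AE_I2)
            fix y assume "y \<in> space (lebesgue_on ?A)"
            then have "y \<in> closure \<Omega>" using closure_subset[of \<Omega>] by auto
            then show "norm (w y) \<le> norm B" using B[of y] by simp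
          qed
        qed
      qed
      have int2: "integrable (lebesgue_on ?A) (\<lambda>y. w x)"
        using Am by (intro finite_measure.integrable_const finite_measure_lebesgue_on)
      have vol1: "(LINT y|lebesgue_on ?A. w x) = measure lebesgue ?A *\<^sub>R w x"
        using Am(2) by (simp add: measure_restrict_space)
      have "(LINT y|lebesgue_on ?A. w y - w x) = (LINT y|lebesgue_on ?A. w y) - measure lebesgue ?A *\<^sub>R w x"
        using int1 int2 vol1 by simp
      then have eq: "ball_mean \<Omega> w x r - w x = (1 / measure lebesgue ?A) *\<^sub>R (LINT y|lebesgue_on ?A. w y - w x)"
        using mA by (simp add: ball_mean_def scaleR_diff_right)
      have "norm (LINT y|lebesgue_on ?A. w y - w x) \<le> (LINT y|lebesgue_on ?A. norm (w y - w x))"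
        by (rule Bochner_Integration.integral_norm_bound)
      also have "\<dots> \<le> (LINT y|lebesgue_on ?A. e / 2)"
      proof (rule Bochner_Integration.integral_mono)
        show "integrable (lebesgue_on ?A) (\<lambda>y. e / 2)" by (rule domain_integrable_one[OF Am(1)])
        show "integrable (lebesgue_on ?A) (\<lambda>y. norm (w y - w x))" using int1 int2 by simp
        fix y assume "y \<in> space (lebesgue_on ?A)"
        then have "y \<in> closure \<Omega>" "dist y x < d"
          using r(2) closure_subset[of \<Omega>] by (auto simp: dist_commute)
        then show "norm (w y - w x) \<le> e / 2" using d(2) by (simp add: dist_norm less_imp_le)
      qed
      also have "\<dots> = measure lebesgue ?A * (e / 2)" using Am(2) by (simp add: measure_restrict_space)
      finally have "norm (ball_mean \<Omega> w x r - w x) \<le> e / 2"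
        using mA unfolding eq by (simp add: field_simps)
      then show ?thesis using e by (simp add: dist_norm)
    qed
    then show "\<forall>\<^sub>F r in at_right 0. dist (ball_mean \<Omega> w x r) (w x) < e"
      unfolding eventually_at_right_field using d(1) by auto
  qed
  then show ?thesis unfolding bd_trace_def has_bd_trace_def
    by (intro the_equality) (auto intro: tendsto_unique[OF trivial_limit_at_right_real])
qed

lemma GamN_props:
  assumes "plasticity_setting P"
  shows "GamN P \<in> sets borel" "GamN P \<subseteq> frontier (Dom P)" "GamN P \<inter> GamD P = {}"
    "lipschitz_domain (Dom P)"
proof -
  have "closed (GamD P)" using assms by (simp add: plasticity_setting_def)
  then show "GamN P \<in> sets borel" by (simp add: GamN_def)
qed (use assms in \<open>auto simp: GamN_def plasticity_setting_def\<close>)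

text \<open>The boundary is covered by finitely many facets.\<close>

lemma frontier_surface_finite:
  fixes P :: "('n::finite) plasticity"
  assumes lip: "lipschitz_domain \<Omega>" and m: "is_mesh \<Omega> \<T>" and n: "CARD('n) \<ge> 2"
  shows "emeasure surface_measure (frontier (\<Omega> :: (real^'n) set)) < \<infinity>"
proof -
  let ?A = "\<Union>K\<in>\<T>. \<Union>E\<in>facets K. E"
  have nd: "nondegenerate K" if "K \<in> \<T>" for K using is_mesh_nondegenerate[OF m that] .
  have fin: "finite \<T>" by (rule mesh_finite[OF m])
  have sets: "(\<Union>E\<in>facets K. E) \<in> sets surface_measure" if "K \<in> \<T>" for K
    using facet_surface_sets[OF nd[OF that]] by (intro sets.finite_UN) auto
  have fK: "emeasure surface_measure (\<Union>E\<in>facets K. E) < \<infinity>" if K: "K \<in> \<T>" for K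
  proof -
    have "emeasure surface_measure (\<Union>E\<in>facets K. E) \<le> (\<Sum>E\<in>facets K. emeasure surface_measure E)"
      using facet_surface_sets[OF nd[OF K]] by (intro emeasure_subadditive_finite) auto
    also have "\<dots> < \<infinity>" using facet_surface_finite[OF nd[OF K] _ n] by (simp add: ennreal_sum_less_top)
    finally show ?thesis .
  qed
  have "(\<Union>K\<in>\<T>. frontier (elem K)) = ?A" using frontier_elem[OF nd] by simp
  then have "frontier \<Omega> \<subseteq> ?A" using frontier_subset_facets[OF lip m] by simp
  then have "emeasure surface_measure (frontier \<Omega>) \<le> emeasure surface_measure ?A"
    using sets fin by (intro emeasure_mono) auto
  also have "\<dots> \<le> (\<Sum>K\<in>\<T>. emeasure surface_measure (\<Union>E\<in>facets K. E))"
    using sets fin by (intro emeasure_subadditive_finite) auto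
  also have "\<dots> < \<infinity>" using fK by (simp add: ennreal_sum_less_top fin)
  finally show ?thesis .
qed

lemma V_disc_L2_boundary:
  fixes P :: "('n::finite) plasticity"
  assumes P: "plasticity_setting P" and m: "is_mesh (Dom P) \<T>" and n: "CARD('n) \<ge> 2"
    and w: "w \<in> V_disc P \<T>"
  shows "L2 (restrict_space surface_measure (GamN P)) w"
proof -
  note G = GamN_props[OF P]
  have cont: "continuous_on (closure (Dom P)) w" by (rule V_disc_continuous[OF m w])
  have sub: "GamN P \<subseteq> closure (Dom P)" using G(2) by (auto simp: frontier_def)
  have "w \<in> borel_measurable (restrict_space borel (GamN P))"
    using continuous_on_subset[OF cont sub] by (rule borel_measurable_continuous_on_restrict)
  then have meas: "w \<in> borel_measurable (restrict_space surface_measure (GamN P))"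
    by (subst measurable_cong_sets[OF sets_restrict_space_cong[of _ borel] refl]) auto
  have "compact (closure (Dom P))" using G(4) by (simp add: lipschitz_domain_def)
  then obtain B where B: "\<And>y. y \<in> closure (Dom P) \<Longrightarrow> norm (w y) \<le> B"
    using compact_imp_bounded[OF compact_continuous_image[OF cont]] by (auto simp: bounded_iff)
  have "emeasure surface_measure (GamN P) \<le> emeasure surface_measure (frontier (Dom P))"
    using G(2) by (intro emeasure_mono) auto
  also have "\<dots> < \<infinity>" by (rule frontier_surface_finite[OF G(4) m n])
  finally have "finite_measure (restrict_space surface_measure (GamN P))"
    using G(1) by (intro finite_measureI) (simp add: emeasure_restrict_space)
  then have "integrable (restrict_space surface_measure (GamN P)) (\<lambda>x. B\<^sup>2)"
    by (rule finite_measure.integrable_const)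
  then have "integrable (restrict_space surface_measure (GamN P)) (\<lambda>x. (norm (w x))\<^sup>2)"
  proof (rule Bochner_Integration.integrable_bound)
    show "AE x in restrict_space surface_measure (GamN P). norm ((norm (w x))\<^sup>2) \<le> norm (B\<^sup>2)"
      using B sub by (intro AE_I2) (auto simp: space_restrict_space intro!: power_mono)
  qed (use meas in auto)
  with meas show ?thesis by (simp add: L2_def)
qed

text \<open>Discrete displacements are continuous, so their traces are their values, which are bounded; then
  both products in the load functional are integrable and split.\<close>

lemma b_form_linear:
  fixes P :: "('n::finite) plasticity"
  assumes P: "plasticity_setting P" and m: "is_mesh (Dom P) \<T>" and n: "CARD('n) \<ge> 2"
    and fg: "loads P f g" and v: "v \<in> V_disc P \<T>" and w: "w \<in> V_disc P \<T>"
  shows "b_form P f g (\<lambda>x. v x + a *\<^sub>R w x, q, \<beta>) = b_form P f g (v, q', \<beta>') + a * b_form P f g (w, q'', \<beta>'')"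
proof -
  note G = GamN_props[OF P]
  let ?M = "lebesgue_on (Dom P)" and ?S = "restrict_space surface_measure (GamN P)"
  have L: "L2 ?M f" "L2 ?S g" using fg by (auto simp: loads_def)
  have Lv: "L2 ?M u" if "u \<in> V_disc P \<T>" for u using that by (auto simp: V_disc_def V_space_def H1_def)
  have tr: "L2_inner ?S g (bd_trace (Dom P) u) = L2_inner ?S g u" if u: "u \<in> V_disc P \<T>" for u
    unfolding L2_inner_def
  proof (rule Bochner_Integration.integral_cong[OF refl])
    fix x assume "x \<in> space ?S"
    then have "x \<in> frontier (Dom P)" using G(2) by (auto simp: space_restrict_space)
    then show "g x \<bullet> bd_trace (Dom P) u x = g x \<bullet> u x"
      using bd_trace_continuous[OF G(4) V_disc_continuous[OF m u]] by simp
  qed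
  have lin: "L2_inner N h (\<lambda>x. v x + a *\<^sub>R w x) = L2_inner N h v + a * L2_inner N h w"
    if "L2 N h" "L2 N v" "L2 N w" for N and h :: "real^'n \<Rightarrow> real^'n"
    using integrable_inner_L2[OF that(1,2)] integrable_inner_L2[OF that(1,3)]
    by (simp add: L2_inner_def inner_add_right)
  show ?thesis
    using lin[OF L(1) Lv[OF v] Lv[OF w]]
      lin[OF L(2) V_disc_L2_boundary[OF P m n v] V_disc_L2_boundary[OF P m n w]]
      tr[OF v] tr[OF w] tr[OF V_disc_linear[OF G(4) v w]]
    by (simp add: b_form_def algebra_simps)
qed

lemma sym_grad_affine:
  assumes lip: "lipschitz_domain (Dom P)" and m: "is_mesh (Dom P) \<T>" and K: "K \<in> \<T>"
    and w: "w \<in> V_disc P \<T>" and aff: "\<forall>x\<in>elem K. w x = A *v x + c"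
  shows "AE x in lebesgue_on (elem K). sym_grad (Dom P) w x = (1/2) *\<^sub>R (A + transpose A)"
proof -
  have "H1 (Dom P) w" using w by (auto simp: V_disc_def V_space_def)
  from grad_affine[OF lip m K this] aff
  have "AE x in lebesgue_on (elem K). grad (Dom P) w x = A" by blast
  then show ?thesis by (auto simp: sym_grad_def elim: eventually_mono)
qed

lemma strain_const:
  assumes lip: "lipschitz_domain (Dom P)" and m: "is_mesh (Dom P) \<T>" and w: "w \<in> V_disc P \<T>"
  shows "elementwise_const \<T> (sym_grad (Dom P) w)"
  unfolding elementwise_const_def
proof
  fix K assume K: "K \<in> \<T>"
  then obtain A c where "\<forall>x\<in>elem K. w x = A *v x + c" using w unfolding V_disc_def by blast
  from sym_grad_affine[OF lip m K w this]
  show "\<exists>c. AE x in lebesgue_on (elem K). sym_grad (Dom P) w x = c" by blast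
qed

text \<open>The strain of an elementwise affine function is the symmetric part of its matrix.\<close>

lemma strain_props:
  assumes lip: "lipschitz_domain (Dom P)" and m: "is_mesh (Dom P) \<T>" and K: "K \<in> \<T>"
    and v: "v \<in> V_disc P \<T>" and w: "w \<in> V_disc P \<T>"
  shows "elem_value K (sym_grad (Dom P) (\<lambda>x. v x + a *\<^sub>R w x)) =
      elem_value K (sym_grad (Dom P) v) + a *\<^sub>R elem_value K (sym_grad (Dom P) w)"
    and "elem_value K (sym_grad (Dom P) v) \<in> sym_mats"
proof -
  have nd: "nondegenerate K" by (rule is_mesh_nondegenerate[OF m K])
  obtain A c B d where A: "\<forall>x\<in>elem K. v x = A *v x + c" and B: "\<forall>x\<in>elem K. w x = B *v x + d"
    using v w K unfolding V_disc_def by blast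
  have "\<forall>x\<in>elem K. v x + a *\<^sub>R w x = (A + a *\<^sub>R B) *v x + (c + a *\<^sub>R d)"
    using A B by (simp add: matrix_vector_mult_add_rdistrib scaleR_matrix_vector_assoc scaleR_add_right)
  from sym_grad_affine[OF lip m K V_disc_linear[OF lip v w] this]
  have "elem_value K (sym_grad (Dom P) (\<lambda>x. v x + a *\<^sub>R w x)) =
      (1/2) *\<^sub>R (A + a *\<^sub>R B + transpose (A + a *\<^sub>R B))"
    by (rule elem_value_eq[OF nd])
  moreover have "transpose (A + a *\<^sub>R B) = transpose A + a *\<^sub>R transpose B"
    by (simp add: transpose_def vec_eq_iff)
  moreover have eA: "elem_value K (sym_grad (Dom P) v) = (1/2) *\<^sub>R (A + transpose A)"
    by (rule elem_value_eq[OF nd sym_grad_affine[OF lip m K v A]])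
  moreover have "elem_value K (sym_grad (Dom P) w) = (1/2) *\<^sub>R (B + transpose B)"
    by (rule elem_value_eq[OF nd sym_grad_affine[OF lip m K w B]])
  ultimately show "elem_value K (sym_grad (Dom P) (\<lambda>x. v x + a *\<^sub>R w x)) =
      elem_value K (sym_grad (Dom P) v) + a *\<^sub>R elem_value K (sym_grad (Dom P) w)"
    by (simp add: algebra_simps)
  show "elem_value K (sym_grad (Dom P) v) \<in> sym_mats"
    unfolding eA by (simp add: sym_mats_def transpose_def vec_eq_iff)
qed

section \<open>The discrete variational inequality\<close>

lemma mat_1_inner: "(mat 1 :: real^'n^'n) \<bullet> M = trace M"
  by (simp add: inner_vec_def mat_def trace_def if_distrib[of "\<lambda>x. x * _"] cong: if_cong)

lemma elast_inner: "elast P \<tau> \<bullet> \<mu> = lame_lambda P * trace \<tau> * trace \<mu> + 2 * lame_mu P * (\<tau> \<bullet> \<mu>)"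
  by (simp add: elast_def inner_add_left mat_1_inner)

lemma elast_sym: "elast P \<tau> \<bullet> \<mu> = elast P \<mu> \<bullet> \<tau>"
  unfolding elast_inner inner_commute[of \<tau> \<mu>] by simp

lemma linear_elast: "linear (elast P)"
proof (rule linearI)
  have "trace (c *\<^sub>R A) = c * trace A" for c and A :: "real^'a^'a"
    by (simp add: trace_def sum_distrib_left)
  then show "elast P (c *\<^sub>R A) = c *\<^sub>R elast P A" for c A
    by (simp add: elast_def scaleR_add_right mult.commute mult.left_commute)
qed (simp add: elast_def trace_add scaleR_add_right scaleR_add_left distrib_left)

definition finer :: "('n::finite) mesh \<Rightarrow> 'n mesh \<Rightarrow> bool" where
  "finer \<T> \<S> \<longleftrightarrow> (\<forall>K'\<in>\<S>. \<exists>K\<in>\<T>. elem K' \<subseteq> elem K)"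

lemma descends_finer: "descends \<T> \<S> \<Longrightarrow> finer \<T> \<S>"
  unfolding descends_def finer_def by blast

lemma elementwise_const_finer:
  assumes fin: "finer \<T> \<S>" and F: "elementwise_const \<T> F"
  shows "elementwise_const \<S> F"
  unfolding elementwise_const_def
proof
  fix K' assume "K' \<in> \<S>"
  then obtain K where K: "K \<in> \<T>" "elem K' \<subseteq> elem K" using fin by (auto simp: finer_def)
  then obtain c where "AE x in lebesgue_on (elem K). F x = c" using F unfolding elementwise_const_def by blast
  from AE_elem_subset[OF K(2) this] show "\<exists>c. AE x in lebesgue_on (elem K'). F x = c" by blast
qed

lemma elem_value_sub:
  assumes K: "nondegenerate K" "K \<in> \<T>" and K': "nondegenerate K'" "elem K' \<subseteq> elem K"
    and F: "elementwise_const \<T> F"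
  shows "elem_value K' F = elem_value K F"
  by (rule elem_value_eq[OF K'(1) AE_elem_subset[OF K'(2) AE_elem_value[OF K F]]])

lemma X_disc_finer:
  assumes "finer \<T> \<S>" shows "X_disc P \<T> \<subseteq> X_disc P \<S>"
proof
  fix z assume z: "z \<in> X_disc P \<T>"
  obtain v q \<beta> where zz: "z = (v, q, \<beta>)" by (cases z)
  have "v \<in> V_disc P \<S>" using z assms unfolding zz X_disc_iff V_disc_def finer_def by blast
  then show "z \<in> X_disc P \<S>"
    using z unfolding zz X_disc_iff by (auto intro: elementwise_const_finer[OF assms])
qed

text \<open>The integrand of the bilinear form on one element, in terms of the strains, plastic strains and
  hardening parameters of the two arguments.\<close>

definition bilinear_density :: "('n::finite) plasticity \<Rightarrow> 'n tagged \<Rightarrow> real^'n^'n \<Rightarrow> real^'n^'n \<Rightarrow> real \<Rightarrow>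
    real^'n^'n \<Rightarrow> real^'n^'n \<Rightarrow> real \<Rightarrow> real" where
  "bilinear_density P K e p a e' q b = elast P (e - p) \<bullet> (e' - q) + elem_value K (hard_tensor P) p \<bullet> q +
     hard_modulus P * a * b"

abbreviation strain :: "('n::finite) plasticity \<Rightarrow> 'n tagged \<Rightarrow> (real^'n \<Rightarrow> real^'n) \<Rightarrow> real^'n^'n" where
  "strain P K w \<equiv> elem_value K (sym_grad (Dom P) w)"

text \<open>A mesh on whose elements the hardening tensor is constant, so that the forms and the dissipation of
  discrete functions become sums over the elements.\<close>

locale disc_problem =
  fixes P :: "('n::finite) plasticity" and \<S> :: "'n mesh"
  assumes P: "plasticity_setting P" and m: "is_mesh (Dom P) \<S>" and n: "CARD('n) \<ge> 2"
    and H: "elementwise_const \<S> (hard_tensor P)"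
begin

lemma lip: "lipschitz_domain (Dom P)"
  using P by (simp add: plasticity_setting_def)

lemmas nd = is_mesh_nondegenerate[OF m]

lemma stress_const:
  assumes w: "w \<in> V_disc P \<S>" and p: "elementwise_const \<S> p"
  shows "elementwise_const \<S> (stress P (w, p, \<alpha>))"
    and "K \<in> \<S> \<Longrightarrow> elem_value K (stress P (w, p, \<alpha>)) = elast P (strain P K w - elem_value K p)"
proof -
  have eq: "stress P (w, p, \<alpha>) = (\<lambda>x. elast P (sym_grad (Dom P) w x - p x))"
    by (simp add: stress_def fun_eq_iff)
  note E = strain_const[OF lip m w]
  show "elementwise_const \<S> (stress P (w, p, \<alpha>))"
    unfolding eq by (rule elementwise_const_comp2[OF E p])
  show "K \<in> \<S> \<Longrightarrow> elem_value K (stress P (w, p, \<alpha>)) = elast P (strain P K w - elem_value K p)"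
    unfolding eq by (rule elem_value_comp2[OF nd _ E p])
qed

lemma a_form_mesh:
  assumes wv: "w \<in> V_disc P \<S>" "v \<in> V_disc P \<S>"
    and c: "elementwise_const \<S> p" "elementwise_const \<S> q" "elementwise_const \<S> \<alpha>" "elementwise_const \<S> \<beta>"
  shows "a_form P (w, p, \<alpha>) (v, q, \<beta>) = (\<Sum>K\<in>\<S>. vol K *
    bilinear_density P K (strain P K w) (elem_value K p) (elem_value K \<alpha>) (strain P K v) (elem_value K q) (elem_value K \<beta>))"
proof -
  note st = stress_const[OF wv(1) c(1)]
  note E = strain_const[OF lip m wv(2)]
  have c1: "elementwise_const \<S> (\<lambda>x. sym_grad (Dom P) v x - q x)" by (rule elementwise_const_comp2[OF E c(2)])
  have c2: "elementwise_const \<S> (\<lambda>x. hard_tensor P x (p x))" by (rule elementwise_const_comp2[OF H c(1)])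
  have c3: "elementwise_const \<S> (\<lambda>x. hard_modulus P * \<alpha> x)" by (rule elementwise_const_comp[OF c(3)])
  have v1: "elem_value K (\<lambda>x. sym_grad (Dom P) v x - q x) = strain P K v - elem_value K q" if "K \<in> \<S>" for K
    by (rule elem_value_comp2[OF nd[OF that] that E c(2)])
  have v2: "elem_value K (\<lambda>x. hard_tensor P x (p x)) = elem_value K (hard_tensor P) (elem_value K p)" if "K \<in> \<S>" for K
    by (rule elem_value_comp2[OF nd[OF that] that H c(1)])
  have v3: "elem_value K (\<lambda>x. hard_modulus P * \<alpha> x) = hard_modulus P * elem_value K \<alpha>" if "K \<in> \<S>" for K
    by (rule elem_value_comp[OF nd[OF that] that c(3)])
  show ?thesis
    unfolding a_form_def prod.case mesh_L2_inner[OF lip m st(1) c1] mesh_L2_inner[OF lip m c2 c(2)]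
      mesh_L2_inner[OF lip m c3 c(4)] sum.distrib[symmetric]
    by (rule sum.cong[OF refl]) (simp add: st(2) v1 v2 v3 bilinear_density_def algebra_simps)
qed

lemma psi_mesh:
  assumes c: "elementwise_const \<S> p" "elementwise_const \<S> \<alpha>"
  shows "psi P (w, p, \<alpha>) = (\<Sum>K\<in>\<S>. ennreal (vol K) * dissipation P (elem_value K p) (elem_value K \<alpha>))"
proof -
  have "elementwise_const \<S> (\<lambda>x. dissipation P (p x) (\<alpha> x))" by (rule elementwise_const_comp2[OF c])
  from mesh_nn_integral[OF lip m this] show ?thesis
    by (simp add: psi_def elem_value_comp2[OF nd _ c] cong: sum.cong)
qed

lemma psi_finite:
  assumes c: "elementwise_const \<S> p" "elementwise_const \<S> \<alpha>"
    and le: "\<And>K. K \<in> \<S> \<Longrightarrow> norm (elem_value K p) \<le> elem_value K \<alpha>"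
  shows "psi P (w, p, \<alpha>) = ennreal (\<Sum>K\<in>\<S>. vol K * (yield_stress P * norm (elem_value K p)))"
proof -
  have y: "yield_stress P > 0" using P by (simp add: plasticity_setting_def)
  have "psi P (w, p, \<alpha>) = (\<Sum>K\<in>\<S>. ennreal (vol K * (yield_stress P * norm (elem_value K p))))"
    unfolding psi_mesh[OF c] using le y by (intro sum.cong[OF refl]) (simp add: dissipation_def ennreal_mult)
  then show ?thesis using y by (simp add: sum_ennreal)
qed

lemma psi_finite_imp:
  assumes c: "elementwise_const \<S> p" "elementwise_const \<S> \<alpha>"
    and fin: "psi P (w, p, \<alpha>) < \<infinity>" and K: "K \<in> \<S>"
  shows "norm (elem_value K p) \<le> elem_value K \<alpha>"
proof (rule ccontr)
  assume "\<not> ?thesis"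
  then have "dissipation P (elem_value K p) (elem_value K \<alpha>) = \<infinity>" by (simp add: dissipation_def)
  moreover have "vol K > 0" by (rule vol_pos[OF nd[OF K]])
  ultimately have "ennreal (vol K) * dissipation P (elem_value K p) (elem_value K \<alpha>) = \<infinity>"
    by (simp add: ennreal_mult_top)
  moreover have "ennreal (vol K) * dissipation P (elem_value K p) (elem_value K \<alpha>) \<le> psi P (w, p, \<alpha>)"
    unfolding psi_mesh[OF c] using K mesh_finite[OF m] by (intro member_le_sum) auto
  ultimately show False using fin by (simp add: top_unique)
qed

lemma vi_real:
  assumes vi: "vi_solution P f g Z u" and z: "z \<in> Z" and r: "psi P z = ennreal r" "psi P u = ennreal s" "r \<ge> 0" "s \<ge> 0"
  shows "b_form P f g (z - u) \<le> a_form P u (z - u) + r - s"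
  using vi z r unfolding vi_solution_def by (auto dest!: bspec[where x = z])

text \<open>The dissipation does not see the displacement, so both signs of a displacement are admissible as
  test directions.\<close>

lemma displacement_equation:
  assumes fg: "loads P f g" and vi: "vi_solution P f g (X_disc P \<S>) (v, p, \<alpha>)" and w: "w \<in> V_disc P \<S>"
  shows "b_form P f g (w, q, \<beta>) = (\<Sum>K\<in>\<S>. vol K * (elast P (strain P K v - elem_value K p) \<bullet> strain P K w))"
proof -
  have u: "(v, p, \<alpha>) \<in> X_disc P \<S>" and fin: "psi P (v, p, \<alpha>) < \<infinity>" using vi by (auto simp: vi_solution_def)
  then have d: "v \<in> V_disc P \<S>" "p \<in> Q_space P" "elementwise_const \<S> p" "\<alpha> \<in> M_space P" "elementwise_const \<S> \<alpha>"
    by (auto simp: X_disc_iff)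
  let ?r = "\<Sum>K\<in>\<S>. vol K * (yield_stress P * norm (elem_value K p))"
  have y: "yield_stress P > 0" using P by (simp add: plasticity_setting_def)
  have r0: "?r \<ge> 0" using y by (intro sum_nonneg) simp
  have psi: "psi P (v', p, \<alpha>) = ennreal ?r" for v'
    by (rule psi_finite[OF d(3,5)]) (rule psi_finite_imp[OF d(3,5) fin])
  let ?S = "\<lambda>w. \<Sum>K\<in>\<S>. vol K * (elast P (strain P K v - elem_value K p) \<bullet> strain P K w)"
  have zc: "elementwise_const \<S> (\<lambda>x. 0 :: 'b :: zero)" by (auto simp: elementwise_const_def)
  have z0: "elem_value K (\<lambda>x. 0 :: 'b :: zero) = 0" if "K \<in> \<S>" for K
    by (rule elem_value_eq[OF nd[OF that]]) simp
  have one: "b_form P f g (w', \<lambda>x. 0, \<lambda>x. 0) \<le> ?S w'" if w': "w' \<in> V_disc P \<S>" for w'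
  proof -
    let ?z = "(\<lambda>x. v x + w' x, p, \<alpha>)"
    have "?z \<in> X_disc P \<S>" using d V_disc_diff(2)[OF lip d(1) w'] by (simp add: X_disc_iff)
    from vi_real[OF vi this psi psi r0 r0]
    have "b_form P f g (?z - (v, p, \<alpha>)) \<le> a_form P (v, p, \<alpha>) (?z - (v, p, \<alpha>))" by simp
    moreover have "?z - (v, p, \<alpha>) = (w', \<lambda>x. 0, \<lambda>x. 0)" by (simp add: fun_diff_def)
    moreover have "a_form P (v, p, \<alpha>) (w', \<lambda>x. 0, \<lambda>x. 0) = ?S w'"
      unfolding a_form_mesh[OF d(1) w' d(3) zc d(5) zc]
      by (rule sum.cong[OF refl]) (simp add: bilinear_density_def z0)
    ultimately show ?thesis by simp
  qed
  have neg: "(\<lambda>x. - w x) \<in> V_disc P \<S>" using V_disc_linear[OF lip V_disc_diff(3)[OF lip w w] w, of "-1"] by simp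
  have zero: "b_form P f g (\<lambda>x. 0, q', \<beta>') = 0" for q' \<beta>'
    using b_form_linear[OF P m n fg w w, of "-1" q' \<beta>' q' \<beta>' q' \<beta>'] by simp
  have bneg: "b_form P f g (\<lambda>x. - w x, \<lambda>x. 0, \<lambda>x. 0) = - b_form P f g (w, \<lambda>x. 0, \<lambda>x. 0)"
    using b_form_linear[OF P m n fg V_disc_diff(3)[OF lip w w] w, of "-1" "\<lambda>x. 0" "\<lambda>x. 0" "\<lambda>x. 0" "\<lambda>x. 0" "\<lambda>x. 0" "\<lambda>x. 0"] zero
    by simp
  have sneg: "?S (\<lambda>x. - w x) = - ?S w"
  proof -
    have "strain P K (\<lambda>x. - w x) = - strain P K w" if "K \<in> \<S>" for K
      using strain_props(1)[OF lip m that V_disc_diff(3)[OF lip w w] w, of "-1"]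
        strain_props(1)[OF lip m that w w, of "-1"] by simp
    then have "?S (\<lambda>x. - w x) = (\<Sum>K\<in>\<S>. - (vol K * (elast P (strain P K v - elem_value K p) \<bullet> strain P K w)))"
      by (intro sum.cong) auto
    then show ?thesis by (simp add: sum_negf)
  qed
  have "b_form P f g (w, q, \<beta>) = b_form P f g (w, \<lambda>x. 0, \<lambda>x. 0)" by (simp add: b_form_def)
  with one[OF w] one[OF neg] bneg sneg show ?thesis by simp
qed

text \<open>Plastic strain and hardening are independent constants on the elements, so the solution may be
  changed on a single element.\<close>

lemma flow_rule:
  assumes fg: "loads P f g" and vi: "vi_solution P f g (X_disc P \<S>) (v, p, \<alpha>)"
    and K: "K \<in> \<S>" and q: "q \<in> dev_mats" "norm q \<le> b"
  defines "p1 \<equiv> elem_value K p" and "a1 \<equiv> elem_value K \<alpha>"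
  shows "0 \<le> - (elast P (strain P K v - p1) \<bullet> (q - p1)) + elem_value K (hard_tensor P) p1 \<bullet> (q - p1)
    + hard_modulus P * a1 * (b - a1) + yield_stress P * (norm q - norm p1)"
proof -
  have u: "(v, p, \<alpha>) \<in> X_disc P \<S>" and fin: "psi P (v, p, \<alpha>) < \<infinity>" using vi by (auto simp: vi_solution_def)
  then have d: "v \<in> V_disc P \<S>" "p \<in> Q_space P" "elementwise_const \<S> p" "\<alpha> \<in> M_space P" "elementwise_const \<S> \<alpha>"
    by (auto simp: X_disc_iff)
  \<comment> \<open>The solution with the values \<open>q\<close> and \<open>b\<close> on the element \<open>K\<close>.\<close>
  define p' where "p' x = (if x \<in> elem K then q else p x)" for x
  define \<alpha>' where "\<alpha>' x = (if x \<in> elem K then b else \<alpha> x)" for x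
  have AEeq: "AE x in lebesgue_on (elem K'). (if x \<in> elem K then c else F x) = (if K' = K then c else elem_value K' F)"
    if K': "K' \<in> \<S>" and F: "elementwise_const \<S> F" for K' and F :: "real^'n \<Rightarrow> 'b" and c
  proof -
    have "AE x in lebesgue_on (elem K'). x \<in> elem K'" by (rule AE_I2) simp
    with AE_elem_value[OF nd[OF K'] K' F] AE_elem_only[OF m K'] show ?thesis
      by eventually_elim (use K in auto)
  qed
  have p'c: "elementwise_const \<S> p'" and \<alpha>'c: "elementwise_const \<S> \<alpha>'"
    unfolding elementwise_const_def p'_def \<alpha>'_def
    by (intro ballI exI, erule AEeq[OF _ d(3)], intro ballI exI, erule AEeq[OF _ d(5)])
  have p'v: "elem_value K' p' = (if K' = K then q else elem_value K' p)"
    and \<alpha>'v: "elem_value K' \<alpha>' = (if K' = K then b else elem_value K' \<alpha>)" if "K' \<in> \<S>" for K'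
    unfolding p'_def \<alpha>'_def
    by (rule elem_value_eq[OF nd[OF that] AEeq[OF that d(3)]],
        rule elem_value_eq[OF nd[OF that] AEeq[OF that d(5)]])
  let ?z = "(v, p', \<alpha>')"
  have "?z \<in> X_disc P \<S>"
  proof -
    have "AE x in lebesgue_on (Dom P). p' x \<in> dev_mats"
      using d(2) q(1) by (auto simp: Q_space_def p'_def elim: eventually_mono)
    then show ?thesis
      using d(1) p'c \<alpha>'c elementwise_const_L2[OF lip m p'c] elementwise_const_L2[OF lip m \<alpha>'c]
      by (simp add: X_disc_iff Q_space_def M_space_def)
  qed
  moreover have le: "norm (elem_value K' p) \<le> elem_value K' \<alpha>" if "K' \<in> \<S>" for K'
    by (rule psi_finite_imp[OF d(3,5) fin that])
  then have le': "norm (elem_value K' p') \<le> elem_value K' \<alpha>'" if "K' \<in> \<S>" for K'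
    using p'v[OF that] \<alpha>'v[OF that] q(2) that by simp
  have y: "yield_stress P > 0" using P by (simp add: plasticity_setting_def)
  have nn: "0 \<le> (\<Sum>K\<in>\<S>. vol K * (yield_stress P * norm (elem_value K q)))" for q
    using y by (intro sum_nonneg) simp
  ultimately have "b_form P f g (?z - (v, p, \<alpha>)) \<le> a_form P (v, p, \<alpha>) (?z - (v, p, \<alpha>)) +
      (\<Sum>K\<in>\<S>. vol K * (yield_stress P * norm (elem_value K p'))) - (\<Sum>K\<in>\<S>. vol K * (yield_stress P * norm (elem_value K p)))"
    using vi_real[OF vi _ psi_finite[OF p'c \<alpha>'c le'] psi_finite[OF d(3,5) le] nn nn] by blast
  moreover have "?z - (v, p, \<alpha>) = (\<lambda>x. 0, \<lambda>x. p' x - p x, \<lambda>x. \<alpha>' x - \<alpha> x)" by (simp add: fun_diff_def)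
  moreover have "b_form P f g (\<lambda>x. 0, q', \<beta>') = 0" for q' \<beta>'
    using b_form_linear[OF P m n fg d(1) d(1), of "-1" q' \<beta>' q' \<beta>' q' \<beta>'] by simp
  moreover have "a_form P (v, p, \<alpha>) (\<lambda>x. 0, \<lambda>x. p' x - p x, \<lambda>x. \<alpha>' x - \<alpha> x) =
      (\<Sum>K'\<in>\<S>. vol K' * bilinear_density P K' (strain P K' v) (elem_value K' p) (elem_value K' \<alpha>) 0
        (elem_value K' p' - elem_value K' p) (elem_value K' \<alpha>' - elem_value K' \<alpha>))"
  proof -
    note z0 = V_disc_diff(3)[OF lip d(1) d(1)]
    have "strain P K' (\<lambda>x. 0) = 0" if "K' \<in> \<S>" for K'
      using strain_props(1)[OF lip m that d(1) d(1), of "-1"] by simp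
    then show ?thesis
      unfolding a_form_mesh[OF d(1) z0 d(3) elementwise_const_comp2[OF p'c d(3)] d(5) elementwise_const_comp2[OF \<alpha>'c d(5)]]
      by (intro sum.cong[OF refl]) (simp add: elem_value_comp2[OF nd _ p'c d(3)] elem_value_comp2[OF nd _ \<alpha>'c d(5)])
  qed
  ultimately have "0 \<le> (\<Sum>K'\<in>\<S>. vol K' * (bilinear_density P K' (strain P K' v) (elem_value K' p) (elem_value K' \<alpha>) 0
        (elem_value K' p' - elem_value K' p) (elem_value K' \<alpha>' - elem_value K' \<alpha>)
        + yield_stress P * norm (elem_value K' p') - yield_stress P * norm (elem_value K' p)))"
    by (simp add: sum.distrib sum_subtractf algebra_simps)
  also have "\<dots> = (\<Sum>K'\<in>{K}. vol K' * (bilinear_density P K' (strain P K' v) (elem_value K' p) (elem_value K' \<alpha>) 0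
        (elem_value K' p' - elem_value K' p) (elem_value K' \<alpha>' - elem_value K' \<alpha>)
        + yield_stress P * norm (elem_value K' p') - yield_stress P * norm (elem_value K' p)))"
    by (rule sum.mono_neutral_right) (use K mesh_finite[OF m] p'v \<alpha>'v in \<open>auto simp: bilinear_density_def\<close>)
  finally have "0 \<le> bilinear_density P K (strain P K v) p1 a1 0 (q - p1) (b - a1)
        + yield_stress P * norm q - yield_stress P * norm p1"
    using p'v[OF K] \<alpha>'v[OF K] vol_pos[OF nd[OF K]] by (simp add: zero_le_mult_iff p1_def a1_def)
  then show ?thesis by (simp add: bilinear_density_def algebra_simps)
qed

end

section \<open>Energy and stress distance\<close>

text \<open>The energy gap on one element, in a form independent of meshes.  The stress \<open>s\<close> and the hardening
  \<open>B\<close> are symmetric and coercive on the subspace of symmetric matrices, primes mark the finer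
  solution, and the two assumptions named after the flow rule are its instances for the two
  solutions, each tested with the other.  The gap is a sum of three nonnegative parts: half the
  quadratic form of the difference in stress and in hardening, and the value \<open>br\<close> of the finer flow
  rule.  Adding the two flow rules shows that plastic strains differ by at most a multiple of the
  difference of the stresses.\<close>

lemma energy_gap_density:
  fixes s B :: "'a::real_inner \<Rightarrow> 'a"
  assumes lin: "linear s" "linear B" and S: "subspace S"
    and sym: "\<And>\<tau> \<mu>. \<tau> \<in> S \<Longrightarrow> \<mu> \<in> S \<Longrightarrow> s \<tau> \<bullet> \<mu> = s \<mu> \<bullet> \<tau>" "\<And>\<tau> \<mu>. \<tau> \<in> S \<Longrightarrow> \<mu> \<in> S \<Longrightarrow> B \<tau> \<bullet> \<mu> = B \<mu> \<bullet> \<tau>"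
    and co: "\<And>\<tau>. \<tau> \<in> S \<Longrightarrow> \<kappa>C * (norm \<tau>)\<^sup>2 \<le> s \<tau> \<bullet> \<tau>" "\<And>\<tau>. \<tau> \<in> S \<Longrightarrow> \<kappa>H * (norm \<tau>)\<^sup>2 \<le> B \<tau> \<bullet> \<tau>"
    and pos: "\<kappa>C > 0" "\<kappa>H > 0" "L > 0" "h \<ge> 0" and L: "\<And>\<tau>. norm (s \<tau>) \<le> L * norm \<tau>"
    and mem: "e \<in> S" "p \<in> S" "e' \<in> S" "p' \<in> S"
    and flow': "0 \<le> - (s (e' - p') \<bullet> (p - p')) + B p' \<bullet> (p - p') + h * a' * (a - a') + y * (norm p - norm p')"
    and flow: "0 \<le> - (s (e - p) \<bullet> (p' - p)) + B p \<bullet> (p' - p) + h * a * (a' - a) + y * (norm p' - norm p)"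
  defines "G \<equiv> (s (e - p) \<bullet> (e - p) + B p \<bullet> p + h * a * a) / 2 - (s (e' - p') \<bullet> (e' - p') + B p' \<bullet> p' + h * a' * a') / 2
      + y * (norm p - norm p') - s (e' - p') \<bullet> (e - e')"
    and "D \<equiv> (norm (s (e - p) - s (e' - p')))\<^sup>2"
  shows "\<kappa>C / (2 * L\<^sup>2) * D \<le> G" "G \<le> (1 / (2 * \<kappa>C) + 1 / \<kappa>H) * D"
proof -
  define t t' d \<pi> where "t = e - p" and "t' = e' - p'" and "d = t - t'" and "\<pi> = p - p'"
  have inS: "t \<in> S" "t' \<in> S" "d \<in> S" "\<pi> \<in> S"
    using mem S by (auto simp: t_def t'_def d_def \<pi>_def intro!: subspace_diff)
  have sd: "s d = s t - s t'" and Bd: "B \<pi> = B p - B p'" using lin by (auto simp: d_def \<pi>_def linear_diff)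
  define A X Q where "A = s d \<bullet> d" and "X = s d \<bullet> \<pi>" and "Q = B \<pi> \<bullet> \<pi> + h * (a - a')\<^sup>2"
  define br where "br = - (s t' \<bullet> \<pi>) + B p' \<bullet> \<pi> + h * a' * (a - a') + y * (norm p - norm p')"
  have D: "D = (norm (s d))\<^sup>2" by (simp add: D_def sd t_def t'_def)
  have G: "G = A / 2 + Q / 2 + br"
  proof -
    have 1: "s t \<bullet> t = s t' \<bullet> t' + 2 * (s t' \<bullet> d) + A"
      using sym(1)[OF inS(2,1)] by (simp add: A_def d_def sd inner_diff_left inner_diff_right linear_diff[OF lin(1)])
    have 2: "B p \<bullet> p = B p' \<bullet> p' + 2 * (B p' \<bullet> \<pi>) + B \<pi> \<bullet> \<pi>"
      using sym(2)[OF mem(4,2)] by (simp add: \<pi>_def inner_diff_left inner_diff_right linear_diff[OF lin(2)])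
    have 3: "s t' \<bullet> (e - e') = s t' \<bullet> d + s t' \<bullet> \<pi>"
      by (simp add: d_def \<pi>_def t_def t'_def inner_diff_right)
    show ?thesis
      unfolding G_def t_def[symmetric] t'_def[symmetric] 1 2 3 br_def Q_def
      by (simp add: field_simps power2_eq_square)
  qed
  have br0: "0 \<le> br" using flow' by (simp add: br_def t'_def \<pi>_def)
  have br1: "br \<le> X - Q"
  proof -
    have "- (s t \<bullet> (p' - p)) = s t \<bullet> \<pi>" "B p \<bullet> (p' - p) = - (B p \<bullet> \<pi>)" by (simp_all add: \<pi>_def inner_diff_right)
    then have "0 \<le> s t \<bullet> \<pi> - B p \<bullet> \<pi> + h * a * (a' - a) + y * (norm p' - norm p)"
      using flow by (simp add: t_def)
    moreover have "X - Q - br = s t \<bullet> \<pi> - B p \<bullet> \<pi> + h * a * (a' - a) + y * (norm p' - norm p)"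
      by (simp add: X_def Q_def br_def sd Bd inner_diff_left algebra_simps power2_eq_square)
    ultimately show ?thesis by linarith
  qed
  have hh: "0 \<le> h * (a - a')\<^sup>2" using pos by simp
  have Q: "\<kappa>H * (norm \<pi>)\<^sup>2 \<le> Q" using co(2)[OF inS(4)] hh by (simp add: Q_def)
  have Q0: "0 \<le> Q" using Q pos(2) by (smt (verit) mult_nonneg_nonneg zero_le_power2)
  have X1: "X \<le> norm (s d) * norm \<pi>" unfolding X_def by (rule norm_cauchy_schwarz)
  have "\<kappa>H * norm \<pi> * norm \<pi> \<le> norm (s d) * norm \<pi>"
    using Q br0 br1 X1 by (simp add: power2_eq_square mult.assoc)
  then have "\<kappa>H * norm \<pi> \<le> norm (s d)" by (cases "\<pi> = 0") auto
  then have \<pi>: "norm \<pi> \<le> norm (s d) / \<kappa>H" using pos by (simp add: field_simps)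
  have X: "X \<le> D / \<kappa>H"
    using X1 mult_left_mono[OF \<pi>, of "norm (s d)"] by (simp add: D power2_eq_square)
  have A1: "A \<le> norm (s d) * norm d" unfolding A_def by (rule norm_cauchy_schwarz)
  have A2: "\<kappa>C * (norm d)\<^sup>2 \<le> A" using co(1)[OF inS(3)] by (simp add: A_def)
  have "\<kappa>C * norm d * norm d \<le> norm (s d) * norm d" using A1 A2 by (simp add: power2_eq_square mult.assoc)
  then have "\<kappa>C * norm d \<le> norm (s d)" by (cases "d = 0") auto
  then have d: "norm d \<le> norm (s d) / \<kappa>C" using pos by (simp add: field_simps)
  have A: "A \<le> D / \<kappa>C"
    using A1 mult_left_mono[OF d, of "norm (s d)"] by (simp add: D power2_eq_square)
  have "G \<le> A / 2 + X" unfolding G using br1 Q0 by linarith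
  also have "\<dots> \<le> D / \<kappa>C / 2 + D / \<kappa>H" 
    using divide_right_mono[OF A, of 2] X by (intro add_mono) auto
  finally show "G \<le> (1 / (2 * \<kappa>C) + 1 / \<kappa>H) * D" by (simp add: field_simps)
  have "D \<le> L\<^sup>2 * (norm d)\<^sup>2"
    unfolding D using power_mono[OF L[of d], of 2] by (simp add: power_mult_distrib)
  then have "\<kappa>C / (2 * L\<^sup>2) * D \<le> \<kappa>C / (2 * L\<^sup>2) * (L\<^sup>2 * (norm d)\<^sup>2)"
    using pos by (intro mult_left_mono) auto
  also have "\<dots> = \<kappa>C * (norm d)\<^sup>2 / 2" using pos by simp
  also have "\<dots> \<le> A / 2" using A2 by simp
  also have "\<dots> \<le> G" unfolding G using br0 Q0 by linarith
  finally show "\<kappa>C / (2 * L\<^sup>2) * D \<le> G" .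
qed

text \<open>Elements are not null sets, so a property of the elementwise constant values that holds almost
  everywhere holds.\<close>

lemma AE_elem_const:
  assumes "nondegenerate K" "AE x in lebesgue_on (elem K). Q"
  shows Q
proof -
  have "AE x in lebesgue_on (elem K). Q = True" using assms(2) by simp
  from AE_elem_unique[OF assms(1), of "\<lambda>_. Q" Q, OF _ this] show Q by simp
qed

lemma is_mesh_nonempty:
  assumes "lipschitz_domain \<Omega>" "is_mesh \<Omega> \<T>" shows "\<T> \<noteq> {}"
proof
  assume "\<T> = {}"
  then have "closure \<Omega> = {}" using assms(2) unfolding is_mesh_def by simp
  then show False using assms(1) by (simp add: lipschitz_domain_def)
qed

lemma subspace_sym_mats: "subspace (sym_mats :: (real^'n^'n) set)"
  by (auto simp: subspace_def sym_mats_def transpose_def vec_eq_iff)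

context disc_problem
begin

lemma coercive_value:
  assumes "coercive_tensor (Dom P) B \<kappa>" and B: "elementwise_const \<S> B" and K: "K \<in> \<S>" and \<tau>: "\<tau> \<in> sym_mats"
  shows "\<kappa> * (norm \<tau>)\<^sup>2 \<le> elem_value K B \<tau> \<bullet> \<tau>"
proof -
  have "L2 (lebesgue_on (Dom P)) (\<lambda>x. \<tau>)"
    using domain_integrable_one[OF domain_lmeasurable(1)[OF lip]] by (simp add: L2_def)
  then have "AE x in lebesgue_on (Dom P). \<kappa> * (norm \<tau>)\<^sup>2 \<le> B x \<tau> \<bullet> \<tau>"
    using assms(1)[unfolded coercive_tensor_def, THEN spec, of "\<lambda>x. \<tau>"] \<tau> by simp
  from AE_domain_elem[OF lip m K this] AE_elem_value[OF nd[OF K] K B]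
  have "AE x in lebesgue_on (elem K). \<kappa> * (norm \<tau>)\<^sup>2 \<le> elem_value K B \<tau> \<bullet> \<tau>"
    by eventually_elim simp
  then show ?thesis by (rule AE_elem_const[OF nd[OF K]])
qed

lemma coercive_elast:
  assumes "coercive_tensor (Dom P) (\<lambda>x. elast P) \<kappa>" and \<tau>: "\<tau> \<in> sym_mats"
  shows "\<kappa> * (norm \<tau>)\<^sup>2 \<le> elast P \<tau> \<bullet> \<tau>"
proof -
  obtain K where K: "K \<in> \<S>" using is_mesh_nonempty[OF lip m] by blast
  have "elementwise_const \<S> (\<lambda>x. elast P)" by (auto simp: elementwise_const_def)
  moreover have "elem_value K (\<lambda>x. elast P) = elast P" by (rule elem_value_eq[OF nd[OF K]]) simp
  ultimately show ?thesis using coercive_value[OF assms(1) _ K \<tau>] by simp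
qed

lemma hard_value:
  assumes K: "K \<in> \<S>"
  shows "linear (elem_value K (hard_tensor P))"
    and "\<tau> \<in> sym_mats \<Longrightarrow> \<mu> \<in> sym_mats \<Longrightarrow>
      elem_value K (hard_tensor P) \<tau> \<bullet> \<mu> = elem_value K (hard_tensor P) \<mu> \<bullet> \<tau>"
proof -
  have "AE x in lebesgue_on (Dom P). linear (hard_tensor P x) \<and>
        (\<forall>\<tau>\<in>sym_mats. \<forall>\<mu>\<in>sym_mats. hard_tensor P x \<tau> \<bullet> \<mu> = \<tau> \<bullet> hard_tensor P x \<mu>)"
    using P by (simp add: plasticity_setting_def)
  from AE_domain_elem[OF lip m K this] AE_elem_value[OF nd[OF K] K H]
  have "AE x in lebesgue_on (elem K). linear (elem_value K (hard_tensor P)) \<and>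
        (\<forall>\<tau>\<in>sym_mats. \<forall>\<mu>\<in>sym_mats. elem_value K (hard_tensor P) \<tau> \<bullet> \<mu> = \<tau> \<bullet> elem_value K (hard_tensor P) \<mu>)"
    by eventually_elim simp
  from AE_elem_const[OF nd[OF K] this]
  show "linear (elem_value K (hard_tensor P))"
    "\<tau> \<in> sym_mats \<Longrightarrow> \<mu> \<in> sym_mats \<Longrightarrow>
      elem_value K (hard_tensor P) \<tau> \<bullet> \<mu> = elem_value K (hard_tensor P) \<mu> \<bullet> \<tau>"
    by (auto simp: inner_commute)
qed

lemma disc_dev_value:
  assumes "p \<in> Q_space P" "elementwise_const \<S> p" "K \<in> \<S>"
  shows "elem_value K p \<in> dev_mats"
proof -
  have "AE x in lebesgue_on (Dom P). p x \<in> dev_mats" using assms(1) by (simp add: Q_space_def)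
  from AE_domain_elem[OF lip m assms(3) this] AE_elem_value[OF nd[OF assms(3)] assms(3,2)]
  have "AE x in lebesgue_on (elem K). elem_value K p \<in> dev_mats" by eventually_elim simp
  then show ?thesis by (rule AE_elem_const[OF nd[OF assms(3)]])
qed

lemma stress_dist_mesh:
  assumes u: "(w, p, \<alpha>) \<in> X_disc P \<S>" and z: "(v, q, \<beta>) \<in> X_disc P \<S>"
  shows "(stress_dist P (w, p, \<alpha>) (v, q, \<beta>))\<^sup>2 = (\<Sum>K\<in>\<S>. vol K *
    (norm (elast P (strain P K w - elem_value K p) - elast P (strain P K v - elem_value K q)))\<^sup>2)"
proof -
  have w: "w \<in> V_disc P \<S>" "elementwise_const \<S> p" and v: "v \<in> V_disc P \<S>" "elementwise_const \<S> q"
    using u z by (auto simp: X_disc_iff)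
  show ?thesis
    unfolding stress_dist_def mesh_L2_nrm[OF lip m elementwise_const_comp2[OF stress_const(1)[OF w] stress_const(1)[OF v]]]
    by (rule sum.cong[OF refl])
      (simp add: elem_value_comp2[OF nd _ stress_const(1)[OF w] stress_const(1)[OF v]] stress_const(2)[OF w] stress_const(2)[OF v])
qed

end

definition energy :: "('n::finite) plasticity \<Rightarrow> (real^'n \<Rightarrow> real^'n) \<Rightarrow> (real^'n \<Rightarrow> real^'n) \<Rightarrow> 'n state \<Rightarrow> real" where
  "energy P f g z = a_form P z z / 2 + enn2real (psi P z) - b_form P f g z"

text \<open>All quantities are evaluated on the finer mesh.  The load enters the gap linearly and is
  eliminated by the displacement equation of the finer problem; the remaining summands are those
  of \<open>energy_gap_density\<close>.\<close>

lemma energy_gap: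
  fixes P :: "('n::finite) plasticity"
  assumes T: "disc_problem P \<T>" and S: "disc_problem P \<S>" and fin: "finer \<T> \<S>"
    and fg: "loads P f g"
    and u: "vi_solution P f g (X_disc P \<T>) u" and u': "vi_solution P f g (X_disc P \<S>) u'"
    and \<kappa>: "\<kappa>C > 0" "coercive_tensor (Dom P) (\<lambda>x. elast P) \<kappa>C"
      "\<kappa>H > 0" "coercive_tensor (Dom P) (hard_tensor P) \<kappa>H"
    and L: "L > 0" "\<And>\<tau>. norm (elast P \<tau>) \<le> L * norm \<tau>"
  shows "\<kappa>C / (2 * L\<^sup>2) * (stress_dist P u' u)\<^sup>2 \<le> energy P f g u - energy P f g u'"
    and "energy P f g u - energy P f g u' \<le> (1 / (2 * \<kappa>C) + 1 / \<kappa>H) * (stress_dist P u' u)\<^sup>2"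
proof -
  interpret T: disc_problem P \<T> by (rule T)
  interpret S: disc_problem P \<S> by (rule S)
  obtain w p \<alpha> where uu: "u = (w, p, \<alpha>)" by (cases u)
  obtain w' p' \<alpha>' where uu': "u' = (w', p', \<alpha>')" by (cases u')
  have uX: "(w, p, \<alpha>) \<in> X_disc P \<T>" and u'X: "(w', p', \<alpha>') \<in> X_disc P \<S>"
    and psiu: "psi P (w, p, \<alpha>) < \<infinity>" and psiu': "psi P (w', p', \<alpha>') < \<infinity>"
    using u u' by (auto simp: vi_solution_def uu uu')
  have uS: "(w, p, \<alpha>) \<in> X_disc P \<S>" using uX X_disc_finer[OF fin] by blast
  have dT: "w \<in> V_disc P \<T>" "p \<in> Q_space P" "elementwise_const \<T> p" "elementwise_const \<T> \<alpha>"
    using uX by (auto simp: X_disc_iff)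
  have d: "w \<in> V_disc P \<S>" "elementwise_const \<S> p" "elementwise_const \<S> \<alpha>"
    using uS by (auto simp: X_disc_iff)
  have d': "w' \<in> V_disc P \<S>" "p' \<in> Q_space P" "elementwise_const \<S> p'" "elementwise_const \<S> \<alpha>'"
    using u'X by (auto simp: X_disc_iff)
  let ?y = "yield_stress P" and ?h = "hard_modulus P"
  have yh: "?y > 0" "?h > 0" using S.P by (auto simp: plasticity_setting_def)
  define e pv av e' pv' av' B where "e K = strain P K w" and "pv K = elem_value K p" and "av K = elem_value K \<alpha>"
    and "e' K = strain P K w'" and "pv' K = elem_value K p'" and "av' K = elem_value K \<alpha>'"
    and "B K = elem_value K (hard_tensor P)" for K
  note defs = e_def pv_def av_def e'_def pv'_def av'_def B_def
  have le: "norm (pv K) \<le> av K" "norm (pv' K) \<le> av' K" if "K \<in> \<S>" for K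
    using S.psi_finite_imp[OF d(2,3) psiu that] S.psi_finite_imp[OF d'(3,4) psiu' that] by (auto simp: defs)
  have en: "energy P f g (w, p, \<alpha>) = (\<Sum>K\<in>\<S>. vol K * ((elast P (e K - pv K) \<bullet> (e K - pv K) + B K (pv K) \<bullet> pv K
      + ?h * av K * av K) / 2 + ?y * norm (pv K))) - b_form P f g (w, p, \<alpha>)"
  proof -
    have "psi P (w, p, \<alpha>) = ennreal (\<Sum>K\<in>\<S>. vol K * (?y * norm (pv K)))"
      unfolding pv_def by (rule S.psi_finite[OF d(2,3)]) (use le(1) in \<open>simp add: defs\<close>)
    moreover have "0 \<le> (\<Sum>K\<in>\<S>. vol K * (?y * norm (pv K)))" using yh by (intro sum_nonneg) simp
    ultimately show ?thesis
      unfolding energy_def S.a_form_mesh[OF d(1,1,2,2,3,3)]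
      by (simp add: bilinear_density_def defs sum.distrib sum_divide_distrib distrib_left add_divide_distrib)
  qed
  have en': "energy P f g (w', p', \<alpha>') = (\<Sum>K\<in>\<S>. vol K * ((elast P (e' K - pv' K) \<bullet> (e' K - pv' K) + B K (pv' K) \<bullet> pv' K
      + ?h * av' K * av' K) / 2 + ?y * norm (pv' K))) - b_form P f g (w', p', \<alpha>')"
  proof -
    have "psi P (w', p', \<alpha>') = ennreal (\<Sum>K\<in>\<S>. vol K * (?y * norm (pv' K)))"
      unfolding pv'_def by (rule S.psi_finite[OF d'(3,4)]) (use le(2) in \<open>simp add: defs\<close>)
    moreover have "0 \<le> (\<Sum>K\<in>\<S>. vol K * (?y * norm (pv' K)))" using yh by (intro sum_nonneg) simp
    ultimately show ?thesis
      unfolding energy_def S.a_form_mesh[OF d'(1,1,3,3,4,4)]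
      by (simp add: bilinear_density_def defs sum.distrib sum_divide_distrib distrib_left add_divide_distrib)
  qed
  have bd: "b_form P f g (w, p, \<alpha>) - b_form P f g (w', p', \<alpha>') = (\<Sum>K\<in>\<S>. vol K * (elast P (e' K - pv' K) \<bullet> (e K - e' K)))"
  proof -
    have "b_form P f g (\<lambda>x. w x + (-1) *\<^sub>R w' x, p, \<alpha>) = b_form P f g (w, p, \<alpha>) - b_form P f g (w', p', \<alpha>')"
      by (subst b_form_linear[OF S.P S.m S.n fg d(1) d'(1)]) auto
    moreover have "b_form P f g (\<lambda>x. w x + (-1) *\<^sub>R w' x, p, \<alpha>) = (\<Sum>K\<in>\<S>. vol K * (elast P (e' K - pv' K) \<bullet>
        strain P K (\<lambda>x. w x + (-1) *\<^sub>R w' x)))"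
      unfolding defs by (rule S.displacement_equation[OF fg u'[unfolded uu'] V_disc_linear[OF S.lip d(1) d'(1)]])
    moreover have "strain P K (\<lambda>x. w x + (-1) *\<^sub>R w' x) = e K - e' K" if "K \<in> \<S>" for K
      using strain_props(1)[OF S.lip S.m that d(1) d'(1), of "-1"] by (simp add: defs)
    ultimately show ?thesis by simp
  qed
  define G where "G K = (elast P (e K - pv K) \<bullet> (e K - pv K) + B K (pv K) \<bullet> pv K + ?h * av K * av K) / 2
      - (elast P (e' K - pv' K) \<bullet> (e' K - pv' K) + B K (pv' K) \<bullet> pv' K + ?h * av' K * av' K) / 2
      + ?y * (norm (pv K) - norm (pv' K)) - elast P (e' K - pv' K) \<bullet> (e K - e' K)" for K
  have gap: "energy P f g u - energy P f g u' = (\<Sum>K\<in>\<S>. vol K * G K)"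
  proof -
    have "energy P f g u - energy P f g u' = (\<Sum>K\<in>\<S>. vol K * ((elast P (e K - pv K) \<bullet> (e K - pv K) + B K (pv K) \<bullet> pv K
      + ?h * av K * av K) / 2 + ?y * norm (pv K))) - (\<Sum>K\<in>\<S>. vol K * ((elast P (e' K - pv' K) \<bullet> (e' K - pv' K) + B K (pv' K) \<bullet> pv' K
      + ?h * av' K * av' K) / 2 + ?y * norm (pv' K))) - (\<Sum>K\<in>\<S>. vol K * (elast P (e' K - pv' K) \<bullet> (e K - e' K)))"
      unfolding uu uu' en en' bd[symmetric] by simp
    also have "\<dots> = (\<Sum>K\<in>\<S>. vol K * G K)"
      unfolding G_def sum_subtractf[symmetric] by (rule sum.cong[OF refl]) (simp add: algebra_simps)
    finally show ?thesis .
  qed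
  define D where "D K = (norm (elast P (e K - pv K) - elast P (e' K - pv' K)))\<^sup>2" for K
  have dist: "(stress_dist P u' u)\<^sup>2 = (\<Sum>K\<in>\<S>. vol K * D K)"
    unfolding uu uu' S.stress_dist_mesh[OF u'X uS] D_def defs by (simp add: norm_minus_commute)
  have G: "\<kappa>C / (2 * L\<^sup>2) * D K \<le> G K \<and> G K \<le> (1 / (2 * \<kappa>C) + 1 / \<kappa>H) * D K" if K: "K \<in> \<S>" for K
  proof -
    obtain K0 where K0: "K0 \<in> \<T>" "elem K \<subseteq> elem K0" using fin K by (auto simp: finer_def)
    have sub: "elem_value K F = elem_value K0 F" if "elementwise_const \<T> F" for F :: "real^'n \<Rightarrow> 'b"
      by (rule elem_value_sub[OF T.nd[OF K0(1)] K0(1) S.nd[OF K] K0(2) that])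
    have dev: "pv K \<in> dev_mats" "pv' K \<in> dev_mats"
      using S.disc_dev_value[OF dT(2) d(2) K] S.disc_dev_value[OF d'(2,3) K] by (auto simp: defs)
    have sym: "pv K \<in> sym_mats" "pv' K \<in> sym_mats" "e K \<in> sym_mats" "e' K \<in> sym_mats"
      using dev strain_props(2)[OF S.lip S.m K d(1) d(1)] strain_props(2)[OF S.lip S.m K d'(1) d'(1)]
      by (auto simp: defs dev_mats_def sym_mats_def)
    have flow': "0 \<le> - (elast P (e' K - pv' K) \<bullet> (pv K - pv' K)) + B K (pv' K) \<bullet> (pv K - pv' K)
        + ?h * av' K * (av K - av' K) + ?y * (norm (pv K) - norm (pv' K))"
      using S.flow_rule[OF fg u'[unfolded uu'] K dev(1) le(1)[OF K]] by (simp add: defs)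
    \<comment> \<open>The flow rule of the coarse problem on the coarse element, tested with the value of the fine one.\<close>
    have flow: "0 \<le> - (elast P (e K - pv K) \<bullet> (pv' K - pv K)) + B K (pv K) \<bullet> (pv' K - pv K)
        + ?h * av K * (av' K - av K) + ?y * (norm (pv' K) - norm (pv K))"
      using T.flow_rule[OF fg u[unfolded uu] K0(1) dev(2) le(2)[OF K]]
      by (simp add: defs sub[OF strain_const[OF T.lip T.m dT(1)]] sub[OF dT(3)] sub[OF dT(4)] sub[OF T.H])
    have co: "\<kappa>C * (norm \<tau>)\<^sup>2 \<le> elast P \<tau> \<bullet> \<tau>" "\<kappa>H * (norm \<tau>)\<^sup>2 \<le> B K \<tau> \<bullet> \<tau>" if "\<tau> \<in> sym_mats" for \<tau>
      using S.coercive_elast[OF \<kappa>(2) that] S.coercive_value[OF \<kappa>(4) S.H K that] by (auto simp: defs)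
    have h0: "?h \<ge> 0" using yh by simp
    note gap = energy_gap_density[OF linear_elast S.hard_value(1)[OF K, folded B_def] subspace_sym_mats elast_sym
        S.hard_value(2)[OF K, folded B_def] co \<kappa>(1,3) L(1) h0 L(2) sym(3,1,4,2) flow' flow]
    show ?thesis using gap unfolding G_def D_def by blast
  qed
  have "\<kappa>C / (2 * L\<^sup>2) * (stress_dist P u' u)\<^sup>2 = (\<Sum>K\<in>\<S>. vol K * (\<kappa>C / (2 * L\<^sup>2) * D K))"
    unfolding dist sum_distrib_left by (rule sum.cong[OF refl]) simp
  also have "\<dots> \<le> (\<Sum>K\<in>\<S>. vol K * G K)" using G by (intro sum_mono mult_left_mono) auto
  finally show "\<kappa>C / (2 * L\<^sup>2) * (stress_dist P u' u)\<^sup>2 \<le> energy P f g u - energy P f g u'" unfolding gap .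
  have "(\<Sum>K\<in>\<S>. vol K * G K) \<le> (\<Sum>K\<in>\<S>. vol K * ((1 / (2 * \<kappa>C) + 1 / \<kappa>H) * D K))"
    using G by (intro sum_mono mult_left_mono) auto
  also have "\<dots> = (1 / (2 * \<kappa>C) + 1 / \<kappa>H) * (stress_dist P u' u)\<^sup>2"
    unfolding dist sum_distrib_left by (rule sum.cong[OF refl]) (simp add: mult.left_commute)
  finally show "energy P f g u - energy P f g u' \<le> (1 / (2 * \<kappa>C) + 1 / \<kappa>H) * (stress_dist P u' u)\<^sup>2"
    unfolding gap .
qed

section \<open>The estimator on a finer mesh\<close>

text \<open>The squared facet residual is the surface integral of this density over the facet, which allows
  one to split it among the facets of a finer mesh.\<close>

definition residual_density ::
    "('n::finite) plasticity \<Rightarrow> (real^'n \<Rightarrow> real^'n) \<Rightarrow> 'n mesh \<Rightarrow> 'n state \<Rightarrow> 'n tagged \<Rightarrow>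
     (real^'n) set \<Rightarrow> real^'n \<Rightarrow> real" where
  "residual_density P g \<T> z K E x =
     (if facet_nbs \<T> K E \<noteq> {} then
        (norm ((elem_value K (stress P z) - elem_value (THE K'. K' \<in> facet_nbs \<T> K E) (stress P z))
            *v facet_normal K E))\<^sup>2
      else if E \<subseteq> GamD P then 0
      else indicator (GamN P) x * (norm (g x - elem_value K (stress P z) *v facet_normal K E))\<^sup>2)"

lemma residual_density_nonneg: "0 \<le> residual_density P g \<T> z K E x"
  by (simp add: residual_density_def)

lemma L2_nrm_sq: "(L2_nrm M F)\<^sup>2 = (LINT x|M. (norm (F x))\<^sup>2)"
  by (simp add: L2_nrm_def)

lemma facet_residual_sq:
  fixes P :: "('n::finite) plasticity"
  assumes P: "plasticity_setting P" and K: "nondegenerate K" "E \<in> facets K"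
  shows "(facet_residual P g \<T> z K E)\<^sup>2 = (LINT x:E|surface_measure. residual_density P g \<T> z K E x)"
proof -
  have E: "E \<in> sets surface_measure" by (rule facet_surface_sets[OF K])
  have G: "GamN P \<in> sets surface_measure" using GamN_props(1)[OF P] by simp
  consider "facet_nbs \<T> K E \<noteq> {}" | "facet_nbs \<T> K E = {}" "E \<subseteq> GamD P"
    | "facet_nbs \<T> K E = {}" "\<not> E \<subseteq> GamD P" by blast
  then show ?thesis
  proof cases
    case 1
    then show ?thesis using E
      by (simp add: facet_residual_def residual_density_def L2_nrm_sq integral_restrict_space
          set_lebesgue_integral_def measure_restrict_space)
  next
    case 2
    then show ?thesis
      by (simp add: facet_residual_def residual_density_def set_lebesgue_integral_def)
  next
    case 3
    then show ?thesis using E G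
      by (simp add: facet_residual_def residual_density_def L2_nrm_sq integral_restrict_space
          set_lebesgue_integral_def indicator_inter_arith mult.assoc)
  qed
qed

lemma residual_density_integrable:
  fixes P :: "('n::finite) plasticity"
  assumes P: "plasticity_setting P" and n: "CARD('n) \<ge> 2" and fg: "loads P f g"
    and K: "nondegenerate K" "E \<in> facets K"
  shows "set_integrable surface_measure E (residual_density P g \<T> z K E)"
proof -
  have E: "E \<in> sets surface_measure" by (rule facet_surface_sets[OF K])
  have G: "GamN P \<in> sets surface_measure" using GamN_props(1)[OF P] by simp
  have fin: "emeasure surface_measure E < \<infinity>" by (rule facet_surface_finite[OF K n])
  have const: "set_integrable surface_measure E (\<lambda>x. c :: real)" for c
    using integrable_mult_left[OF integrable_real_indicator[OF E fin], of c] by (simp add: set_integrable_def)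
  consider "facet_nbs \<T> K E \<noteq> {}" | "facet_nbs \<T> K E = {}" "E \<subseteq> GamD P"
    | "facet_nbs \<T> K E = {}" "\<not> E \<subseteq> GamD P" by blast
  then show ?thesis
  proof cases
    case 1
    then show ?thesis using const by (simp add: residual_density_def[abs_def])
  next
    case 2
    then show ?thesis using const[of 0] by (simp add: residual_density_def[abs_def])
  next
    case 3
    let ?A = "E \<inter> GamN P" and ?c = "elem_value K (stress P z) *v facet_normal K E"
    have A: "?A \<in> sets surface_measure" using E G by blast
    let ?M = "restrict_space surface_measure ?A"
    have Lg: "L2 (restrict_space surface_measure (GamN P)) g" using fg by (simp add: loads_def)
    from Lg have "g \<in> borel_measurable (restrict_space surface_measure (GamN P))" unfolding L2_def by (rule conjunct1)
    then have "g \<in> borel_measurable ?M" by (rule measurable_restrict_mono) simp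
    moreover have "integrable ?M (\<lambda>x. (norm (g x))\<^sup>2)"
    proof -
      have "set_integrable surface_measure (GamN P) (\<lambda>x. (norm (g x))\<^sup>2)"
        using Lg G by (simp add: L2_def integrable_restrict_space set_integrable_def)
      then have "set_integrable surface_measure ?A (\<lambda>x. (norm (g x))\<^sup>2)" using A by (rule set_integrable_subset) auto
      then show ?thesis using A by (simp add: integrable_restrict_space set_integrable_def)
    qed
    ultimately have "L2 ?M g" by (simp add: L2_def)
    moreover have "L2 ?M (\<lambda>x. - ?c)"
    proof -
      have "set_integrable surface_measure ?A (\<lambda>x. (norm (- ?c))\<^sup>2)" by (rule set_integrable_subset[OF const A]) auto
      then show ?thesis using A by (simp add: L2_def integrable_restrict_space set_integrable_def)
    qed
    ultimately have "integrable ?M (\<lambda>x. (norm (g x + - ?c))\<^sup>2)" using L2_add unfolding L2_def by blast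
    then have "integrable surface_measure (\<lambda>x. indicator ?A x *\<^sub>R (norm (g x - ?c))\<^sup>2)"
      using A by (simp add: integrable_restrict_space)
    then show ?thesis using 3
      by (simp add: residual_density_def[abs_def] set_integrable_def indicator_inter_arith mult.assoc)
  qed
qed

lemma mesh_face:
  assumes "is_mesh \<Omega> \<T>" "K \<in> \<T>" "K' \<in> \<T>"
  shows "(elem K \<inter> elem K') face_of elem K"
proof -
  have "triangulation (elem ` \<T>)" using assms(1) unfolding is_mesh_def by (elim conjE)
  then show ?thesis using assms(2,3) unfolding triangulation_def by blast
qed

text \<open>If the element across the fine facet lies in the same coarse element, there is no jump.  If it
  lies in another one, then the two coarse elements meet in a facet that contains the fine one.
  Without an element across, the Neumann residual is an integral over a part of the boundary of the
  domain; it vanishes unless the fine facet lies in a coarse one, which then has no neighbour either,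
  because facets between two elements have their relative interior inside the domain.\<close>

lemma residual_localizes:
  fixes P :: "('n::finite) plasticity" and \<T> \<S> :: "'n mesh"
  assumes P: "plasticity_setting P" and n: "CARD('n) \<ge> 2"
    and mT: "is_mesh (Dom P) \<T>" and mS: "is_mesh (Dom P) \<S>" and fin: "finer \<T> \<S>"
    and st: "elementwise_const \<T> (stress P z)"
    and K: "K \<in> \<T>" and K': "K' \<in> \<S>" "elem K' \<subseteq> elem K" and E': "E' \<in> facets K'"
    and nz: "facet_residual P g \<S> z K' E' \<noteq> 0"
  shows "\<exists>E\<in>facets K. E' \<subseteq> E \<and>
    (facet_residual P g \<S> z K' E')\<^sup>2 = (LINT x:E'|surface_measure. residual_density P g \<T> z K E x)"
proof -
  note ndT = is_mesh_nondegenerate[OF mT] and ndS = is_mesh_nondegenerate[OF mS]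
  note lip = GamN_props(4)[OF P]
  have val: "elem_value L' (stress P z) = elem_value L (stress P z)"
    if "L' \<in> \<S>" "L \<in> \<T>" "elem L' \<subseteq> elem L" for L L'
    by (rule elem_value_sub[OF ndT[OF that(2)] that(2) ndS[OF that(1)] that(3) st])
  have dimE': "aff_dim E' \<ge> int CARD('n) - 1" and E'K': "E' \<subseteq> elem K'"
    using facet_props(3,4)[OF ndS[OF K'(1)] E'] by auto
  have sq: "(facet_residual P g \<S> z K' E')\<^sup>2 = (LINT x:E'|surface_measure. residual_density P g \<S> z K' E' x)"
    by (rule facet_residual_sq[OF P ndS[OF K'(1)] E'])
  have E's: "E' \<in> sets surface_measure" by (rule facet_surface_sets[OF ndS[OF K'(1)] E'])
  show ?thesis
  proof (cases "facet_nbs \<S> K' E' = {}")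
    case False
    then obtain K'' where K'': "K'' \<in> facet_nbs \<S> K' E'" by blast
    then have the: "(THE L. L \<in> facet_nbs \<S> K' E') = K''"
      using facet_nbs_unique[OF mS K'(1) E'] by blast
    have mem: "K'' \<in> \<S>" "E' \<in> facets K''" using K'' by (auto simp: facet_nbs_def)
    obtain K2 where K2: "K2 \<in> \<T>" "elem K'' \<subseteq> elem K2" using fin mem by (auto simp: finer_def)
    have "K2 \<noteq> K"
    proof
      assume "K2 = K"
      then have "elem_value K'' (stress P z) = elem_value K' (stress P z)"
        using val[OF mem(1) K2] val[OF K'(1) K K'(2)] by simp
      then have "facet_residual P g \<S> z K' E' = 0"
        using False by (simp add: facet_residual_def the L2_nrm_def)
      with nz show False by simp
    qed
    let ?E = "elem K \<inter> elem K2"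
    have E'sub: "E' \<subseteq> ?E"
      using E'K' K'(2) facet_props(4)[OF ndS[OF mem(1)] mem(2)] K2(2) by blast
    have f: "?E face_of elem K" "?E face_of elem K2"
      using mesh_face[OF mT K K2(1)] mesh_face[OF mT K2(1) K] by (simp_all add: Int_commute)
    have ne: "?E \<noteq> elem K" "?E \<noteq> elem K2"
      using mesh_sub_unique[OF mT K K2(1) ndT[OF K]] mesh_sub_unique[OF mT K K2(1) ndT[OF K2(1)]] \<open>K2 \<noteq> K\<close>
      by blast+
    have E: "?E \<in> facets K" "?E \<in> facets K2"
      using facetI[OF ndT[OF K] f(1) ne(1) E'sub dimE' n] facetI[OF ndT[OF K2(1)] f(2) ne(2) E'sub dimE' n] by auto
    have nb: "K2 \<in> facet_nbs \<T> K ?E" using K2(1) \<open>K2 \<noteq> K\<close> E(2) by (simp add: facet_nbs_def)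
    then have theT: "(THE L. L \<in> facet_nbs \<T> K ?E) = K2" "facet_nbs \<T> K ?E \<noteq> {}"
      using facet_nbs_unique[OF mT K E(1)] by blast+
    have nu: "facet_normal K' E' = facet_normal K ?E"
      by (rule facet_normal_sub[OF ndT[OF K] E(1) ndS[OF K'(1)] E' K'(2) E'sub])
    have "residual_density P g \<S> z K' E' = residual_density P g \<T> z K ?E"
      using False theT by (simp add: fun_eq_iff residual_density_def the nu val[OF K'(1) K K'(2)] val[OF mem(1) K2])
    then show ?thesis using E(1) E'sub sq by (intro bexI[of _ ?E]) simp_all
  next
    case empty: True
    have nD: "\<not> E' \<subseteq> GamD P" using nz empty by (auto simp: facet_residual_def)
    have dens: "residual_density P g \<S> z K' E' x =
        indicator (GamN P) x * (norm (g x - elem_value K (stress P z) *v facet_normal K' E'))\<^sup>2" for x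
      using empty nD by (simp add: residual_density_def val[OF K'(1) K K'(2)])
    \<comment> \<open>Otherwise the residual is an integral over a null set.\<close>
    have nonnull: "E' \<inter> GamN P \<notin> null_sets surface_measure"
    proof
      assume null: "E' \<inter> GamN P \<in> null_sets surface_measure"
      have "(LINT x:E'|surface_measure. residual_density P g \<S> z K' E' x) = 0"
        unfolding set_lebesgue_integral_def dens[abs_def]
        by (rule integral_eq_zero_AE)
          (use AE_not_in[OF null] in \<open>eventually_elim, auto simp: indicator_def\<close>)
      then show False using nz sq by simp
    qed
    have cov: "E' \<inter> GamN P \<subseteq> (\<Union>E\<in>facets K. E' \<inter> E)"
    proof
      fix x assume x: "x \<in> E' \<inter> GamN P"
      then have "x \<in> frontier (Dom P)" "x \<in> elem K" using GamN_props(2)[OF P] E'K' K'(2) by auto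
      moreover have "open (Dom P)" by (rule domain_lmeasurable(3)[OF lip])
      ultimately have "x \<in> frontier (elem K)"
        using elem_interior_subset[OF lip mT K] by (auto simp: frontier_def interior_open)
      then show "x \<in> (\<Union>E\<in>facets K. E' \<inter> E)" using x frontier_elem[OF ndT[OF K]] by auto
    qed
    have low: "E' \<inter> E \<in> null_sets surface_measure" if E: "E \<in> facets K" "\<not> E' \<subseteq> E" for E
    proof (rule rel_boundary_facet_null[OF ndS[OF K'(1)] E' n])
      have "E \<inter> E' face_of elem K \<inter> E'"
        by (rule face_of_slice[OF facet_props(1)[OF ndT[OF K] E(1)] facet_props(7)[OF ndS[OF K'(1)] E']])
      moreover have "elem K \<inter> E' = E'" using E'K' K'(2) by blast
      ultimately show "E' \<inter> E face_of E'" by (simp add: Int_commute)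
      show "E' \<inter> E \<noteq> E'" using E(2) by blast
    qed
    have "\<exists>E\<in>facets K. E' \<subseteq> E"
    proof (rule ccontr)
      assume "\<not> (\<exists>E\<in>facets K. E' \<subseteq> E)"
      then have "(\<Union>E\<in>facets K. E' \<inter> E) \<in> null_sets surface_measure"
        using low by (intro null_sets.finite_UN) auto
      moreover have "E' \<inter> GamN P \<in> sets surface_measure" using E's GamN_props(1)[OF P] by simp
      ultimately have "E' \<inter> GamN P \<in> null_sets surface_measure"
        using cov by (rule null_sets_subset)
      with nonnull show False by simp
    qed
    then obtain E where E: "E \<in> facets K" "E' \<subseteq> E" by blast
    have Enb: "facet_nbs \<T> K E = {}"
    proof (rule ccontr)
      assume "facet_nbs \<T> K E \<noteq> {}"
      then obtain K2 where K2: "K2 \<in> facet_nbs \<T> K E" by blast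
      have "E' \<inter> GamN P \<subseteq> E - rel_interior E"
      proof
        fix x assume x: "x \<in> E' \<inter> GamN P"
        then have "x \<in> frontier (Dom P)" using GamN_props(2)[OF P] by auto
        then have "x \<notin> Dom P" using domain_lmeasurable(3)[OF lip] by (auto simp: frontier_def interior_open)
        then have "x \<notin> rel_interior E"
          using inner_facet_interior[OF mT K E(1) K2] lipschitz_interior_closure[OF lip] by auto
        then show "x \<in> E - rel_interior E" using x E(2) by auto
      qed
      moreover have "E' \<inter> GamN P \<in> sets surface_measure" using E's GamN_props(1)[OF P] by simp
      ultimately have "E' \<inter> GamN P \<in> null_sets surface_measure"
        by (intro null_sets_subset[OF facet_boundary_null[OF ndT[OF K] E(1) n]])
      with nonnull show False by simp
    qed
    have "\<not> E \<subseteq> GamD P" using nD E(2) by blast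
    moreover have "facet_normal K' E' = facet_normal K E"
      by (rule facet_normal_sub[OF ndT[OF K] E(1) ndS[OF K'(1)] E' K'(2) E(2)])
    ultimately have "residual_density P g \<S> z K' E' = residual_density P g \<T> z K E"
      using Enb by (simp add: fun_eq_iff dens) (simp add: residual_density_def)
    then show ?thesis using E sq by (intro bexI[of _ E]) simp_all
  qed
qed

text \<open>Equal facets would belong to two overlapping elements on the same side of the coarse facet.
  Different ones meet in a proper face by conformity.\<close>

lemma subfacets_overlap_null:
  fixes K :: "('n::finite) tagged" and \<S> :: "'n mesh"
  assumes n: "CARD('n) \<ge> 2" and mS: "is_mesh \<Omega> \<S>" and K: "nondegenerate K" "E \<in> facets K"
    and 1: "K1 \<in> \<S>" "elem K1 \<subseteq> elem K" "E1 \<in> facets K1" "E1 \<subseteq> E"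
    and 2: "K2 \<in> \<S>" "elem K2 \<subseteq> elem K" "E2 \<in> facets K2" "E2 \<subseteq> E"
    and ne: "(K1, E1) \<noteq> (K2, E2)"
  shows "E1 \<inter> E2 \<in> null_sets surface_measure"
proof (cases "E1 = E2")
  case True
  then have "K1 \<noteq> K2" using ne by simp
  obtain \<nu> b where h: "norm \<nu> = 1" "E \<subseteq> {y. \<nu> \<bullet> y = b}" "elem K \<subseteq> {y. \<nu> \<bullet> y \<le> b}"
    by (rule facet_hyperplane[OF K])
  have nz: "\<nu> \<noteq> 0" using h(1) by auto
  have "E1 \<subseteq> {y. \<nu> \<bullet> y = b}" "elem K1 \<subseteq> {y. \<nu> \<bullet> y \<le> b}" "elem K2 \<subseteq> {y. \<nu> \<bullet> y \<le> b}"
    using h(2,3) 1 2 by (meson order_trans)+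
  from same_side_overlap[OF is_mesh_nondegenerate[OF mS 1(1)] is_mesh_nondegenerate[OF mS 2(1)] 1(3) 2(3)[folded True] this nz]
    mesh_interiors_disjoint[OF mS 1(1) 2(1) \<open>K1 \<noteq> K2\<close>]
  show ?thesis by (rule notE)
next
  case False
  note nd1 = is_mesh_nondegenerate[OF mS 1(1)] and nd2 = is_mesh_nondegenerate[OF mS 2(1)]
  let ?F = "elem K1 \<inter> elem K2"
  have F: "?F face_of elem K1" "?F face_of elem K2"
    using mesh_face[OF mS 1(1) 2(1)] mesh_face[OF mS 2(1) 1(1)] by (simp_all add: Int_commute)
  have cF: "convex ?F" by (simp add: convex_Int)
  have "E1 \<inter> ?F face_of elem K1 \<inter> ?F" "E2 \<inter> ?F face_of elem K2 \<inter> ?F"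
    using face_of_slice[OF facet_props(1)[OF nd1 1(3)] cF] face_of_slice[OF facet_props(1)[OF nd2 2(3)] cF] by auto
  moreover have "elem K1 \<inter> ?F = ?F" "elem K2 \<inter> ?F = ?F" by auto
  ultimately have "E1 \<inter> ?F face_of ?F" "E2 \<inter> ?F face_of ?F" by simp_all
  then have "(E1 \<inter> ?F) \<inter> (E2 \<inter> ?F) face_of ?F" by (rule face_of_Int)
  moreover have eq: "(E1 \<inter> ?F) \<inter> (E2 \<inter> ?F) = E1 \<inter> E2"
    using facet_props(4)[OF nd1 1(3)] facet_props(4)[OF nd2 2(3)] by auto
  ultimately have f: "E1 \<inter> E2 face_of elem K1" "E1 \<inter> E2 face_of elem K2"
    using F face_of_trans by metis+
  have f1: "E1 \<inter> E2 face_of E1" and f2: "E1 \<inter> E2 face_of E2"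
    using face_of_subset[OF f(1) _ facet_props(4)[OF nd1 1(3)]] face_of_subset[OF f(2) _ facet_props(4)[OF nd2 2(3)]]
    by auto
  have "E1 \<inter> E2 \<noteq> E1"
  proof
    assume a: "E1 \<inter> E2 = E1"
    then have "E1 face_of E2" "E1 \<noteq> E2" using f2 False by simp_all
    then have "aff_dim E1 < aff_dim E2" using facet_props(7)[OF nd2 2(3)] by (intro face_of_aff_dim_lt)
    then show False using facet_props(3)[OF nd1 1(3)] facet_props(3)[OF nd2 2(3)] by simp
  qed
  then show ?thesis by (rule rel_boundary_facet_null[OF nd1 1(3) n f1])
qed

text \<open>The load is square integrable on the open domain; the boundary of an element is a Lebesgue null
  set.\<close>

lemma load_set_integrable:
  assumes lip: "lipschitz_domain \<Omega>" and m: "is_mesh \<Omega> \<T>" and K: "K \<in> \<T>" and f: "L2 (lebesgue_on \<Omega>) f"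
  shows "set_integrable lebesgue (elem K) (\<lambda>x. (norm (f x))\<^sup>2)"
proof -
  have \<Omega>: "\<Omega> \<in> sets lebesgue" by (rule domain_lmeasurable(2)[OF lip])
  have "set_integrable lebesgue \<Omega> (\<lambda>x. (norm (f x))\<^sup>2)"
    using f \<Omega> by (simp add: L2_def integrable_restrict_space set_integrable_def)
  then have i: "set_integrable lebesgue (interior (elem K)) (\<lambda>x. (norm (f x))\<^sup>2)"
    by (rule set_integrable_subset[OF _ _ elem_interior_subset[OF lip m K]]) simp
  show ?thesis
  proof (rule absolutely_integrable_spike_set[OF i])
    show "negligible {x \<in> interior (elem K) - elem K. (norm (f x))\<^sup>2 \<noteq> 0}"
    proof -
      have "{x \<in> interior (elem K) - elem K. (norm (f x))\<^sup>2 \<noteq> 0} = {}" using interior_subset by auto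
      then show ?thesis by (simp only: negligible_empty)
    qed
    show "negligible {x \<in> elem K - interior (elem K). (norm (f x))\<^sup>2 \<noteq> 0}"
      by (rule negligible_subset[OF negligible_frontier_elem[of K]]) (auto simp: frontier_def)
  qed
qed

text \<open>The bound on the relative volume of a bisected element in \<open>bisected_simplex\<close>.\<close>

definition shrink :: "('n::finite) itself \<Rightarrow> real" where
  "shrink _ = 1 - (1/2) ^ CARD('n)"

lemma shrink_bounds: "0 \<le> shrink TYPE('n::finite)" "shrink TYPE('n) < 1"
  by (simp_all add: shrink_def power_le_one)

lemma eta_sq_nonneg: "0 \<le> eta_sq P f g \<T> z K"
  by (simp add: eta_sq_def sum_nonneg)

text \<open>Every nonvanishing residual of a fine facet is assigned to a facet of the coarse element; the fine
  facets assigned to one coarse facet overlap in null sets.\<close>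

lemma eta_sq_refined_element:
  fixes P :: "('n::finite) plasticity" and \<T> \<S> :: "'n mesh"
  assumes P: "plasticity_setting P" and n: "CARD('n) \<ge> 2" and fg: "loads P f g"
    and mT: "is_mesh (Dom P) \<T>" and mS: "is_mesh (Dom P) \<S>" and fin: "finer \<T> \<S>"
    and st: "elementwise_const \<T> (stress P z)" and K: "K \<in> \<T>"
    and I: "I \<subseteq> \<S>" "\<And>K'. K' \<in> I \<Longrightarrow> elem K' \<subseteq> elem K \<and> vol K' \<le> q * vol K"
    and q: "0 \<le> q" "q \<le> 1"
  shows "(\<Sum>K'\<in>I. eta_sq P f g \<S> z K') \<le> sqrt q * eta_sq P f g \<T> z K"
proof -
  note ndT = is_mesh_nondegenerate[OF mT] and ndS = is_mesh_nondegenerate[OF mS]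
  note lip = GamN_props(4)[OF P]
  have finI: "finite I" using I(1) mesh_finite[OF mS] finite_subset by blast
  have Lf: "L2 (lebesgue_on (Dom P)) f" using fg by (simp add: loads_def)
  let ?r = "\<lambda>K' E'. (facet_residual P g \<S> z K' E')\<^sup>2"
  let ?J = "Sigma I facets"
  have finJ: "finite ?J" using finI by (intro finite_SigmaI) auto
  have fL: "(L2_nrm (lebesgue_on (elem L)) f)\<^sup>2 = (LINT x:elem L|lebesgue. (norm (f x))\<^sup>2)" for L
    by (simp add: L2_nrm_sq integral_restrict_space set_lebesgue_integral_def)
  have loads: "(\<Sum>K'\<in>I. (L2_nrm (lebesgue_on (elem K')) f)\<^sup>2) \<le> (L2_nrm (lebesgue_on (elem K)) f)\<^sup>2"
    unfolding fL
  proof (rule sum_integral_almost_disjoint[OF finI])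
    show "elem K1 \<inter> elem K2 \<in> null_sets lebesgue" if "K1 \<in> I" "K2 \<in> I" "K1 \<noteq> K2" for K1 K2
      using mesh_overlap_negligible[OF mS _ _ that(3)] that I(1) by (auto simp: negligible_iff_null_sets)
  qed (use I(2) load_set_integrable[OF lip mT K Lf] in auto)
  have jumps: "(\<Sum>(K',E')\<in>?J. ?r K' E') \<le> (\<Sum>E\<in>facets K. (facet_residual P g \<T> z K E)\<^sup>2)"
  proof -
    let ?w = "residual_density P g \<T> z K"
    \<comment> \<open>Only pairs with a nonvanishing residual have a coarse facet assigned to them.\<close>
    define J where "J = {(K',E') \<in> ?J. facet_residual P g \<S> z K' E' \<noteq> 0}"
    have JI: "fst i \<in> I" "snd i \<in> facets (fst i)" if "i \<in> J" for i
      using that by (auto simp: J_def)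
    have "\<forall>i\<in>J. \<exists>E\<in>facets K. snd i \<subseteq> E \<and> ?r (fst i) (snd i) = (LINT x:snd i|surface_measure. ?w E x)"
    proof
      fix i assume i: "i \<in> J"
      then have i': "fst i \<in> I" "snd i \<in> facets (fst i)" "facet_residual P g \<S> z (fst i) (snd i) \<noteq> 0"
        by (auto simp: J_def)
      then have "fst i \<in> \<S>" "elem (fst i) \<subseteq> elem K" using I by auto
      from residual_localizes[OF P n mT mS fin st K this i'(2,3)]
      show "\<exists>E\<in>facets K. snd i \<subseteq> E \<and> ?r (fst i) (snd i) = (LINT x:snd i|surface_measure. ?w E x)" .
    qed
    then obtain \<phi> where \<phi>: "\<And>i. i \<in> J \<Longrightarrow> \<phi> i \<in> facets K" "\<And>i. i \<in> J \<Longrightarrow> snd i \<subseteq> \<phi> i"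
      "\<And>i. i \<in> J \<Longrightarrow> ?r (fst i) (snd i) = (LINT x:snd i|surface_measure. ?w (\<phi> i) x)"
      by metis
    have Jsub: "J \<subseteq> ?J" by (auto simp: J_def)
    then have finJ': "finite J" using finJ finite_subset by blast
    have "(\<Sum>(K',E')\<in>?J. ?r K' E') = (\<Sum>i\<in>J. ?r (fst i) (snd i))"
      by (rule sum.mono_neutral_cong_right[OF finJ Jsub]) (auto simp: J_def)
    also have "\<dots> = (\<Sum>E\<in>facets K. \<Sum>i\<in>{i\<in>J. \<phi> i = E}. ?r (fst i) (snd i))"
      by (rule sum.group[symmetric]) (use \<phi>(1) finJ' in auto)
    also have "\<dots> \<le> (\<Sum>E\<in>facets K. (facet_residual P g \<T> z K E)\<^sup>2)"
    proof (rule sum_mono)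
      fix E assume E: "E \<in> facets K"
      have "(\<Sum>i\<in>{i\<in>J. \<phi> i = E}. ?r (fst i) (snd i)) = (\<Sum>i\<in>{i\<in>J. \<phi> i = E}. LINT x:snd i|surface_measure. ?w E x)"
        using \<phi>(3) by (intro sum.cong) auto
      also have "\<dots> \<le> (LINT x:E|surface_measure. ?w E x)"
      proof (rule sum_integral_almost_disjoint)
        fix i assume i: "i \<in> {i\<in>J. \<phi> i = E}"
        then have "nondegenerate (fst i)" "snd i \<in> facets (fst i)" using JI[of i] I(1) ndS[of "fst i"] by auto
        then show "snd i \<in> sets surface_measure \<and> snd i \<subseteq> E" using \<phi>(2) i facet_surface_sets by blast
      next
        fix i j assume ij: "i \<in> {i\<in>J. \<phi> i = E}" "j \<in> {i\<in>J. \<phi> i = E}" "i \<noteq> j"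
        then have s: "snd i \<subseteq> E" "snd j \<subseteq> E" using \<phi>(2) by blast+
        have i: "fst i \<in> \<S>" "elem (fst i) \<subseteq> elem K" "snd i \<in> facets (fst i)"
          and j: "fst j \<in> \<S>" "elem (fst j) \<subseteq> elem K" "snd j \<in> facets (fst j)"
          using JI[of i] JI[of j] ij I(1) I(2)[of "fst i"] I(2)[of "fst j"] by auto
        show "snd i \<inter> snd j \<in> null_sets surface_measure"
          by (rule subfacets_overlap_null[OF n mS ndT[OF K] E i s(1) j s(2)]) (use ij(3) in \<open>simp add: prod_eq_iff\<close>)
      qed (use finJ' facet_surface_sets[OF ndT[OF K] E] residual_density_integrable[OF P n fg ndT[OF K] E, of \<T> z]
          residual_density_nonneg[of P g \<T> z K E] in auto)
      also have "\<dots> = (facet_residual P g \<T> z K E)\<^sup>2" by (rule facet_residual_sq[OF P ndT[OF K] E, symmetric])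
      finally show "(\<Sum>i\<in>{i\<in>J. \<phi> i = E}. ?r (fst i) (snd i)) \<le> (facet_residual P g \<T> z K E)\<^sup>2" .
    qed
    finally show ?thesis .
  qed
  have qs: "q \<le> sqrt q" using q by (intro real_le_rsqrt) (simp add: power2_eq_square mult_left_le)
  have "(\<Sum>K'\<in>I. eta_sq P f g \<S> z K') \<le> (\<Sum>K'\<in>I. q * vol K * (L2_nrm (lebesgue_on (elem K')) f)\<^sup>2 +
      sqrt (q * vol K) * (\<Sum>E'\<in>facets K'. ?r K' E'))"
    unfolding eta_sq_def using I(2) by (intro sum_mono add_mono mult_right_mono) (auto intro!: sum_nonneg)
  also have "\<dots> = q * vol K * (\<Sum>K'\<in>I. (L2_nrm (lebesgue_on (elem K')) f)\<^sup>2) +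
      sqrt (q * vol K) * (\<Sum>(K',E')\<in>?J. ?r K' E')"
    by (simp add: sum.distrib sum_distrib_left sum.Sigma[OF finI] case_prod_unfold)
  also have "\<dots> \<le> q * vol K * (L2_nrm (lebesgue_on (elem K)) f)\<^sup>2 +
      sqrt (q * vol K) * (\<Sum>E\<in>facets K. (facet_residual P g \<T> z K E)\<^sup>2)"
    using loads jumps q by (intro add_mono mult_left_mono) auto
  also have "\<dots> \<le> sqrt q * vol K * (L2_nrm (lebesgue_on (elem K)) f)\<^sup>2 +
      sqrt (q * vol K) * (\<Sum>E\<in>facets K. (facet_residual P g \<T> z K E)\<^sup>2)"
    using qs by (intro add_mono mult_right_mono) (auto intro!: sum_nonneg)
  also have "\<dots> = sqrt q * eta_sq P f g \<T> z K"
    by (simp add: eta_sq_def real_sqrt_mult algebra_simps)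
  finally show ?thesis .
qed

text \<open>The new elements are grouped by the elements that contain them, which have been refined
  themselves, because elements of the finer mesh do not overlap.\<close>

lemma estimator_refined_sum:
  fixes P :: "('n::finite) plasticity" and \<T> \<S> :: "'n mesh"
  assumes P: "plasticity_setting P" and n: "CARD('n) \<ge> 2" and fg: "loads P f g"
    and mT: "is_mesh (Dom P) \<T>" and mS: "is_mesh (Dom P) \<S>" and d: "descends \<T> \<S>"
    and st: "elementwise_const \<T> (stress P z)"
  shows "(\<Sum>K'\<in>\<S> - \<T>. eta_sq P f g \<S> z K') \<le>
    sqrt (shrink TYPE('n)) * (\<Sum>K\<in>\<T> - \<S>. eta_sq P f g \<T> z K)"
proof -
  let ?q = "shrink TYPE('n)"
  have "\<forall>K'\<in>\<S> - \<T>. \<exists>K\<in>\<T>. elem K' \<subseteq> elem K \<and> vol K' \<le> ?q * vol K"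
    using d by (auto simp: descends_def shrink_def)
  then obtain par where par: "\<And>K'. K' \<in> \<S> - \<T> \<Longrightarrow> par K' \<in> \<T>"
    "\<And>K'. K' \<in> \<S> - \<T> \<Longrightarrow> elem K' \<subseteq> elem (par K') \<and> vol K' \<le> ?q * vol (par K')"
    by metis
  have par': "par K' \<in> \<T> - \<S>" if K': "K' \<in> \<S> - \<T>" for K'
  proof -
    have "par K' \<notin> \<S>"
    proof
      assume "par K' \<in> \<S>"
      then have "par K' = K'"
        using mesh_sub_unique[OF mS, of "par K'" K' K'] is_mesh_nondegenerate[OF mS] par(2)[OF K'] K' by auto
      then show False using par(1)[OF K'] K' by simp
    qed
    then show ?thesis using par(1)[OF K'] by simp
  qed
  have "(\<Sum>K'\<in>\<S> - \<T>. eta_sq P f g \<S> z K') =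
      (\<Sum>K\<in>\<T> - \<S>. \<Sum>K'\<in>{K'\<in>\<S> - \<T>. par K' = K}. eta_sq P f g \<S> z K')"
    by (rule sum.group[symmetric]) (use par' mesh_finite[OF mT] mesh_finite[OF mS] in auto)
  also have "\<dots> \<le> (\<Sum>K\<in>\<T> - \<S>. sqrt ?q * eta_sq P f g \<T> z K)"
  proof (rule sum_mono)
    fix K assume "K \<in> \<T> - \<S>"
    then have "K \<in> \<T>" by simp
    then show "(\<Sum>K'\<in>{K'\<in>\<S> - \<T>. par K' = K}. eta_sq P f g \<S> z K') \<le> sqrt ?q * eta_sq P f g \<T> z K"
      by (rule eta_sq_refined_element[OF P n fg mT mS descends_finer[OF d] st])
        (use par(2) shrink_bounds[where 'n = 'n] in auto)
  qed
  finally show ?thesis by (simp add: sum_distrib_left)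
qed

section \<open>Linear convergence of real sequences\<close>

lemma young_weighted:
  fixes x y \<delta> :: real assumes "\<delta> > 0"
  shows "(x + y)\<^sup>2 \<le> (1 + \<delta>) * x\<^sup>2 + (1 + 1 / \<delta>) * y\<^sup>2"
proof -
  have "0 \<le> (\<delta> * x - y)\<^sup>2 / \<delta>" using assms by simp
  also have "\<dots> = \<delta> * x\<^sup>2 - 2 * x * y + y\<^sup>2 / \<delta>"
    using assms by (simp add: power2_eq_square field_simps)
  finally show ?thesis by (simp add: power2_eq_square algebra_simps)
qed

text \<open>If the first term of each tail dominates a fixed fraction of the tail, dropping it shrinks the
  tail by a fixed factor.\<close>

lemma tail_sums_imp_linear:
  fixes a :: "nat \<Rightarrow> real"
  assumes C: "C > 1" and tail: "\<And>l m. l \<le> m \<Longrightarrow> (\<Sum>k=l..m. (a k)\<^sup>2) \<le> C * (a l)\<^sup>2"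
  shows "(a (l + n))\<^sup>2 \<le> C * (1 - 1 / C) ^ n * (a l)\<^sup>2"
proof -
  define q where "q = 1 - 1 / C"
  have q: "0 \<le> q" using C by (simp add: q_def)
  have "(\<Sum>k=l+j..l+n. (a k)\<^sup>2) \<le> q ^ j * (\<Sum>k=l..l+n. (a k)\<^sup>2)" if "j \<le> n" for j
    using that
  proof (induction j)
    case (Suc j)
    let ?S = "\<lambda>i. \<Sum>k=i..l+n. (a k)\<^sup>2"
    have "?S (l + j) = (a (l + j))\<^sup>2 + ?S (l + Suc j)"
      using Suc.prems by (simp add: sum.atLeast_Suc_atMost)
    moreover have "?S (l + j) / C \<le> (a (l + j))\<^sup>2"
      using tail[of "l + j" "l + n"] Suc.prems C by (simp add: field_simps)
    moreover have "q * ?S (l + j) = ?S (l + j) - ?S (l + j) / C" by (simp add: q_def left_diff_distrib)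
    ultimately have "?S (l + Suc j) \<le> q * ?S (l + j)" by linarith
    also have "\<dots> \<le> q * (q ^ j * ?S l)" using Suc q by (intro mult_left_mono) auto
    finally show ?case by (simp add: mult.assoc)
  qed simp
  from this[of n] have "(a (l + n))\<^sup>2 \<le> q ^ n * (\<Sum>k=l..l+n. (a k)\<^sup>2)" by simp
  also have "\<dots> \<le> q ^ n * (C * (a l)\<^sup>2)" using q tail by (intro mult_left_mono) auto
  finally show ?thesis by (simp add: q_def mult_ac)
qed

text \<open>Squaring the reduction with Young's inequality for the weight \<open>\<kappa> / 2\<close> leaves a contraction with
  factor \<open>1 - \<kappa> / 2\<close> and squares of increments; their sum telescopes in the energy \<open>J\<close>.\<close>

lemma reduction_and_energy_imp_tail_sums:
  fixes a d J :: "nat \<Rightarrow> real"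
  assumes \<kappa>: "0 < \<kappa>" "\<kappa> \<le> 1" and c: "c > 0" "C1 \<ge> 0" and nn: "\<And>k. a k \<ge> 0" "\<And>k. d k \<ge> 0"
    and red: "\<And>k. a (Suc k) \<le> sqrt (1 - \<kappa>) * a k + C1 * d k"
    and inc: "\<And>k. c * (d k)\<^sup>2 \<le> J k - J (Suc k)"
    and gap: "\<And>l m. l \<le> m \<Longrightarrow> J l - J m \<le> E * (a l)\<^sup>2"
    and lm: "l \<le> m"
  shows "(\<Sum>k=l..m. (a k)\<^sup>2) \<le> 2 / \<kappa> * (1 + (1 + 2 / \<kappa>) * C1\<^sup>2 * E / c) * (a l)\<^sup>2"
proof -
  let ?D = "(1 + 2 / \<kappa>) * C1\<^sup>2"
  have D0: "?D \<ge> 0" using \<kappa> by simp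
  have step: "(a (Suc k))\<^sup>2 \<le> (1 - \<kappa> / 2) * (a k)\<^sup>2 + ?D * (d k)\<^sup>2" for k
  proof -
    have "(a (Suc k))\<^sup>2 \<le> (sqrt (1 - \<kappa>) * a k + C1 * d k)\<^sup>2"
      using red nn by (intro power_mono) auto
    also have "\<dots> \<le> (1 + \<kappa> / 2) * (sqrt (1 - \<kappa>) * a k)\<^sup>2 + (1 + 1 / (\<kappa> / 2)) * (C1 * d k)\<^sup>2"
      using \<kappa> by (intro young_weighted) auto
    also have "\<dots> = (1 + \<kappa> / 2) * (1 - \<kappa>) * (a k)\<^sup>2 + ?D * (d k)\<^sup>2"
      using \<kappa> by (simp add: power_mult_distrib)
    also have "(1 + \<kappa> / 2) * (1 - \<kappa>) \<le> 1 - \<kappa> / 2"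
      using \<kappa> by (simp add: algebra_simps)
    finally show ?thesis by (simp add: mult_right_mono)
  qed
  let ?S = "\<Sum>k=l..m. (a k)\<^sup>2"
  have "?S \<le> (a l)\<^sup>2 + (1 - \<kappa> / 2) * (\<Sum>k=l..<m. (a k)\<^sup>2) + ?D / c * (J l - J m)"
    using lm
  proof (induction m rule: dec_induct)
    case (step m)
    have "?D * (d m)\<^sup>2 = ?D / c * (c * (d m)\<^sup>2)" using c by simp
    also have "\<dots> \<le> ?D / c * (J m - J (Suc m))"
      using inc[of m] D0 c by (intro mult_left_mono divide_nonneg_pos) auto
    finally have "(a (Suc m))\<^sup>2 \<le> (1 - \<kappa> / 2) * (a m)\<^sup>2 + ?D / c * (J m - J (Suc m))"
      using \<open>(a (Suc m))\<^sup>2 \<le> _\<close> by linarith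
    moreover have "(\<Sum>k=l..Suc m. (a k)\<^sup>2) = (\<Sum>k=l..m. (a k)\<^sup>2) + (a (Suc m))\<^sup>2"
      "(\<Sum>k=l..<Suc m. (a k)\<^sup>2) = (\<Sum>k=l..<m. (a k)\<^sup>2) + (a m)\<^sup>2" using step by auto
    moreover have "?D / c * (J l - J (Suc m)) = ?D / c * (J l - J m) + ?D / c * (J m - J (Suc m))"
      by (simp only: flip: distrib_left) simp
    ultimately show ?case using step.IH by (simp only: distrib_left)
  qed simp
  also have "\<dots> \<le> (a l)\<^sup>2 + (1 - \<kappa> / 2) * ?S + ?D / c * (E * (a l)\<^sup>2)"
  proof (intro add_mono mult_left_mono)
    show "(\<Sum>k=l..<m. (a k)\<^sup>2) \<le> ?S" by (rule sum_mono2) auto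
    show "J l - J m \<le> E * (a l)\<^sup>2" by (rule gap[OF lm])
  qed (use \<kappa> D0 c in auto)
  finally have "\<kappa> / 2 * ?S \<le> (1 + ?D * E / c) * (a l)\<^sup>2" by (simp add: algebra_simps)
  then have "2 / \<kappa> * (\<kappa> / 2 * ?S) \<le> 2 / \<kappa> * ((1 + ?D * E / c) * (a l)\<^sup>2)"
    using \<kappa> by (intro mult_left_mono) auto
  also have "2 / \<kappa> * (\<kappa> / 2 * ?S) = ?S" using \<kappa> by simp
  finally show ?thesis by (simp only: mult.assoc[of "2 / \<kappa>"])
qed

text \<open>Seen from the last term backwards, the negative powers decay geometrically.\<close>

lemma linear_convergence_power_sum:
  fixes a :: "nat \<Rightarrow> real"
  assumes C: "C > 1" and s: "s > 0" and pos: "\<And>k. k \<le> l \<Longrightarrow> a k > 0"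
    and lin: "\<And>k n. (a (k + n))\<^sup>2 \<le> C * (1 - 1 / C) ^ n * (a k)\<^sup>2"
  defines "r \<equiv> (1 - 1 / C) powr (1 / (2 * s))"
  shows "(\<Sum>k<l. a k powr (- 1 / s)) \<le> C powr (1 / (2 * s)) / (1 - r) * a l powr (- 1 / s)"
proof -
  let ?q = "1 - 1 / C"
  have q: "0 < ?q" "?q < 1" using C by auto
  have r: "0 < r" "r < 1" using q s powr_less_mono2[of "1 / (2 * s)" ?q 1] by (auto simp: r_def)
  let ?c = "C powr (1 / (2 * s))"
  have bound: "a k powr (- 1 / s) \<le> ?c * a l powr (- 1 / s) * r ^ (l - k)" if k: "k < l" for k
  proof -
    have ak: "a k > 0" and al: "a l > 0" using pos k by auto
    have "(a l)\<^sup>2 \<le> C * ?q ^ (l - k) * (a k)\<^sup>2" using lin[of k "l - k"] k by simp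
    then have "((a l)\<^sup>2) powr (1 / (2 * s)) \<le> (C * ?q ^ (l - k) * (a k)\<^sup>2) powr (1 / (2 * s))"
      using s by (intro powr_mono2) auto
    moreover have sq: "(x\<^sup>2) powr (1 / (2 * s)) = x powr (1 / s)" if "x > 0" for x :: real
    proof -
      have "x\<^sup>2 = x powr 2" using that by (simp add: powr_numeral)
      then show ?thesis using s by (simp add: powr_powr)
    qed
    moreover have "(C * ?q ^ (l - k) * (a k)\<^sup>2) powr (1 / (2 * s)) = ?c * r ^ (l - k) * a k powr (1 / s)"
    proof -
      have "(?q ^ (l - k)) powr (1 / (2 * s)) = r ^ (l - k)"
        using q by (simp add: r_def powr_power powr_realpow[symmetric] powr_powr mult.commute)
      then show ?thesis using C q ak by (simp add: powr_mult sq)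
    qed
    ultimately have "a l powr (1 / s) \<le> ?c * r ^ (l - k) * a k powr (1 / s)" using sq[OF al] by simp
    then show ?thesis using ak al by (simp add: powr_minus_divide field_simps)
  qed
  have geo: "(\<Sum>k<l. r ^ (l - k)) \<le> 1 / (1 - r)"
  proof -
    have "(\<Sum>k<l. r ^ (l - k)) = (\<Sum>k<l. r ^ Suc k)"
      by (rule sum.reindex_bij_witness[of _ "\<lambda>k. l - Suc k" "\<lambda>k. l - Suc k"])
        (auto simp: Suc_diff_Suc simp flip: power_Suc)
    also have "\<dots> \<le> (\<Sum>k<l. r ^ k)" using r by (intro sum_mono) (simp add: mult_left_le_one_le)
    also have "\<dots> = (1 - r ^ l) / (1 - r)" using r by (simp add: sum_gp_strict)
    also have "\<dots> \<le> 1 / (1 - r)" using r by (intro divide_right_mono) auto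
    finally show ?thesis .
  qed
  have "(\<Sum>k<l. a k powr (- 1 / s)) \<le> (\<Sum>k<l. ?c * a l powr (- 1 / s) * r ^ (l - k))"
    using bound by (intro sum_mono) auto
  also have "\<dots> = ?c * a l powr (- 1 / s) * (\<Sum>k<l. r ^ (l - k))" by (simp add: sum_distrib_left)
  also have "\<dots> \<le> ?c * a l powr (- 1 / s) * (1 / (1 - r))" by (rule mult_left_mono[OF geo]) simp
  finally show ?thesis by simp
qed

section \<open>Quasi-monotonicity and optimal marking\<close>

lemma stress_dist_self [simp]: "stress_dist P z z = 0"
  by (simp add: stress_dist_def L2_nrm_def)

lemma eta_on_sq: "(eta_on P f g \<T> z \<S>)\<^sup>2 = (\<Sum>K\<in>\<S>. eta_sq P f g \<T> z K)"
  by (simp add: eta_on_def sum_nonneg eta_sq_nonneg)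

lemma eta_on_nonneg [simp]: "0 \<le> eta_on P f g \<T> z \<S>" and eta_nonneg [simp]: "0 \<le> eta P f g \<T> z"
  by (simp_all add: eta_on_def eta_def sum_nonneg eta_sq_nonneg)

text \<open>The data of the discrete problems on all refinements of the initial mesh, with stability and
  discrete reliability of the estimator.\<close>

locale afem =
  fixes P :: "('n::finite) plasticity" and T0 :: "'n mesh" and f g :: "real^'n \<Rightarrow> real^'n"
    and U :: "'n mesh \<Rightarrow> 'n state" and C1 C4 CR Cson :: real
  assumes P: "plasticity_setting P" and n: "CARD('n) \<ge> 2" and H: "elementwise_const T0 (hard_tensor P)"
    and nvb: "nvb_properties (Dom P) T0 Cson" and fg: "loads P f g"
    and sol: "\<And>\<T>. \<T> \<in> refinements T0 \<Longrightarrow> vi_solution P f g (X_disc P \<T>) (U \<T>)"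
    and stability: "\<And>\<T> \<T>' S z z'. \<T> \<in> refinements T0 \<Longrightarrow> \<T>' \<in> refinements \<T> \<Longrightarrow> S \<subseteq> \<T> \<inter> \<T>' \<Longrightarrow>
      z \<in> X_disc P \<T> \<Longrightarrow> z' \<in> X_disc P \<T>' \<Longrightarrow>
      \<bar>eta_on P f g \<T>' z' S - eta_on P f g \<T> z S\<bar> \<le> C1 * stress_dist P z' z"
    and reliability: "\<And>\<T> \<T>'. \<T> \<in> refinements T0 \<Longrightarrow> \<T>' \<in> refinements \<T> \<Longrightarrow>
      \<exists>R. \<T> - \<T>' \<subseteq> R \<and> R \<subseteq> \<T> \<and> real (card R) \<le> CR * real (card (\<T> - \<T>')) \<and>
        (stress_dist P (U \<T>') (U \<T>))\<^sup>2 \<le> C4\<^sup>2 * (\<Sum>K\<in>R. eta_sq P f g \<T> (U \<T>) K)"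
    and C: "C1 > 0" "C4 \<ge> 1" "CR \<ge> 1"
begin

abbreviation \<eta> :: "'n mesh \<Rightarrow> real" where "\<eta> \<T> \<equiv> eta P f g \<T> (U \<T>)"

abbreviation dist_sol :: "'n mesh \<Rightarrow> 'n mesh \<Rightarrow> real" where "dist_sol \<S> \<T> \<equiv> stress_dist P (U \<S>) (U \<T>)"

lemmas nvb_conjuncts =
  nvb[unfolded nvb_properties_def, THEN conjunct1]
  nvb[unfolded nvb_properties_def, THEN conjunct2, THEN conjunct1]
  nvb[unfolded nvb_properties_def, THEN conjunct2, THEN conjunct2, THEN conjunct2, THEN conjunct1]
  nvb[unfolded nvb_properties_def, THEN conjunct2, THEN conjunct2, THEN conjunct2, THEN conjunct2]

lemma mesh: "\<T> \<in> refinements T0 \<Longrightarrow> is_mesh (Dom P) \<T>"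
  by (drule bspec[OF nvb_conjuncts(1)]) (erule conjunct1)

lemma card_refined:
  assumes "\<T> \<in> refinements T0" "\<S> \<in> refinements \<T>"
  shows "card \<T> + card (\<T> - \<S>) \<le> card \<S>"
  by (rule bspec[OF bspec[OF nvb_conjuncts(2) assms(1)] assms(2)])

lemma card_NVB:
  assumes "\<T> \<in> refinements T0" "\<M> \<subseteq> \<T>" "NVB \<T> \<M> = Some \<T>'"
  shows "real (card \<T>') \<le> Cson * real (card \<T>)"
proof -
  have "real (card \<T>') - real (card \<T>) \<le> (Cson - 1) * real (card \<T>)"
    using bspec[OF nvb_conjuncts(3) assms(1)] assms(2,3) by simp
  then show ?thesis by (simp add: algebra_simps)
qed

lemma overlay:
  assumes T: "\<T> \<in> refinements T0" and T1: "\<T>1 \<in> refinements \<T>" and T2: "\<T>2 \<in> refinements \<T>"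
  obtains \<S> where "\<S> \<in> refinements \<T>1" "\<S> \<in> refinements \<T>2" "card \<S> + card \<T> \<le> card \<T>1 + card \<T>2"
proof -
  obtain \<S> where "coarsest_common_refinement \<T>1 \<T>2 \<S>" "card \<S> + card \<T> \<le> card \<T>1 + card \<T>2"
    using bspec[OF bspec[OF bspec[OF nvb_conjuncts(4) T] T1] T2] by (elim exE conjE)
  then show thesis using that unfolding coarsest_common_refinement_def by auto
qed

lemma desc: "\<T> \<in> refinements T0 \<Longrightarrow> \<S> \<in> refinements \<T> \<Longrightarrow> descends \<T> \<S>"
  using refinements_descend[of \<S> \<T>] is_mesh_nondegenerate[OF mesh] by blast

lemma disc:
  assumes T: "\<T> \<in> refinements T0" shows "disc_problem P \<T>"
proof
  show "elementwise_const \<T> (hard_tensor P)"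
    by (rule elementwise_const_finer[OF descends_finer[OF desc[OF refinements.base T]] H])
qed (use P mesh[OF T] n in auto)

lemma U_disc:
  assumes T: "\<T> \<in> refinements T0" and S: "\<S> \<in> refinements \<T>"
  shows "U \<T> \<in> X_disc P \<S>"
  using sol[OF T] X_disc_finer[OF descends_finer[OF desc[OF T S]]] by (auto simp: vi_solution_def)

lemma stress_U:
  assumes T: "\<T> \<in> refinements T0" shows "elementwise_const \<T> (stress P (U \<T>))"
proof -
  interpret disc_problem P \<T> by (rule disc[OF T])
  obtain w p \<alpha> where u: "U \<T> = (w, p, \<alpha>)" by (cases "U \<T>")
  have "w \<in> V_disc P \<T>" "elementwise_const \<T> p"
    using U_disc[OF T refinements.base] by (auto simp: u X_disc_iff)
  then show ?thesis unfolding u by (rule stress_const(1))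
qed

lemma eta_split:
  assumes T: "\<T> \<in> refinements T0" and A: "A \<subseteq> \<T>"
  shows "(eta P f g \<T> z)\<^sup>2 = (\<Sum>K\<in>A. eta_sq P f g \<T> z K) + (\<Sum>K\<in>\<T> - A. eta_sq P f g \<T> z K)"
  using sum.subset_diff[OF A mesh_finite[OF mesh[OF T]]]
  by (simp add: eta_def eta_on_sq add.commute)

text \<open>Stability for one and the same function on both meshes shows that the contributions of the common
  elements are equal.\<close>

lemma refined_estimator:
  assumes T: "\<T> \<in> refinements T0" and S: "\<S> \<in> refinements \<T>"
  shows "(eta P f g \<S> (U \<T>))\<^sup>2 \<le>
    (\<eta> \<T>)\<^sup>2 - (1 - sqrt (shrink TYPE('n))) * (\<Sum>K\<in>\<T> - \<S>. eta_sq P f g \<T> (U \<T>) K)"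
proof -
  have S0: "\<S> \<in> refinements T0" by (rule refinements_trans[OF S T])
  have UT: "U \<T> \<in> X_disc P \<T>" by (rule U_disc[OF T refinements.base])
  have "eta_on P f g \<S> (U \<T>) (\<T> \<inter> \<S>) = eta_on P f g \<T> (U \<T>) (\<T> \<inter> \<S>)"
    using stability[OF T S subset_refl UT U_disc[OF T S]] by simp
  then have same: "(\<Sum>K\<in>\<T> \<inter> \<S>. eta_sq P f g \<S> (U \<T>) K) = (\<Sum>K\<in>\<T> \<inter> \<S>. eta_sq P f g \<T> (U \<T>) K)"
    by (metis eta_on_sq)
  have new: "(\<Sum>K\<in>\<S> - \<T>. eta_sq P f g \<S> (U \<T>) K) \<le>
      sqrt (shrink TYPE('n)) * (\<Sum>K\<in>\<T> - \<S>. eta_sq P f g \<T> (U \<T>) K)"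
    by (rule estimator_refined_sum[OF P n fg mesh[OF T] mesh[OF S0] desc[OF T S] stress_U[OF T]])
  have d: "\<S> - \<T> \<inter> \<S> = \<S> - \<T>" "\<T> - \<T> \<inter> \<S> = \<T> - \<S>" by auto
  have 1: "(eta P f g \<S> (U \<T>))\<^sup>2 = (\<Sum>K\<in>\<T> \<inter> \<S>. eta_sq P f g \<S> (U \<T>) K) + (\<Sum>K\<in>\<S> - \<T>. eta_sq P f g \<S> (U \<T>) K)"
    using eta_split[OF S0, of "\<T> \<inter> \<S>" "U \<T>"] unfolding d by simp
  have 2: "(\<eta> \<T>)\<^sup>2 = (\<Sum>K\<in>\<T> \<inter> \<S>. eta_sq P f g \<T> (U \<T>) K) + (\<Sum>K\<in>\<T> - \<S>. eta_sq P f g \<T> (U \<T>) K)"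
    using eta_split[OF T, of "\<T> \<inter> \<S>" "U \<T>"] unfolding d by simp
  show ?thesis unfolding 1 2 same using new by (simp add: algebra_simps)
qed

lemma estimator_stability:
  assumes T: "\<T> \<in> refinements T0" and S: "\<S> \<in> refinements \<T>"
  shows "\<eta> \<S> \<le> eta P f g \<S> (U \<T>) + C1 * dist_sol \<S> \<T>"
proof -
  have S0: "\<S> \<in> refinements T0" by (rule refinements_trans[OF S T])
  have "\<bar>eta_on P f g \<S> (U \<S>) \<S> - eta_on P f g \<S> (U \<T>) \<S>\<bar> \<le> C1 * dist_sol \<S> \<T>"
    by (rule stability[OF S0 refinements.base _ U_disc[OF T S] U_disc[OF S0 refinements.base]]) simp
  then show ?thesis by (simp add: eta_def)
qed

lemma dist_le_estimator:
  assumes T: "\<T> \<in> refinements T0" and S: "\<S> \<in> refinements \<T>"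
  shows "dist_sol \<S> \<T> \<le> C4 * \<eta> \<T>"
proof -
  obtain R where R: "R \<subseteq> \<T>" "(dist_sol \<S> \<T>)\<^sup>2 \<le> C4\<^sup>2 * (\<Sum>K\<in>R. eta_sq P f g \<T> (U \<T>) K)"
    using reliability[OF T S] by blast
  have "(\<Sum>K\<in>R. eta_sq P f g \<T> (U \<T>) K) \<le> (\<eta> \<T>)\<^sup>2"
    using eta_split[OF T R(1), of "U \<T>"] by (simp add: sum_nonneg eta_sq_nonneg)
  then have "C4\<^sup>2 * (\<Sum>K\<in>R. eta_sq P f g \<T> (U \<T>) K) \<le> C4\<^sup>2 * (\<eta> \<T>)\<^sup>2" by (intro mult_left_mono) auto
  with R(2) have "(dist_sol \<S> \<T>)\<^sup>2 \<le> (C4 * \<eta> \<T>)\<^sup>2" by (simp add: power_mult_distrib)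
  then show ?thesis by (rule power2_le_imp_le) (use C in simp)
qed

lemma quasi_monotone:
  assumes T: "\<T> \<in> refinements T0" and S: "\<S> \<in> refinements \<T>"
  shows "\<eta> \<S> \<le> (1 + C1 * C4) * \<eta> \<T>"
proof -
  have "0 \<le> (1 - sqrt (shrink TYPE('n))) * (\<Sum>K\<in>\<T> - \<S>. eta_sq P f g \<T> (U \<T>) K)"
    using shrink_bounds[where 'n='n] by (intro mult_nonneg_nonneg sum_nonneg) (auto simp: eta_sq_nonneg)
  then have "(eta P f g \<S> (U \<T>))\<^sup>2 \<le> (\<eta> \<T>)\<^sup>2" using refined_estimator[OF T S] by linarith
  then have "eta P f g \<S> (U \<T>) \<le> \<eta> \<T>" by (rule power2_le_imp_le) simp
  moreover have "C1 * dist_sol \<S> \<T> \<le> C1 * (C4 * \<eta> \<T>)"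
    using dist_le_estimator[OF T S] C by (intro mult_left_mono) auto
  ultimately show ?thesis using estimator_stability[OF T S] by (simp add: algebra_simps)
qed

text \<open>On common elements the estimator changes at most by the stress distance, which discrete
  reliability bounds by the estimator on \<open>R\<close>.  So a substantial drop forces a large share of the
  estimator to be located on \<open>R\<close>.\<close>

lemma bulk_optimal:
  assumes T: "\<T> \<in> refinements T0" and S: "\<S> \<in> refinements \<T>"
    and \<delta>: "\<delta> > 0" and small: "(\<eta> \<S>)\<^sup>2 \<le> \<kappa>0 * (\<eta> \<T>)\<^sup>2"
    and \<theta>: "\<theta> * (1 + (1 + \<delta>) * (C1\<^sup>2 * C4\<^sup>2)) \<le> 1 - (1 + 1 / \<delta>) * \<kappa>0"
  shows "\<exists>R. bulk P f g \<theta> \<T> (U \<T>) R \<and> real (card R) \<le> CR * real (card (\<T> - \<S>))"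
proof -
  have S0: "\<S> \<in> refinements T0" by (rule refinements_trans[OF S T])
  obtain R where R: "\<T> - \<S> \<subseteq> R" "R \<subseteq> \<T>" "real (card R) \<le> CR * real (card (\<T> - \<S>))"
    "(dist_sol \<S> \<T>)\<^sup>2 \<le> C4\<^sup>2 * (\<Sum>K\<in>R. eta_sq P f g \<T> (U \<T>) K)"
    using reliability[OF T S] by blast
  let ?r = "\<Sum>K\<in>R. eta_sq P f g \<T> (U \<T>) K" and ?D = "dist_sol \<S> \<T>"
  have finT: "finite \<T>" "finite \<S>" using mesh_finite mesh T S0 by blast+
  have r0: "0 \<le> ?r" by (simp add: sum_nonneg eta_sq_nonneg)
  have "eta_on P f g \<T> (U \<T>) (\<T> \<inter> \<S>) \<le> eta_on P f g \<S> (U \<S>) (\<T> \<inter> \<S>) + C1 * ?D"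
    using stability[OF T S subset_refl U_disc[OF T refinements.base] U_disc[OF S0 refinements.base]] by linarith
  also have "eta_on P f g \<S> (U \<S>) (\<T> \<inter> \<S>) \<le> \<eta> \<S>"
    unfolding eta_def eta_on_def using finT by (intro real_sqrt_le_mono sum_mono2) (auto simp: eta_sq_nonneg)
  finally have "(eta_on P f g \<T> (U \<T>) (\<T> \<inter> \<S>))\<^sup>2 \<le> (C1 * ?D + \<eta> \<S>)\<^sup>2"
    by (intro power_mono) auto
  also have "\<dots> \<le> (1 + \<delta>) * (C1 * ?D)\<^sup>2 + (1 + 1 / \<delta>) * (\<eta> \<S>)\<^sup>2" by (rule young_weighted[OF \<delta>])
  also have "\<dots> \<le> (1 + \<delta>) * (C1\<^sup>2 * (C4\<^sup>2 * ?r)) + (1 + 1 / \<delta>) * (\<kappa>0 * (\<eta> \<T>)\<^sup>2)"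
    unfolding power_mult_distrib using R(4) small \<delta> by (intro add_mono mult_left_mono) auto
  finally have i: "(\<Sum>K\<in>\<T> \<inter> \<S>. eta_sq P f g \<T> (U \<T>) K) \<le>
      (1 + \<delta>) * (C1\<^sup>2 * (C4\<^sup>2 * ?r)) + (1 + 1 / \<delta>) * (\<kappa>0 * (\<eta> \<T>)\<^sup>2)" by (simp only: eta_on_sq)
  have "(\<Sum>K\<in>\<T> - \<S>. eta_sq P f g \<T> (U \<T>) K) \<le> ?r"
    using R(1,2) finT finite_subset by (intro sum_mono2) (auto simp: eta_sq_nonneg)
  moreover have "(\<eta> \<T>)\<^sup>2 = (\<Sum>K\<in>\<T> \<inter> \<S>. eta_sq P f g \<T> (U \<T>) K) + (\<Sum>K\<in>\<T> - \<S>. eta_sq P f g \<T> (U \<T>) K)"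
    using eta_split[OF T, of "\<T> \<inter> \<S>" "U \<T>"] by (simp add: Diff_Int)
  ultimately have "(1 - (1 + 1 / \<delta>) * \<kappa>0) * (\<eta> \<T>)\<^sup>2 \<le> (1 + (1 + \<delta>) * (C1\<^sup>2 * C4\<^sup>2)) * ?r"
    using i by (simp add: algebra_simps)
  moreover have "\<theta> * (1 + (1 + \<delta>) * (C1\<^sup>2 * C4\<^sup>2)) * (\<eta> \<T>)\<^sup>2 \<le> (1 - (1 + 1 / \<delta>) * \<kappa>0) * (\<eta> \<T>)\<^sup>2"
    using \<theta> by (rule mult_right_mono) simp
  ultimately have "(1 + (1 + \<delta>) * (C1\<^sup>2 * C4\<^sup>2)) * (\<theta> * (\<eta> \<T>)\<^sup>2) \<le> (1 + (1 + \<delta>) * (C1\<^sup>2 * C4\<^sup>2)) * ?r"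
    by (simp only: mult_ac)
  moreover have "1 + (1 + \<delta>) * (C1\<^sup>2 * C4\<^sup>2) > 0" using \<delta> by (intro add_pos_nonneg) auto
  ultimately have "\<theta> * (\<eta> \<T>)\<^sup>2 \<le> ?r" by (simp only: mult_le_cancel_left_pos)
  then show ?thesis using R by (auto simp: bulk_def)
qed

text \<open>A strict bound avoids the question whether the infimum in the approximation norm is attained.\<close>

lemma approximant:
  assumes b: "approx_norm P f g T0 U s < ennreal b"
  obtains \<T> where "\<T> \<in> refinements T0" "card \<T> \<le> card T0 + N" "(real N + 1) powr s * \<eta> \<T> < b"
proof -
  have "(INF \<T>\<in>refinements_upto T0 N. ennreal ((real N + 1) powr s * \<eta> \<T>)) \<le> approx_norm P f g T0 U s"
    unfolding approx_norm_def by (rule SUP_upper) simp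
  also note b
  finally obtain \<T> where "\<T> \<in> refinements_upto T0 N" "ennreal ((real N + 1) powr s * \<eta> \<T>) < ennreal b"
    by (auto simp: INF_less_iff)
  then show thesis using that by (auto simp: refinements_upto_def ennreal_less_iff)
qed

text \<open>The competitor is the overlay of the current mesh with a mesh of at most \<open>N\<close> additional elements
  whose estimator is below \<open>\<mu>\<close> times the current one.  The approximation norm says how large \<open>N\<close> has
  to be, and the overlay adds at most \<open>N\<close> elements to the current mesh.\<close>

lemma marked_card:
  assumes T: "\<T> \<in> refinements T0" and pos: "\<eta> \<T> > 0" and s: "s > 0"
    and b: "approx_norm P f g T0 U s < ennreal b" "b > 0"
    and \<delta>: "\<delta> > 0" and \<theta>: "\<theta> * (1 + (1 + \<delta>) * (C1\<^sup>2 * C4\<^sup>2)) \<le> 1 - (1 + 1 / \<delta>) * \<kappa>0"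
    and \<mu>: "\<mu> > 0" "((1 + C1 * C4) * \<mu>)\<^sup>2 \<le> \<kappa>0"
    and min: "\<And>\<M>'. bulk P f g \<theta> \<T> (U \<T>) \<M>' \<Longrightarrow> card \<M> \<le> card \<M>'"
  shows "real (card \<M>) \<le> CR * (b / (\<mu> * \<eta> \<T>)) powr (1 / s)"
proof -
  define x where "x = (b / (\<mu> * \<eta> \<T>)) powr (1 / s)"
  \<comment> \<open>The largest \<open>N\<close> that the claimed bound allows; since \<open>N + 1\<close> is at least \<open>x\<close>, its power reaches the required accuracy.\<close>
  define N where "N = nat \<lfloor>x\<rfloor>"
  have x0: "0 \<le> x" by (simp add: x_def)
  have N: "real N \<le> x" "x \<le> real N + 1" using x0 by (auto simp: N_def)
  have pos': "0 < b / (\<mu> * \<eta> \<T>)" using b pos \<mu> by simp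
  obtain \<T>' where T': "\<T>' \<in> refinements T0" "card \<T>' \<le> card T0 + N" "(real N + 1) powr s * \<eta> \<T>' < b"
    using approximant[OF b(1)] by blast
  have "b / (\<mu> * \<eta> \<T>) = x powr s" using s b(2) pos \<mu>(1) by (simp add: x_def powr_powr abs_mult)
  also have "\<dots> \<le> (real N + 1) powr s" using N x0 s by (intro powr_mono2) auto
  finally have "b / (\<mu> * \<eta> \<T>) * \<eta> \<T>' \<le> (real N + 1) powr s * \<eta> \<T>'" by (intro mult_right_mono) auto
  then have "b / (\<mu> * \<eta> \<T>) * \<eta> \<T>' < b * 1" using T'(3) by linarith
  then have "b * (\<eta> \<T>' / (\<mu> * \<eta> \<T>)) < b * 1" by simp
  then have "\<eta> \<T>' / (\<mu> * \<eta> \<T>) < 1" using b(2) by (simp only: mult_less_cancel_left_pos)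
  then have eps: "\<eta> \<T>' < \<mu> * \<eta> \<T>" using \<mu> pos by simp
  obtain \<S> where S: "\<S> \<in> refinements \<T>" "\<S> \<in> refinements \<T>'" "card \<S> + card T0 \<le> card \<T> + card \<T>'"
    using overlay[OF refinements.base T T'(1)] by blast
  have "\<eta> \<S> \<le> (1 + C1 * C4) * \<eta> \<T>'" by (rule quasi_monotone[OF T'(1) S(2)])
  also have "\<dots> \<le> (1 + C1 * C4) * (\<mu> * \<eta> \<T>)" using eps C by (intro mult_left_mono) auto
  finally have "(\<eta> \<S>)\<^sup>2 \<le> ((1 + C1 * C4) * \<mu> * \<eta> \<T>)\<^sup>2" by (intro power_mono) (auto simp: mult.assoc)
  also have "\<dots> \<le> \<kappa>0 * (\<eta> \<T>)\<^sup>2" using \<mu>(2) by (simp add: power_mult_distrib mult_right_mono)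
  finally have small: "(\<eta> \<S>)\<^sup>2 \<le> \<kappa>0 * (\<eta> \<T>)\<^sup>2" .
  obtain R where R: "bulk P f g \<theta> \<T> (U \<T>) R" "real (card R) \<le> CR * real (card (\<T> - \<S>))"
    using bulk_optimal[OF T S(1) \<delta> small \<theta>] by blast
  have "card (\<T> - \<S>) \<le> N" using card_refined[OF T S(1)] S(3) T'(2) by linarith
  then have "real (card (\<T> - \<S>)) \<le> x" using N(1) by linarith
  have "real (card \<M>) \<le> real (card R)" using min[OF R(1)] by simp
  also note R(2)
  also have "CR * real (card (\<T> - \<S>)) \<le> CR * x"
    using \<open>real (card (\<T> - \<S>)) \<le> x\<close> C by (intro mult_left_mono) auto
  finally show ?thesis by (simp add: x_def)
qed

text \<open>For \<open>N = 0\<close> the only competitor is the initial mesh.\<close>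

lemma estimator_initial_less:
  assumes b: "approx_norm P f g T0 U s < ennreal b"
  shows "\<eta> T0 < b"
proof -
  obtain \<T> where T: "\<T> \<in> refinements T0" "card \<T> \<le> card T0 + 0" "(real 0 + 1) powr s * \<eta> \<T> < b"
    by (rule approximant[OF b])
  note fin = mesh_finite[OF mesh[OF T(1)]] mesh_finite[OF mesh[OF refinements.base]]
  have "card (T0 - \<T>) = 0" using card_refined[OF refinements.base T(1)] T(2) by linarith
  then have "T0 \<subseteq> \<T>" using fin by auto
  then have "T0 = \<T>" using T(2) fin by (intro card_seteq) auto
  then show ?thesis using T(3) by simp
qed

end

section \<open>Rates along the adaptive sequence\<close>

text \<open>The constants \<open>c\<close> and \<open>E\<close> are those of the energy gap.  They are parameters, since they must not
  depend on the loads.\<close>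

locale afem_sequence = afem P T0 f g U C1 C4 CR Cson
  for P :: "('n::finite) plasticity" and T0 f g U C1 C4 CR Cson +
  fixes \<T> \<M> :: "nat \<Rightarrow> 'n mesh" and \<theta> c E :: real
  assumes \<theta>: "0 < \<theta>" "\<theta> \<le> 1" and seq: "adaptive_sequence P f g \<theta> T0 U \<T> \<M>"
    and c: "c > 0" "E \<ge> 0"
    and gap: "\<And>T S. T \<in> refinements T0 \<Longrightarrow> S \<in> refinements T \<Longrightarrow>
      c * (stress_dist P (U S) (U T))\<^sup>2 \<le> energy P f g (U T) - energy P f g (U S) \<and>
      energy P f g (U T) - energy P f g (U S) \<le> E * (stress_dist P (U S) (U T))\<^sup>2"
begin

lemma seq0: "\<T> 0 = T0" and marking: "bulk P f g \<theta> (\<T> l) (U (\<T> l)) (\<M> l)"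
  and marking_min: "bulk P f g \<theta> (\<T> l) (U (\<T> l)) \<M>' \<Longrightarrow> card (\<M> l) \<le> card \<M>'"
  and refine: "NVB (\<T> l) (\<M> l) = Some (\<T> (Suc l))"
  using seq by (auto simp: adaptive_sequence_def)

lemma marked_sub: "\<M> l \<subseteq> \<T> l"
  using marking[of l] by (simp add: bulk_def)

lemma seq_refines: "l \<le> m \<Longrightarrow> \<T> m \<in> refinements (\<T> l)"
  by (induction m rule: dec_induct) (auto intro: refinements.base refinements.step[OF _ marked_sub refine])

lemma seq_in: "\<T> l \<in> refinements T0"
  using seq_refines[of 0 l] by (simp add: seq0)

lemma marked_refined: "\<M> l \<subseteq> \<T> l - \<T> (Suc l)"
  using NVB_refines_marked[OF mesh[OF seq_in] marked_sub refine] marked_sub by blast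

definition \<kappa> :: real where "\<kappa> = (1 - sqrt (shrink TYPE('n))) * \<theta>"

lemma \<kappa>: "0 < \<kappa>" "\<kappa> \<le> 1"
proof -
  have r: "0 \<le> sqrt (shrink TYPE('n))" "sqrt (shrink TYPE('n)) < 1" using shrink_bounds[where 'n='n] by auto
  then show "0 < \<kappa>" using \<theta> by (simp add: \<kappa>_def)
  have "(1 - sqrt (shrink TYPE('n))) * \<theta> \<le> 1 * 1" using r \<theta> by (intro mult_mono) auto
  then show "\<kappa> \<le> 1" by (simp add: \<kappa>_def)
qed

text \<open>Marked elements are refined, so the bulk criterion bounds the reduction from below.\<close>

lemma estimator_step: "\<eta> (\<T> (Suc k)) \<le> sqrt (1 - \<kappa>) * \<eta> (\<T> k) + C1 * dist_sol (\<T> (Suc k)) (\<T> k)"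
proof -
  have S: "\<T> (Suc k) \<in> refinements (\<T> k)" by (rule seq_refines) simp
  have "finite (\<T> k)" by (rule mesh_finite[OF mesh[OF seq_in]])
  have "\<theta> * (\<eta> (\<T> k))\<^sup>2 \<le> (\<Sum>K\<in>\<M> k. eta_sq P f g (\<T> k) (U (\<T> k)) K)"
    using marking[of k] by (simp add: bulk_def)
  also have "\<dots> \<le> (\<Sum>K\<in>\<T> k - \<T> (Suc k). eta_sq P f g (\<T> k) (U (\<T> k)) K)"
    using marked_refined \<open>finite (\<T> k)\<close> by (intro sum_mono2) (auto simp: eta_sq_nonneg)
  finally have "(1 - sqrt (shrink TYPE('n))) * (\<theta> * (\<eta> (\<T> k))\<^sup>2) \<le>
      (1 - sqrt (shrink TYPE('n))) * (\<Sum>K\<in>\<T> k - \<T> (Suc k). eta_sq P f g (\<T> k) (U (\<T> k)) K)"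
    using shrink_bounds[where 'n='n] by (intro mult_left_mono) auto
  then have "(eta P f g (\<T> (Suc k)) (U (\<T> k)))\<^sup>2 \<le> (1 - \<kappa>) * (\<eta> (\<T> k))\<^sup>2"
    using refined_estimator[OF seq_in S] by (simp add: \<kappa>_def algebra_simps)
  also have "\<dots> = (sqrt (1 - \<kappa>) * \<eta> (\<T> k))\<^sup>2" using \<kappa> by (simp add: power_mult_distrib)
  finally have "eta P f g (\<T> (Suc k)) (U (\<T> k)) \<le> sqrt (1 - \<kappa>) * \<eta> (\<T> k)"
    by (rule power2_le_imp_le) (use \<kappa> in simp)
  then show ?thesis using estimator_stability[OF seq_in S] by linarith
qed

definition Clin :: real where
  "Clin = 2 / \<kappa> * (1 + (1 + 2 / \<kappa>) * C1\<^sup>2 * (E * C4\<^sup>2) / c)"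

lemma Clin: "Clin > 1"
proof -
  have "2 / \<kappa> \<ge> 2" using \<kappa> by (simp add: field_simps)
  moreover have "0 \<le> (1 + 2 / \<kappa>) * C1\<^sup>2 * (E * C4\<^sup>2) / c" using \<kappa> c by simp
  ultimately have "2 * 1 \<le> Clin" unfolding Clin_def using \<kappa> by (intro mult_mono) auto
  then show ?thesis by simp
qed

text \<open>Energy gaps bound the squared increments by differences that telescope, and discrete reliability
  bounds the total gap by the estimator.\<close>

lemma linear_convergence: "(\<eta> (\<T> (l + n)))\<^sup>2 \<le> Clin * (1 - 1 / Clin) ^ n * (\<eta> (\<T> l))\<^sup>2"
proof (rule tail_sums_imp_linear[OF Clin])
  fix l m :: nat assume "l \<le> m"
  then show "(\<Sum>k=l..m. (\<eta> (\<T> k))\<^sup>2) \<le> Clin * (\<eta> (\<T> l))\<^sup>2"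
    unfolding Clin_def
  proof (rule reduction_and_energy_imp_tail_sums[where a = "\<lambda>k. \<eta> (\<T> k)" and
        d = "\<lambda>k. dist_sol (\<T> (Suc k)) (\<T> k)" and J = "\<lambda>k. energy P f g (U (\<T> k))",
        OF \<kappa> c(1) _ _ _ estimator_step, rotated -1])
    show "c * (dist_sol (\<T> (Suc k)) (\<T> k))\<^sup>2 \<le> energy P f g (U (\<T> k)) - energy P f g (U (\<T> (Suc k)))" for k
      using gap[OF seq_in seq_refines[of k "Suc k"]] by simp
    show "energy P f g (U (\<T> l)) - energy P f g (U (\<T> m)) \<le> E * C4\<^sup>2 * (\<eta> (\<T> l))\<^sup>2" if "l \<le> m" for l m
    proof -
      have "(dist_sol (\<T> m) (\<T> l))\<^sup>2 \<le> (C4 * \<eta> (\<T> l))\<^sup>2"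
        using dist_le_estimator[OF seq_in seq_refines[OF that]]
        by (intro power_mono) (auto simp: stress_dist_def L2_nrm_def)
      then have "E * (dist_sol (\<T> m) (\<T> l))\<^sup>2 \<le> E * (C4 * \<eta> (\<T> l))\<^sup>2" using c by (intro mult_left_mono)
      then show ?thesis using gap[OF seq_in seq_refines[OF that]] by (simp add: power_mult_distrib mult.assoc)
    qed
  qed (use C in \<open>auto simp: stress_dist_def L2_nrm_def\<close>)
qed

text \<open>Stated for every real bound \<open>b\<close> that exceeds the approximation norm, so that the norm may vanish.
  The second summand of \<open>W\<close> pays for the \<open>1\<close> in the element count.\<close>

lemma alg_le_apx:
  fixes s b \<mu> \<delta> \<kappa>0 Cmesh :: real
  assumes s: "s > 0" and b: "approx_norm P f g T0 U s < ennreal b" "b > 0"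
    and \<delta>: "\<delta> > 0" "\<theta> * (1 + (1 + \<delta>) * (C1\<^sup>2 * C4\<^sup>2)) \<le> 1 - (1 + 1 / \<delta>) * \<kappa>0"
    and \<mu>: "\<mu> > 0" "((1 + C1 * C4) * \<mu>)\<^sup>2 \<le> \<kappa>0"
    and Cm: "Cmesh > 0" "real (card (\<T> l)) - real (card T0) \<le> Cmesh * (\<Sum>k<l. real (card (\<M> k)))"
  defines "W \<equiv> Cmesh * CR * (1 / \<mu>) powr (1 / s) *
      (Clin powr (1 / (2 * s)) / (1 - (1 - 1 / Clin) powr (1 / (2 * s)))) + (1 + C1 * C4) powr (1 / s)"
  shows "\<eta> (\<T> l) * (real (card (\<T> l)) - real (card T0) + 1) powr s \<le> W powr s * b"
proof (cases "\<eta> (\<T> l) = 0")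
  case False
  then have al: "\<eta> (\<T> l) > 0" using eta_nonneg[of P f g "\<T> l" "U (\<T> l)"] by linarith
  have ak: "\<eta> (\<T> k) > 0" if "k \<le> l" for k
  proof (rule ccontr)
    assume "\<not> \<eta> (\<T> k) > 0"
    then have "\<eta> (\<T> k) = 0" using eta_nonneg[of P f g "\<T> k" "U (\<T> k)"] by linarith
    then show False using quasi_monotone[OF seq_in seq_refines[OF that]] al by simp
  qed
  let ?a = "\<lambda>k. \<eta> (\<T> k)" and ?S = "Clin powr (1 / (2 * s)) / (1 - (1 - 1 / Clin) powr (1 / (2 * s)))"
  let ?m = "real (card (\<T> l)) - real (card T0)"
  have m0: "0 \<le> ?m" using card_refined[OF refinements.base seq_in[of l]] by linarith
  have split: "(b / (\<mu> * x)) powr (1 / s) = b powr (1 / s) * (1 / \<mu>) powr (1 / s) * x powr (- 1 / s)" if "x > 0" for x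
    using b(2) \<mu>(1) that by (simp add: powr_divide powr_mult powr_minus_divide)
  \<comment> \<open>The number of new elements is bounded by the marked ones, and these by \<open>marked_card\<close>.\<close>
  have "?m \<le> Cmesh * (\<Sum>k<l. CR * (b powr (1 / s) * (1 / \<mu>) powr (1 / s) * ?a k powr (- 1 / s)))"
  proof (rule order_trans[OF Cm(2)], intro mult_left_mono sum_mono)
    fix k assume "k \<in> {..<l}"
    then have k: "?a k > 0" using ak by simp
    show "real (card (\<M> k)) \<le> CR * (b powr (1 / s) * (1 / \<mu>) powr (1 / s) * ?a k powr (- 1 / s))"
      using marked_card[OF seq_in k s b \<delta> \<mu> marking_min] unfolding split[OF k] .
  qed (use Cm in simp)
  also have "\<dots> = Cmesh * CR * (1 / \<mu>) powr (1 / s) * b powr (1 / s) * (\<Sum>k<l. ?a k powr (- 1 / s))"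
    by (simp add: sum_distrib_left mult_ac)
  also have "\<dots> \<le> Cmesh * CR * (1 / \<mu>) powr (1 / s) * b powr (1 / s) * (?S * ?a l powr (- 1 / s))"
  proof (rule mult_left_mono)
    show "(\<Sum>k<l. ?a k powr (- 1 / s)) \<le> ?S * ?a l powr (- 1 / s)"
      by (rule linear_convergence_power_sum[OF Clin s ak linear_convergence])
  qed (use Cm C in simp)
  finally have 1: "?m \<le> Cmesh * CR * (1 / \<mu>) powr (1 / s) * ?S * (b powr (1 / s) * ?a l powr (- 1 / s))"
    by (simp add: mult_ac)
  have "?a l \<le> (1 + C1 * C4) * \<eta> T0" using quasi_monotone[OF refinements.base seq_in] .
  also have "\<dots> \<le> (1 + C1 * C4) * b" using estimator_initial_less[OF b(1)] C by (intro mult_left_mono) auto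
  finally have "1 \<le> (1 + C1 * C4) * b / ?a l" using al by simp
  then have "1 powr (1 / s) \<le> ((1 + C1 * C4) * b / ?a l) powr (1 / s)" using s by (intro powr_mono2) auto
  also have "\<dots> = (1 + C1 * C4) powr (1 / s) * (b powr (1 / s) * ?a l powr (- 1 / s))"
    using b(2) al C by (simp add: powr_divide powr_mult powr_minus_divide)
  finally have 2: "1 \<le> (1 + C1 * C4) powr (1 / s) * (b powr (1 / s) * ?a l powr (- 1 / s))" by simp
  have W0: "W \<ge> 0"
  proof -
    have "(1 - 1 / Clin) powr (1 / (2 * s)) \<le> 1 powr (1 / (2 * s))"
      using Clin s by (intro powr_mono2) (auto simp: field_simps)
    then show ?thesis unfolding W_def using Cm C by (intro add_nonneg_nonneg mult_nonneg_nonneg divide_nonneg_nonneg) auto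
  qed
  have "?m + 1 \<le> W * (b powr (1 / s) * ?a l powr (- 1 / s))"
    using 1 2 unfolding W_def by (simp only: distrib_right)
  then have "(?m + 1) powr s \<le> (W * (b powr (1 / s) * ?a l powr (- 1 / s))) powr s"
    using m0 s by (intro powr_mono2) auto
  also have "\<dots> = W powr s * (b / ?a l)"
    using W0 b(2) al s by (simp add: powr_mult powr_divide powr_powr powr_minus_divide)
  finally have "?a l * (?m + 1) powr s \<le> ?a l * (W powr s * (b / ?a l))" using al by (intro mult_left_mono) auto
  then show ?thesis using al by simp
qed (use b in simp)

text \<open>Given \<open>N\<close>, the competitor is the last adaptive mesh before more than \<open>N\<close> elements have been
  added; one step multiplies the number of elements by at most \<open>Cson\<close>.  If the number stays below this
  bound, then nothing is marked at some step, and the estimator has vanished.\<close>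

lemma apx_le_alg:
  assumes s: "s > 0" and Cson: "Cson > 0"
  defines "C' \<equiv> (Cson * real (card T0)) powr s"
  shows "approx_norm P f g T0 U s \<le> ennreal C' * (SUP l. ennreal (\<eta> (\<T> l) *
    (real (card (\<T> l)) - real (card T0) + 1) powr s))"
    (is "_ \<le> ennreal C' * ?alg")
  unfolding approx_norm_def
proof (rule SUP_least)
  fix N
  have T0: "real (card T0) \<ge> 1"
    using is_mesh_nonempty[OF GamN_props(4)[OF P] mesh[OF refinements.base]] mesh_finite[OF mesh[OF refinements.base]]
    by (simp add: Suc_le_eq card_gt_0_iff)
  have le: "(INF T\<in>refinements_upto T0 N. ennreal ((real N + 1) powr s * \<eta> T)) \<le> ennreal ((real N + 1) powr s * \<eta> (\<T> l))"
    if "card (\<T> l) \<le> card T0 + N" for l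
    using that seq_in by (intro INF_lower) (simp add: refinements_upto_def)
  have mono: "real (card (\<T> l)) \<ge> real (card T0)" for l
    using card_refined[OF refinements.base seq_in[of l]] by linarith
  show "(INF T\<in>refinements_upto T0 N. ennreal ((real N + 1) powr s * \<eta> T)) \<le> ennreal C' * ?alg"
  proof (cases "\<exists>l. card (\<T> l) > card T0 + N")
    case True
    define l where "l = (LEAST l. card (\<T> l) > card T0 + N)"
    have l: "card (\<T> l) > card T0 + N" unfolding l_def by (rule LeastI_ex[OF True])
    have "l \<noteq> 0" using l seq0 by (metis le_add1 not_le)
    then obtain k where k: "l = Suc k" by (cases l) auto
    have "\<not> card (\<T> k) > card T0 + N" using not_less_Least[of k "\<lambda>l. card (\<T> l) > card T0 + N"] k by (simp add: l_def)
    then have kN: "card (\<T> k) \<le> card T0 + N" by simp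
    let ?x = "real (card (\<T> k)) - real (card T0) + 1"
    have x1: "?x \<ge> 1" using mono by simp
    have "real N + 1 \<le> real (card (\<T> l)) - real (card T0)" using l by linarith
    also have "\<dots> \<le> Cson * real (card (\<T> k))"
      using card_NVB[OF seq_in marked_sub refine, of k] k by simp
    also have "\<dots> \<le> Cson * (real (card T0) * ?x)"
    proof (intro mult_left_mono)
      have "0 \<le> (real (card T0) - 1) * (?x - 1)" using T0 x1 by (intro mult_nonneg_nonneg) auto
      then show "real (card (\<T> k)) \<le> real (card T0) * ?x" by (simp add: algebra_simps)
    qed (use Cson in simp)
    finally have "(real N + 1) powr s \<le> (Cson * real (card T0) * ?x) powr s"
      using s by (intro powr_mono2) (auto simp: mult.assoc)
    also have "\<dots> = C' * ?x powr s" using Cson T0 x1 by (simp add: C'_def powr_mult)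
    finally have "(real N + 1) powr s * \<eta> (\<T> k) \<le> C' * (\<eta> (\<T> k) * ?x powr s)"
      using mult_right_mono[of "(real N + 1) powr s" "C' * ?x powr s" "\<eta> (\<T> k)"] by (simp add: mult_ac)
    then have "ennreal ((real N + 1) powr s * \<eta> (\<T> k)) \<le> ennreal C' * ennreal (\<eta> (\<T> k) * ?x powr s)"
      by (simp add: C'_def ennreal_leI flip: ennreal_mult)
    also have "\<dots> \<le> ennreal C' * ?alg" by (intro mult_left_mono SUP_upper) auto
    finally show ?thesis using le[OF kN] by (rule order_trans[rotated])
  next
    case False
    have "\<exists>l. \<eta> (\<T> l) = 0"
    proof (rule ccontr)
      assume nz: "\<nexists>l. \<eta> (\<T> l) = 0"
      have grow: "card (\<T> l) + 1 \<le> card (\<T> (Suc l))" for l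
      proof -
        have "\<M> l \<noteq> {}"
        proof
          assume "\<M> l = {}"
          then have "\<theta> * (\<eta> (\<T> l))\<^sup>2 \<le> 0" using marking[of l] by (simp add: bulk_def)
          moreover have "0 < \<theta> * (\<eta> (\<T> l))\<^sup>2" using \<theta> nz by simp
          ultimately show False by linarith
        qed
        then have "\<T> l - \<T> (Suc l) \<noteq> {}" using marked_refined[of l] by blast
        then have "card (\<T> l - \<T> (Suc l)) \<ge> 1"
          using mesh_finite[OF mesh[OF seq_in]] by (simp add: Suc_le_eq card_gt_0_iff)
        then show ?thesis using card_refined[OF seq_in seq_refines[of l "Suc l"]] by simp
      qed
      have "card T0 + l \<le> card (\<T> l)" for l
        by (induction l) (use grow seq0 in \<open>auto intro: order_trans[OF _ grow]\<close>)
      from this[of "Suc N"] have "card (\<T> (Suc N)) > card T0 + N" by simp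
      with False show False by blast
    qed
    then obtain l where l: "\<eta> (\<T> l) = 0" ..
    have "card (\<T> l) \<le> card T0 + N" using False by (metis not_le)
    from le[OF this] show ?thesis by (simp add: l)
  qed
qed

end

section \<open>Equivalence of the two quantities\<close>

text \<open>The distance of \<open>\<theta> * (1 + A)\<close> to \<open>1\<close> is split into halves for \<open>\<delta>\<close> and \<open>\<kappa>0\<close>.\<close>

lemma bulk_parameter_slack:
  fixes \<theta> A :: real
  assumes "0 < \<theta>" "A > 0" "\<theta> < inverse (1 + A)"
  obtains \<delta> \<kappa>0 where "\<delta> > 0" "\<kappa>0 > 0" "\<theta> * (1 + (1 + \<delta>) * A) \<le> 1 - (1 + 1 / \<delta>) * \<kappa>0"
proof -
  have t: "\<theta> * (1 + A) < 1" using assms by (simp add: field_simps)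
  define \<delta> where "\<delta> = (1 - \<theta> * (1 + A)) / (2 * \<theta> * A)"
  define \<kappa>0 where "\<kappa>0 = (1 - \<theta> * (1 + A)) / 2 / (1 + 1 / \<delta>)"
  have \<delta>: "\<delta> > 0" using t assms by (simp add: \<delta>_def)
  have d1: "1 + 1 / \<delta> > 0" using \<delta> by (simp add: add_pos_pos)
  have "\<theta> * (1 + (1 + \<delta>) * A) = \<theta> * (1 + A) + \<delta> * (\<theta> * A)" by (simp add: algebra_simps)
  also have "\<delta> * (\<theta> * A) = (1 - \<theta> * (1 + A)) / 2" using assms by (simp add: \<delta>_def)
  also have "\<theta> * (1 + A) + (1 - \<theta> * (1 + A)) / 2 = 1 - (1 - \<theta> * (1 + A)) / 2" by (simp add: field_simps)
  also have "(1 - \<theta> * (1 + A)) / 2 = (1 + 1 / \<delta>) * \<kappa>0"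
  proof -
    have "e = D * (e / D)" if "D > 0" for D e :: real using that by simp
    from this[OF d1] show ?thesis unfolding \<kappa>0_def .
  qed
  finally show thesis using that[of \<delta> \<kappa>0] \<delta> t d1 by (simp add: \<kappa>0_def)
qed

lemma le_mult_of_le_mult_greater:
  fixes t w r :: real
  assumes "w \<ge> 0" "\<And>b. b > r \<Longrightarrow> t \<le> w * b"
  shows "t \<le> w * r"
proof (cases "w = 0")
  case False
  then have "w > 0" using assms(1) by simp
  have "t / w \<le> r"
  proof (rule dense_ge)
    fix b assume "r < b"
    then have "t \<le> w * b" by (rule assms(2))
    then show "t / w \<le> b" using \<open>w > 0\<close> by (simp add: field_simps)
  qed
  then show ?thesis using \<open>w > 0\<close> by (simp add: divide_le_eq mult.commute)
qed (use assms(2)[of "r + 1"] in simp)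

theorem theorem2:
  fixes P :: "('n::finite) plasticity" and T0 :: "'n mesh"
    and C1 C4 CR Cson Cmesh \<theta> s :: real
  assumes "CARD('n) = 2 \<or> CARD('n) = 3"
    and "plasticity_setting P"
    and "is_mesh (Dom P) T0" and "resolves_boundary P T0"
    and "elementwise_const T0 (hard_tensor P)"
    and "Cson > 0" and "nvb_properties (Dom P) T0 Cson" and "Cmesh > 0"
    and "C1 > 0" and "C4 \<ge> 1" and "CR \<ge> 1"
    and "0 < \<theta>" and "\<theta> < inverse (1 + C1\<^sup>2 * C4\<^sup>2)"
    and "s > 0"
  shows "\<exists>C>0. \<forall>f g u U \<T> \<M>.
    loads P f g \<longrightarrow>
    vi_solution P f g (X_space P) u \<longrightarrow>
    (\<forall>T\<in>refinements T0. vi_solution P f g (X_disc P T) (U T)) \<longrightarrow>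
    (\<forall>T\<in>refinements T0. \<forall>T'\<in>refinements T. \<forall>S. S \<subseteq> T \<inter> T' \<longrightarrow>
       (\<forall>z\<in>X_disc P T. \<forall>z'\<in>X_disc P T'.
          \<bar>eta_on P f g T' z' S - eta_on P f g T z S\<bar> \<le> C1 * stress_dist P z' z)) \<longrightarrow>
    (\<forall>T\<in>refinements T0. \<forall>T'\<in>refinements T. \<exists>R. T - T' \<subseteq> R \<and> R \<subseteq> T \<and>
       real (card R) \<le> CR * real (card (T - T')) \<and>
       (stress_dist P (U T') (U T))\<^sup>2 \<le> C4\<^sup>2 * (\<Sum>K\<in>R. eta_sq P f g T (U T) K)) \<longrightarrow>
    adaptive_sequence P f g \<theta> T0 U \<T> \<M> \<longrightarrow>
    (\<forall>l. real (card (\<T> l)) - real (card T0) \<le> Cmesh * (\<Sum>k<l. real (card (\<M> k)))) \<longrightarrow>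
    (let apx = approx_norm P f g T0 U s;
         alg = (SUP l. ennreal (eta P f g (\<T> l) (U (\<T> l)) *
                  (real (card (\<T> l)) - real (card T0) + 1) powr s))
     in apx \<le> ennreal C * alg \<and> alg \<le> ennreal C * apx)"
proof -
  have n: "CARD('n) \<ge> 2" using assms(1) by auto
  have lip: "lipschitz_domain (Dom P)" using assms(2) by (simp add: plasticity_setting_def)
  obtain \<kappa>C \<kappa>H where k: "\<kappa>C > 0" "coercive_tensor (Dom P) (\<lambda>x. elast P) \<kappa>C"
    "\<kappa>H > 0" "coercive_tensor (Dom P) (hard_tensor P) \<kappa>H"
    using assms(2) unfolding plasticity_setting_def by blast
  obtain L where L: "L > 0" "\<And>\<tau>. norm (elast P \<tau>) \<le> L * norm \<tau>"
    using linear_bounded_pos[OF linear_elast] by blast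
  define c E where "c = \<kappa>C / (2 * L\<^sup>2)" and "E = 1 / (2 * \<kappa>C) + 1 / \<kappa>H"
  have cE: "c > 0" "E \<ge> 0" using k L by (auto simp: c_def E_def)
  have A: "C1\<^sup>2 * C4\<^sup>2 > 0" using assms(9,10) by simp
  obtain \<delta> \<kappa>0 where d: "\<delta> > 0" "\<kappa>0 > 0"
    "\<theta> * (1 + (1 + \<delta>) * (C1\<^sup>2 * C4\<^sup>2)) \<le> 1 - (1 + 1 / \<delta>) * \<kappa>0"
    by (rule bulk_parameter_slack[OF assms(12) A assms(13)])
  define \<mu> where "\<mu> = sqrt \<kappa>0 / (1 + C1 * C4)"
  have C14: "1 + C1 * C4 > 0" using assms(9,10) by (intro add_pos_nonneg) auto
  have \<mu>: "\<mu> > 0" "((1 + C1 * C4) * \<mu>)\<^sup>2 \<le> \<kappa>0" using d(2) C14 by (auto simp: \<mu>_def)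
  have \<theta>1: "\<theta> \<le> 1"
    using assms(13) A inverse_less_1_iff[of "1 + C1\<^sup>2 * C4\<^sup>2"] by linarith
  define \<kappa>' where "\<kappa>' = (1 - sqrt (shrink TYPE('n))) * \<theta>"
  \<comment> \<open>This is the constant of linear convergence of the adaptive sequence below, free of the loads.\<close>
  define Cl where "Cl = 2 / \<kappa>' * (1 + (1 + 2 / \<kappa>') * C1\<^sup>2 * (E * C4\<^sup>2) / c)"
  define W where "W = Cmesh * CR * (1 / \<mu>) powr (1 / s) *
      (Cl powr (1 / (2 * s)) / (1 - (1 - 1 / Cl) powr (1 / (2 * s)))) + (1 + C1 * C4) powr (1 / s)"
  define C where "C = max ((Cson * real (card T0)) powr s) (W powr s)"
  have "card T0 > 0" using is_mesh_nonempty[OF lip assms(3)] mesh_finite[OF assms(3)] by (simp add: card_gt_0_iff)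
  then have C0: "C > 0" using assms(6) by (simp add: C_def less_max_iff_disj)
  show ?thesis
  proof (intro exI[of _ C] conjI allI impI C0)
    fix f g u U \<T> \<M>
    assume fg: "loads P f g"
      and sol: "\<forall>T\<in>refinements T0. vi_solution P f g (X_disc P T) (U T)"
      and A1: "\<forall>T\<in>refinements T0. \<forall>T'\<in>refinements T. \<forall>S. S \<subseteq> T \<inter> T' \<longrightarrow>
       (\<forall>z\<in>X_disc P T. \<forall>z'\<in>X_disc P T'.
          \<bar>eta_on P f g T' z' S - eta_on P f g T z S\<bar> \<le> C1 * stress_dist P z' z)"
      and A4: "\<forall>T\<in>refinements T0. \<forall>T'\<in>refinements T. \<exists>R. T - T' \<subseteq> R \<and> R \<subseteq> T \<and>
       real (card R) \<le> CR * real (card (T - T')) \<and>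
       (stress_dist P (U T') (U T))\<^sup>2 \<le> C4\<^sup>2 * (\<Sum>K\<in>R. eta_sq P f g T (U T) K)"
      and seq: "adaptive_sequence P f g \<theta> T0 U \<T> \<M>"
      and closure: "\<forall>l. real (card (\<T> l)) - real (card T0) \<le> Cmesh * (\<Sum>k<l. real (card (\<M> k)))"
    interpret A: afem P T0 f g U C1 C4 CR Cson
    proof
      show "\<bar>eta_on P f g T' z' S - eta_on P f g T z S\<bar> \<le> C1 * stress_dist P z' z"
        if "T \<in> refinements T0" "T' \<in> refinements T" "S \<subseteq> T \<inter> T'" "z \<in> X_disc P T" "z' \<in> X_disc P T'" for T T' S z z'
        using A1[rule_format, OF that] .
      show "\<exists>R. T - T' \<subseteq> R \<and> R \<subseteq> T \<and> real (card R) \<le> CR * real (card (T - T')) \<and>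
          (stress_dist P (U T') (U T))\<^sup>2 \<le> C4\<^sup>2 * (\<Sum>K\<in>R. eta_sq P f g T (U T) K)"
        if "T \<in> refinements T0" "T' \<in> refinements T" for T T'
        using A4[rule_format, OF that] .
    qed (use assms n fg sol in auto)
    interpret S: afem_sequence P T0 f g U C1 C4 CR Cson \<T> \<M> \<theta> c E
    proof
      fix T S assume T: "T \<in> refinements T0" and S: "S \<in> refinements T"
      have S0: "S \<in> refinements T0" by (rule refinements_trans[OF S T])
      show "c * (stress_dist P (U S) (U T))\<^sup>2 \<le> energy P f g (U T) - energy P f g (U S) \<and>
          energy P f g (U T) - energy P f g (U S) \<le> E * (stress_dist P (U S) (U T))\<^sup>2"
        unfolding c_def E_def
        using energy_gap[OF A.disc[OF T] A.disc[OF S0] descends_finer[OF A.desc[OF T S]] fg A.sol[OF T] A.sol[OF S0] k L]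
        by (rule conjI)
    qed (use assms(12) \<theta>1 seq cE in auto)
    have Cl: "S.Clin = Cl" by (simp add: S.Clin_def Cl_def S.\<kappa>_def \<kappa>'_def)
    let ?apx = "approx_norm P f g T0 U s"
    let ?t = "\<lambda>l. eta P f g (\<T> l) (U (\<T> l)) * (real (card (\<T> l)) - real (card T0) + 1) powr s"
    let ?alg = "SUP l. ennreal (?t l)"
    have lower: "?apx \<le> ennreal C * ?alg"
    proof -
      have "?apx \<le> ennreal ((Cson * real (card T0)) powr s) * ?alg" by (rule S.apx_le_alg[OF assms(14,6)])
      also have "\<dots> \<le> ennreal C * ?alg" by (intro mult_right_mono ennreal_leI) (auto simp: C_def)
      finally show ?thesis .
    qed
    have upper: "?alg \<le> ennreal C * ?apx"
    proof (cases "?apx = \<infinity>")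
      case True
      then show ?thesis using C0 by (simp add: ennreal_mult_top)
    next
      case False
      then obtain r where r: "?apx = ennreal r" "r \<ge> 0" by (cases ?apx) auto
      have "?t l \<le> W powr s * r" for l
      proof (rule le_mult_of_le_mult_greater)
        fix b assume b: "b > r"
        have "?apx < ennreal b" "b > 0" using r b by (auto simp: ennreal_less_iff)
        from S.alg_le_apx[OF assms(14) this d(1,3) \<mu> assms(8) closure[rule_format]]
        show "?t l \<le> W powr s * b" unfolding W_def Cl .
      qed simp
      moreover have "W powr s * r \<le> C * r" using r(2) by (intro mult_right_mono) (auto simp: C_def)
      ultimately have "?t l \<le> C * r" for l by (meson order_trans)
      then have "?alg \<le> ennreal (C * r)" by (intro SUP_least ennreal_leI)
      then show ?thesis using r C0 by (simp add: ennreal_mult)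
    qed
    show "let apx = ?apx; alg = ?alg in apx \<le> ennreal C * alg \<and> alg \<le> ennreal C * apx"
      using lower upper by (simp add: Let_def)
  qed
qed

end
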